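(* Let $b=b(n)$ be positive integers with $b/\log n\to\infty$ as $n\to\infty$, let $\gamma>1.5$ be a constant, let $x$ be a complex random variable with mean $0$ and variance $1$ (not depending on $n$), and let $\Phi_n$ be an $n\times n$ random matrix whose entries are iid copies of $x/\sqrt n$ (so each entry has mean $0$ and variance $1/n$). Then the empirical spectral distribution of $T_{b,n}+n^{-\gamma}\Phi_n$ converges in probability, as $n\to\infty$, to the uniform probability measure on the unit circle $\{z\in\mathbb C:|z|=1\}$. In particular (taking $b=n-1$), the empirical spectral distribution of $T_n+n^{-\gamma}\Phi_n$ converges in probability to the uniform probability measure on the unit circle.
   Context: $T_k$ denotes the $k\times k$ matrix with entries $1$ in positions $(i,i+1)$, $1\le i\le k-1$, and $0$ elsewhere. For a positive integer $b$, $T_{b,n}$ is the $n\times n$ block diagonal matrix with $\lfloor n/(b+1)\rfloor$ consecutive diagonal blocks equal to $T_{b+1}$, followed, if $k=n-\lfloor n/(b+1)\rfloor(b+1)>0$, by one last diagonal block equal to $T_k$. The empirical spectral distribution of an $n\times n$ complex matrix $A$ with eigenvalues $\lambda_1,\dots,\lambda_n$ (with multiplicity) is $\mu_A=\frac1n\sum_{j=1}^n\delta_{\lambda_j}$. $\mu_{A_n}$ converges in probability to a probability measure $\mu$ on $\mathbb C$ if for every smooth compactly supported $g:\mathbb C\to\mathbb C$, $\int g\,d\mu_{A_n}\to\int g\,d\mu$ in probability. The variance of a mean-zero complex random variable $x$ is $\mathbb E|x|^2$. *)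

theory Defs
  imports
    "HOL-Probability.Probability"
    "HOL-Computational_Algebra.Computational_Algebra"
    "Jordan_Normal_Form.Char_Poly"
begin

definition shift_mat :: "nat \<Rightarrow> complex mat" where
  "shift_mat k = Matrix.mat k k (\<lambda>(i, j). if j = i + 1 then 1 else 0)"

definition block_shift_mat :: "nat \<Rightarrow> nat \<Rightarrow> complex mat" where
  "block_shift_mat b n =
     (let q = n div (b + 1); k = n - q * (b + 1)
      in diag_block_mat
           (replicate q (shift_mat (b + 1)) @ (if k > 0 then [shift_mat k] else [])))"

(* The multiset of roots of the characteristic polynomial lists the eigenvalues with algebraic
   multiplicity.  The push-forward along the identity only replaces the discrete sigma-algebra
   of the pmf by the Borel one.  The 0 x 0 matrix has no eigenvalues, and its esd is a
   meaningless default value. *)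
definition esd :: "complex mat \<Rightarrow> complex measure" where
  "esd A = distr (measure_pmf (pmf_of_multiset (proots (char_poly A)))) borel (\<lambda>z. z)"

definition uniform_circle :: "complex measure" where
  "uniform_circle = distr (uniform_measure lborel {0..2 * pi}) borel cis"

(* Differentiability is over the reals here: "differentiable" and "frechet_derivative" refer
   to real-linear derivatives of maps from the plane to itself, so C^k functions need not be
   holomorphic. *)
primrec Ck_plane :: "nat \<Rightarrow> (complex \<Rightarrow> complex) \<Rightarrow> bool" where
  "Ck_plane 0 g \<longleftrightarrow> continuous_on UNIV g"
| "Ck_plane (Suc k) g \<longleftrightarrow>
     (\<forall>z. g differentiable (at z)) \<and> (\<forall>v. Ck_plane k (\<lambda>z. frechet_derivative g (at z) v))"

definition test_function :: "(complex \<Rightarrow> complex) \<Rightarrow> bool" where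
  "test_function g \<longleftrightarrow> (\<forall>k. Ck_plane k g) \<and> compact (closure {z. g z \<noteq> 0})"

(* Each Y n may live on its own probability space.  Measurability is demanded explicitly,
   since "measure" is 0 on non-measurable sets. *)
definition converges_in_prob ::
  "(nat \<Rightarrow> 'a measure) \<Rightarrow> (nat \<Rightarrow> 'a \<Rightarrow> complex) \<Rightarrow> complex \<Rightarrow> bool" where
  "converges_in_prob M Y c \<longleftrightarrow>
     (\<forall>n. Y n \<in> borel_measurable (M n)) \<and>
     (\<forall>\<epsilon>>0. (\<lambda>n. measure (M n) {\<omega> \<in> space (M n). dist (Y n \<omega>) c > \<epsilon>}) \<longlonglongrightarrow> 0)"

definition esd_converges_in_prob ::
  "(nat \<Rightarrow> 'a measure) \<Rightarrow> (nat \<Rightarrow> 'a \<Rightarrow> complex mat) \<Rightarrow> complex measure \<Rightarrow> bool" where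
  "esd_converges_in_prob M A \<mu> \<longleftrightarrow>
     (\<forall>g. test_function g \<longrightarrow>
        converges_in_prob M (\<lambda>n \<omega>. \<integral>z. g z \<partial>esd (A n \<omega>)) (\<integral>z. g z \<partial>\<mu>))"

definition iid_matrix ::
  "'a measure \<Rightarrow> nat \<Rightarrow> ('a \<Rightarrow> complex mat) \<Rightarrow> complex measure \<Rightarrow> bool" where
  "iid_matrix M n \<Phi> D \<longleftrightarrow>
     (\<forall>\<omega>\<in>space M. \<Phi> \<omega> \<in> carrier_mat n n) \<and>
     prob_space.indep_vars M (\<lambda>_. borel) (\<lambda>ij \<omega>. \<Phi> \<omega> $$ ij) ({..<n} \<times> {..<n}) \<and>
     (\<forall>i<n. \<forall>j<n. distr M borel (\<lambda>\<omega>. \<Phi> \<omega> $$ (i, j)) = D)"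

end

theory Submission
  imports Defs "Jordan_Normal_Form.Schur_Decomposition"
begin

text \<open>
Write the matrix as \<open>T + E\<close> with \<open>T\<close> the block shift and \<open>E\<close> the scaled noise.

Where the eigenvalues lie is decided by three elementary facts. The Hilbert-Schmidt norm of \<open>E\<close>
tends to \<open>0\<close> in probability (Markov's inequality, \<open>perturbation_hs_small\<close>), and \<open>T\<close> is a contraction,
so all eigenvalues have modulus at most \<open>1 + o(1)\<close>. The positive powers of \<open>T\<close> are traceless, so every
fixed power sum of the eigenvalues is \<open>o(n)\<close> (\<open>trace_perturbed_subshift_pow\<close>). Finally, if
\<open>\<bar>det (T + E)\<bar> \<ge> exp (- o(n))\<close>, the moduli, which are almost bounded by \<open>1\<close>, have product at least
\<open>exp (- o(n))\<close>, and all but \<open>o(n)\<close> eigenvalues must be close to the unit circle. There conjugate powers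
are inverse powers, so the vanishing power sums are the Weyl criterion for the uniform distribution
(\<open>equidistribution_criterion\<close>).

All the probability is in the lower bound for the determinant. Only the rows that end a block vanish in
\<open>T\<close>. After a reordering of rows and columns, \<open>T\<close> has an identity block in the upper left corner and
\<open>m = O(n / b + 1)\<close> further rows (\<open>block_shift_reordering\<close>). The perturbed identity block has a
determinant of modulus at least \<open>exp (- o(n))\<close>. The other rows are revealed one
at a time, and the largest minor of the rows revealed so far is followed. If \<open>k\<close> rows have been
revealed, a new entry outside the columns of the best minor enters a larger minor affinely, with the best minor as slope; there are \<open>n - k\<close> such entries, and they fail
independently of each other to produce a minor of size \<open>n powr (- O(1))\<close> times the old one, so a step
fails with probability exponentially small in \<open>n - k\<close> (\<open>greedy_step\<close>). Since \<open>m * ln n = o(n)\<close>, which is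
what \<open>b / ln n \<longrightarrow> \<infinity>\<close> gives, the total loss in these steps is \<open>exp (- o(n))\<close>.

A bounded number \<open>d\<close> of last steps is left. There the new determinant is a linear form in the new row
whose coefficients are the cofactors. At least \<open>K\<close> of them are within a factor \<open>n powr (- O(K))\<close> of the
largest one, for otherwise fewer than \<open>K\<close> columns would be nearly dependent, which the greedy argument
applied to columns rules out (\<open>cofactors_spread\<close>). So a weak form of the Littlewood-Offord inequality,
with a bound that tends to \<open>0\<close> as \<open>K\<close> grows, finishes the proof (\<open>weak_littlewood_offord\<close>,
\<open>spread_step\<close>). Losses of polynomial size are harmless in a bounded number of steps. Letting first
\<open>n\<close>, then \<open>K\<close>, then \<open>d\<close> tend to infinity makes all exceptional probabilities vanish.
\<close>

section \<open>Hilbert-Schmidt norms and perturbed shifts\<close>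

definition hs_norm :: "complex mat \<Rightarrow> real" where
  "hs_norm A = L2_set (\<lambda>ij. cmod (A $$ ij)) ({..<dim_row A} \<times> {..<dim_col A})"

definition mat_trace :: "complex mat \<Rightarrow> complex" where
  "mat_trace A = (\<Sum>i<dim_row A. A $$ (i, i))"

lemma hs_norm_nonneg [simp]: "0 \<le> hs_norm A"
  by (simp add: hs_norm_def)

lemma hs_norm_sq: "(hs_norm A)\<^sup>2 = (\<Sum>i<dim_row A. \<Sum>j<dim_col A. (cmod (A $$ (i,j)))\<^sup>2)"
  by (simp add: hs_norm_def L2_set_def sum.cartesian_product' sum_nonneg)

lemma norm_entry_le_hs_norm:
  assumes "i < dim_row A" "j < dim_col A"
  shows "cmod (A $$ (i, j)) \<le> hs_norm A"
  unfolding hs_norm_def using assms by (intro member_le_L2_set) auto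

lemma hs_norm_add:
  assumes "A \<in> carrier_mat n m" "B \<in> carrier_mat n m"
  shows "hs_norm (A + B) \<le> hs_norm A + hs_norm B"
proof -
  have "hs_norm (A + B) = L2_set (\<lambda>ij. cmod (A $$ ij + B $$ ij)) ({..<n} \<times> {..<m})"
    unfolding hs_norm_def using assms by (intro L2_set_cong) auto
  also have "\<dots> \<le> L2_set (\<lambda>ij. cmod (A $$ ij) + cmod (B $$ ij)) ({..<n} \<times> {..<m})"
    by (intro L2_set_mono norm_triangle_ineq) auto
  also have "\<dots> \<le> hs_norm A + hs_norm B"
    using L2_set_triangle_ineq assms by (auto simp: hs_norm_def)
  finally show ?thesis .
qed

lemma index_mult_mat_sum:
  assumes "A \<in> carrier_mat n k" "B \<in> carrier_mat k m" "i < n" "j < m"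
  shows "(A * B) $$ (i, j) = (\<Sum>l<k. A $$ (i, l) * B $$ (l, j))"
  using assms by (auto simp: scalar_prod_def lessThan_atLeast0 intro!: sum.cong)

lemma hs_norm_mult:
  assumes A: "A \<in> carrier_mat n k" and B: "B \<in> carrier_mat k m"
  shows "hs_norm (A * B) \<le> hs_norm A * hs_norm B"
proof (rule power2_le_imp_le)
  let ?r = "\<lambda>i. \<Sum>l<k. (cmod (A $$ (i,l)))\<^sup>2" and ?c = "\<lambda>j. \<Sum>l<k. (cmod (B $$ (l,j)))\<^sup>2"
  have entry: "(cmod ((A * B) $$ (i,j)))\<^sup>2 \<le> ?r i * ?c j" if "i < n" "j < m" for i j
  proof -
    have "cmod ((A * B) $$ (i,j)) \<le> (\<Sum>l<k. \<bar>cmod (A $$ (i,l))\<bar> * \<bar>cmod (B $$ (l,j))\<bar>)"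
      unfolding index_mult_mat_sum[OF A B that] by (rule order_trans[OF norm_sum]) (simp add: norm_mult)
    also have "\<dots> \<le> L2_set (\<lambda>l. cmod (A $$ (i,l))) {..<k} * L2_set (\<lambda>l. cmod (B $$ (l,j))) {..<k}"
      by (rule L2_set_mult_ineq)
    finally have "(cmod ((A * B) $$ (i,j)))\<^sup>2 \<le>
        (L2_set (\<lambda>l. cmod (A $$ (i,l))) {..<k} * L2_set (\<lambda>l. cmod (B $$ (l,j))) {..<k})\<^sup>2"
      by (intro power_mono) auto
    then show ?thesis by (simp add: power_mult_distrib L2_set_def sum_nonneg)
  qed
  have "(hs_norm (A * B))\<^sup>2 \<le> (\<Sum>i<n. \<Sum>j<m. ?r i * ?c j)"
    unfolding hs_norm_sq using A B entry by (auto intro!: sum_mono)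
  also have "\<dots> = (\<Sum>i<n. ?r i) * (\<Sum>j<m. ?c j)"
    by (simp add: sum_product)
  also have "(\<Sum>j<m. ?c j) = (\<Sum>l<k. \<Sum>j<m. (cmod (B $$ (l,j)))\<^sup>2)" by (rule sum.swap)
  finally show "(hs_norm (A * B))\<^sup>2 \<le> (hs_norm A * hs_norm B)\<^sup>2"
    using A B by (simp add: power_mult_distrib hs_norm_sq)
qed simp

text \<open>Every block shift belongs to this class. Only two properties of a block shift matter for the upper
bounds: it is a contraction, and it is nilpotent with traceless powers. Both follow from these entrywise
bounds.\<close>
definition subshift :: "nat \<Rightarrow> complex mat \<Rightarrow> bool" where
  "subshift n T \<longleftrightarrow> T \<in> carrier_mat n n \<and>
     (\<forall>i<n. \<forall>j<n. cmod (T $$ (i, j)) \<le> (if j = Suc i then 1 else 0))"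

lemma subshift_zero: "subshift n T \<Longrightarrow> i < n \<Longrightarrow> j < n \<Longrightarrow> j \<noteq> Suc i \<Longrightarrow> T $$ (i, j) = 0"
  unfolding subshift_def by (metis norm_le_zero_iff)

lemma subshift_le_1: "subshift n T \<Longrightarrow> i < n \<Longrightarrow> j < n \<Longrightarrow> cmod (T $$ (i, j)) \<le> 1"
  unfolding subshift_def by (rule order_trans[of _ "if j = Suc i then 1 else 0"]) auto

lemma hs_norm_subshift_mult:
  assumes T: "subshift n T" and X: "X \<in> carrier_mat n m"
  shows "hs_norm (T * X) \<le> hs_norm X"
proof (rule power2_le_imp_le)
  have Tc: "T \<in> carrier_mat n n" using T by (simp add: subshift_def)
  have entry: "(cmod ((T * X) $$ (i,j)))\<^sup>2 \<le> (if Suc i < n then (cmod (X $$ (Suc i, j)))\<^sup>2 else 0)"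
    if "i < n" "j < m" for i j
  proof (cases "Suc i < n")
    case True
    have "(T * X) $$ (i,j) = (\<Sum>l<n. if l = Suc i then T $$ (i, Suc i) * X $$ (Suc i, j) else 0)"
      unfolding index_mult_mat_sum[OF Tc X that]
      using subshift_zero[OF T that(1)] by (intro sum.cong) auto
    also have "\<dots> = T $$ (i, Suc i) * X $$ (Suc i, j)" using True by simp
    finally have "cmod ((T * X) $$ (i,j)) \<le> 1 * cmod (X $$ (Suc i, j))"
      using subshift_le_1[OF T that(1) True] by (auto simp: norm_mult intro: mult_left_le_one_le)
    then show ?thesis using True by (simp add: power_mono)
  next
    case False
    have "(T * X) $$ (i,j) = 0"
      unfolding index_mult_mat_sum[OF Tc X that]
      using subshift_zero[OF T that(1)] False by (intro sum.neutral) (metis lessThan_iff mult_zero_left)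
    then show ?thesis using False by simp
  qed
  have shift: "(\<Sum>i<n. if Suc i < n then f (Suc i) else 0) \<le> (\<Sum>i<n. f i)"
    if f: "\<And>i. (0::real) \<le> f i" for f
  proof (cases n)
    case (Suc k)
    have "(\<Sum>i<n. if Suc i < n then f (Suc i) else 0) = (\<Sum>i<k. f (Suc i))"
      by (simp add: Suc)
    also have "\<dots> \<le> (\<Sum>i<n. f i)" using f by (simp add: Suc sum.lessThan_Suc_shift del: sum.lessThan_Suc)
    finally show ?thesis .
  qed simp
  have "(hs_norm (T * X))\<^sup>2 \<le> (\<Sum>i<n. if Suc i < n then \<Sum>j<m. (cmod (X $$ (Suc i, j)))\<^sup>2 else 0)"
  proof -
    have "(\<Sum>j<m. (cmod ((T * X) $$ (i, j)))\<^sup>2)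
        \<le> (if Suc i < n then \<Sum>j<m. (cmod (X $$ (Suc i, j)))\<^sup>2 else 0)" if "i < n" for i
      using sum_mono[of "{..<m}", OF entry[OF that]] by (cases "Suc i < n") auto
    then show ?thesis unfolding hs_norm_sq using Tc X
      by (simp del: index_mult_mat(1)) (intro sum_mono, simp)
  qed
  also have "\<dots> \<le> (\<Sum>i<n. \<Sum>j<m. (cmod (X $$ (i, j)))\<^sup>2)"
    by (rule shift) (auto intro: sum_nonneg)
  finally show "(hs_norm (T * X))\<^sup>2 \<le> (hs_norm X)\<^sup>2"
    unfolding hs_norm_sq using X by simp
qed simp

lemma hs_norm_mult_subshift:
  assumes T: "subshift n T" and X: "X \<in> carrier_mat m n"
  shows "hs_norm (X * T) \<le> hs_norm X"
proof (rule power2_le_imp_le)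
  have Tc: "T \<in> carrier_mat n n" using T by (simp add: subshift_def)
  have entry: "(cmod ((X * T) $$ (i,j)))\<^sup>2 \<le> (if j = 0 then 0 else (cmod (X $$ (i, j - 1)))\<^sup>2)"
    if "i < m" "j < n" for i j
  proof (cases j)
    case (Suc k)
    have "(X * T) $$ (i,j) = (\<Sum>l<n. if l = k then X $$ (i, k) * T $$ (k, j) else 0)"
      unfolding index_mult_mat_sum[OF X Tc that]
      using subshift_zero[OF T _ that(2)] Suc by (intro sum.cong) auto
    also have "\<dots> = X $$ (i, k) * T $$ (k, j)" using Suc that by simp
    finally have "cmod ((X * T) $$ (i,j)) \<le> cmod (X $$ (i, k)) * 1"
      using subshift_le_1[OF T _ that(2), of k] Suc that by (auto simp: norm_mult intro: mult_left_le)
    then show ?thesis using Suc by (simp add: power_mono)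
  next
    case 0
    have "(X * T) $$ (i,j) = 0"
      unfolding index_mult_mat_sum[OF X Tc that]
      using subshift_zero[OF T _ that(2)] 0 by (intro sum.neutral) auto
    then show ?thesis using 0 by simp
  qed
  have shift: "(\<Sum>j<n. if j = 0 then 0 else f (j - 1)) \<le> (\<Sum>j<n. f j)"
    if f: "\<And>i. (0::real) \<le> f i" for f
    using f by (cases n) (simp_all add: sum.lessThan_Suc_shift[of "\<lambda>j. if j = 0 then 0 else f (j - 1)"]
        del: sum.lessThan_Suc, simp)
  have "(hs_norm (X * T))\<^sup>2 \<le> (\<Sum>i<m. \<Sum>j<n. if j = 0 then 0 else (cmod (X $$ (i, j - 1)))\<^sup>2)"
    unfolding hs_norm_sq using Tc X entry by (auto intro!: sum_mono)
  also have "\<dots> \<le> (\<Sum>i<m. \<Sum>j<n. (cmod (X $$ (i, j)))\<^sup>2)"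
    by (intro sum_mono shift) auto
  finally show "(hs_norm (X * T))\<^sup>2 \<le> (hs_norm X)\<^sup>2"
    unfolding hs_norm_sq using X by simp
qed simp

lemma mat_trace_comm:
  assumes A: "A \<in> carrier_mat n m" and B: "B \<in> carrier_mat m n"
  shows "mat_trace (A * B) = mat_trace (B * A)"
proof -
  have "mat_trace (A * B) = (\<Sum>i<n. \<Sum>l<m. A $$ (i, l) * B $$ (l, i))"
    using A B by (simp add: mat_trace_def index_mult_mat_sum[OF A B] del: index_mult_mat(1))
  also have "\<dots> = (\<Sum>l<m. \<Sum>i<n. A $$ (i, l) * B $$ (l, i))" by (rule sum.swap)
  also have "\<dots> = mat_trace (B * A)"
    using A B by (simp add: mat_trace_def index_mult_mat_sum[OF B A] mult.commute del: index_mult_mat(1))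
  finally show ?thesis .
qed

lemma norm_mat_trace_le:
  assumes "A \<in> carrier_mat n n"
  shows "cmod (mat_trace A) \<le> sqrt n * hs_norm A"
proof -
  have "cmod (mat_trace A) \<le> (\<Sum>i<n. \<bar>1\<bar> * \<bar>cmod (A $$ (i, i))\<bar>)"
    using assms by (simp add: mat_trace_def sum_norm_le)
  also have "\<dots> \<le> L2_set (\<lambda>i. 1) {..<n} * L2_set (\<lambda>i. cmod (A $$ (i, i))) {..<n}"
    by (rule L2_set_mult_ineq)
  also have "L2_set (\<lambda>i. cmod (A $$ (i, i))) {..<n} \<le> hs_norm A"
  proof -
    have "(\<Sum>i<n. (cmod (A $$ (i, i)))\<^sup>2) \<le> (\<Sum>i<n. \<Sum>j<n. (cmod (A $$ (i, j)))\<^sup>2)"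
      by (intro sum_mono member_le_sum) auto
    also have "\<dots> = (hs_norm A)\<^sup>2" using assms by (simp add: hs_norm_sq)
    finally show ?thesis unfolding L2_set_def by (rule real_le_lsqrt[OF hs_norm_nonneg])
  qed
  finally show ?thesis by (simp add: L2_set_def mult_left_mono)
qed

lemma upper_triangular_pow:
  assumes B: "B \<in> carrier_mat n n" and ut: "upper_triangular B"
  shows "upper_triangular (B ^\<^sub>m k) \<and> (\<forall>i<n. (B ^\<^sub>m k) $$ (i, i) = ((B :: complex mat) $$ (i, i)) ^ k)"
proof (induction k)
  case 0
  then show ?case using B by auto
next
  case (Suc k)
  let ?C = "B ^\<^sub>m k"
  have C: "?C \<in> carrier_mat n n" using B by simp
  have lowC: "?C $$ (i, j) = 0" if "j < i" "i < n" for i j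
    using Suc C that by (auto simp: upper_triangular_def)
  have lowB: "B $$ (i, j) = 0" if "j < i" "i < n" for i j
    using ut B that by (auto simp: upper_triangular_def)
  have "(?C * B) $$ (i, j) = (if i = j then B $$ (i,i) ^ Suc k else 0)" if ij: "j \<le> i" "i < n" for i j
  proof -
    have "(?C * B) $$ (i, j) = (\<Sum>l<n. if l = i then (if i = j then ?C $$ (i,i) * B $$ (i,i) else 0) else 0)"
      unfolding index_mult_mat_sum[OF C B ij(2) le_less_trans[OF ij]]
    proof (intro sum.cong refl)
      fix l assume "l \<in> {..<n}"
      then show "?C $$ (i, l) * B $$ (l, j) = (if l = i then (if i = j then ?C $$ (i,i) * B $$ (i,i) else 0) else 0)"
        using lowC[of l i] lowB[of j l] ij by (cases "l < i"; cases "l = i"; auto)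
    qed
    also have "\<dots> = (if i = j then B $$ (i,i) ^ Suc k else 0)" using ij Suc by simp
    finally show ?thesis .
  qed
  then show ?case using C B by (auto simp: upper_triangular_def)
qed

text \<open>The Schur form shows the eigenvalues with multiplicity on the diagonal of a triangular matrix, where
the determinant and all power traces can be read off.\<close>
lemma spectrum_list:
  assumes A: "A \<in> carrier_mat n n"
  obtains es where "length es = n" "proots (char_poly A) = mset es" "det A = prod_list es"
    "\<forall>k. mat_trace (A ^\<^sub>m k) = (\<Sum>e\<leftarrow>es. e ^ k)"
proof -
  have "lead_coeff (char_poly A) = 1" using degree_monic_char_poly[OF A] by simp
  then have prod: "(\<Prod>x\<in>#proots (char_poly A). [:-x, 1:]) = char_poly A"
    using complex_poly_decompose_multiset[of "char_poly A"] by simp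
  obtain es where es: "mset es = proots (char_poly A)" using ex_mset by blast
  then have cp: "char_poly A = (\<Prod>e\<leftarrow>es. [:- e, 1:])"
    using prod by (metis mset_map prod_mset_prod_list)
  obtain B P Q where "schur_decomposition A es = (B, P, Q)" by (metis prod_cases3)
  from schur_decomposition[OF A cp this]
  have wit: "similar_mat_wit A B P Q" and ut: "upper_triangular B" and dg: "diag_mat B = es" by auto
  from similar_mat_witD2[OF A wit]
  have QP: "Q * P = 1\<^sub>m n" and B: "B \<in> carrier_mat n n"
    and P: "P \<in> carrier_mat n n" and Q: "Q \<in> carrier_mat n n" by auto
  have len: "length es = n" using dg B by (auto simp: diag_mat_def)
  have "det A = det B" using wit by (intro det_similar) (auto simp: similar_mat_def)
  also have "\<dots> = prod_list es" using det_upper_triangular[OF ut B] dg by simp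
  finally have det: "det A = prod_list es" .
  have tr: "mat_trace (A ^\<^sub>m k) = (\<Sum>e\<leftarrow>es. e ^ k)" for k
  proof -
    have Bk: "B ^\<^sub>m k \<in> carrier_mat n n" using B by simp
    have "mat_trace (A ^\<^sub>m k) = mat_trace (P * B ^\<^sub>m k * Q)"
      using similar_mat_wit_pow_id[OF wit] by simp
    also have "\<dots> = mat_trace (Q * (P * B ^\<^sub>m k))"
      by (rule mat_trace_comm) (use P Bk Q in auto)
    also have "Q * (P * B ^\<^sub>m k) = B ^\<^sub>m k"
      using assoc_mult_mat[OF Q P Bk] left_mult_one_mat[OF Bk] unfolding QP by simp
    also have "mat_trace (B ^\<^sub>m k) = (\<Sum>i<n. (B $$ (i, i)) ^ k)"
      using upper_triangular_pow[OF B ut] Bk B by (simp add: mat_trace_def)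
    also have "\<dots> = (\<Sum>e\<leftarrow>diag_mat B. e ^ k)"
      using B by (simp add: diag_mat_def comp_def interv_sum_list_conv_sum_set_nat lessThan_atLeast0)
    finally show ?thesis using dg by simp
  qed
  show thesis using that[OF len es[symmetric] det] tr by blast
qed

text \<open>An eigenvector, read as a matrix with one column, is stretched by the modulus of its eigenvalue. In
this way bounds for the operator norm can be stated with the Hilbert-Schmidt norm of columns alone.\<close>
lemma eigenvalue_hs_bound:
  assumes A: "A \<in> carrier_mat n n" and e: "e \<in># proots (char_poly A)"
    and bound: "\<And>V. V \<in> carrier_mat n 1 \<Longrightarrow> hs_norm (A * V) \<le> c * hs_norm V"
  shows "cmod e \<le> c"
proof -
  have "char_poly A \<noteq> 0" using degree_monic_char_poly[OF A] by auto
  then have "eigenvalue A e" using e eigenvalue_root_char_poly[OF A] by simp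
  then obtain v where v: "v \<in> carrier_vec n" "v \<noteq> 0\<^sub>v n" "A *\<^sub>v v = e \<cdot>\<^sub>v v"
    using A by (auto simp: eigenvalue_def eigenvector_def)
  define V where "V = mat n 1 (\<lambda>(i, j). v $ i)"
  have V: "V \<in> carrier_mat n 1" by (simp add: V_def)
  have col: "col V 0 = v" using v by (auto simp: V_def)
  have entry: "(A * V) $$ (i, 0) = e * V $$ (i, 0)" if "i < n" for i
  proof -
    have "(A * V) $$ (i, 0) = (A *\<^sub>v v) $ i" using A V that by (simp add: col)
    also have "\<dots> = e * V $$ (i, 0)" using v that by (simp add: V_def)
    finally show ?thesis .
  qed
  have "(hs_norm (A * V))\<^sup>2 = (cmod e * hs_norm V)\<^sup>2"
    unfolding power_mult_distrib hs_norm_sq using A V entry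
    by (simp add: norm_mult power_mult_distrib sum_distrib_left del: index_mult_mat(1))
  then have eq: "hs_norm (A * V) = cmod e * hs_norm V" by simp
  obtain i where "i < n" "v $ i \<noteq> 0" using v by (metis carrier_vecD eq_vecI index_zero_vec)
  then have "0 < cmod (V $$ (i, 0))" by (simp add: V_def)
  also have "\<dots> \<le> hs_norm V" using V \<open>i < n\<close> by (intro norm_entry_le_hs_norm) auto
  finally show ?thesis using bound[OF V] eq by simp
qed

lemma spectral_bound_perturbed_subshift:
  assumes T: "subshift n T" and E: "E \<in> carrier_mat n n" and e: "e \<in># proots (char_poly (T + E))"
  shows "cmod e \<le> 1 + hs_norm E"
proof (rule eigenvalue_hs_bound[OF _ e])
  have Tc: "T \<in> carrier_mat n n" using T by (simp add: subshift_def)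
  show "T + E \<in> carrier_mat n n" using E by simp
  fix V :: "complex mat" assume V: "V \<in> carrier_mat n 1"
  have "(T + E) * V = T * V + E * V" by (rule add_mult_distrib_mat[OF Tc E V])
  then have "hs_norm ((T + E) * V) \<le> hs_norm (T * V) + hs_norm (E * V)"
    using hs_norm_add[of "T * V" n 1 "E * V"] Tc E V by simp
  also have "\<dots> \<le> hs_norm V + hs_norm E * hs_norm V"
    by (intro add_mono hs_norm_subshift_mult[OF T V] hs_norm_mult[OF E V])
  finally show "hs_norm ((T + E) * V) \<le> (1 + hs_norm E) * hs_norm V" by (simp add: algebra_simps)
qed

text \<open>Each eigenvalue of \<open>1 + E\<close> differs from \<open>1\<close> by an eigenvalue of \<open>E\<close>, and the determinant is the product
of the eigenvalues.\<close>
lemma det_near_identity: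
  assumes E: "E \<in> carrier_mat n n" and h: "hs_norm E \<le> 1"
  shows "(1 - hs_norm E) ^ n \<le> cmod (det (1\<^sub>m n + E))"
proof -
  define A where "A = 1\<^sub>m n + E"
  have A: "A \<in> carrier_mat n n" using E by (simp add: A_def)
  obtain es where len: "length es = n" and pr: "proots (char_poly A) = mset es"
    and det: "det A = prod_list es" and "\<forall>k. mat_trace (A ^\<^sub>m k) = (\<Sum>e\<leftarrow>es. e ^ k)"
    by (rule spectrum_list[OF A])
  have "1 - hs_norm E \<le> cmod e" if e: "e \<in> set es" for e
  proof -
    have "char_poly A \<noteq> 0" using degree_monic_char_poly[OF A] by auto
    moreover have "e \<in># proots (char_poly A)" using e pr by simp
    ultimately have "eigenvalue A e" using eigenvalue_root_char_poly[OF A] by simp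
    then obtain v where v: "v \<in> carrier_vec n" "v \<noteq> 0\<^sub>v n" "A *\<^sub>v v = e \<cdot>\<^sub>v v"
      using A by (auto simp: eigenvalue_def eigenvector_def)
    have "E *\<^sub>v v = (e - 1) \<cdot>\<^sub>v v"
    proof (intro eq_vecI)
      fix i assume "i < dim_vec ((e - 1) \<cdot>\<^sub>v v)"
      then have i: "i < n" using v by simp
      have "A *\<^sub>v v = v + E *\<^sub>v v"
        unfolding A_def using v E by (simp add: add_mult_distrib_mat_vec[of _ n n])
      then have "v $ i + (E *\<^sub>v v) $ i = e * v $ i" using v i E
        by (metis carrier_matD(1) carrier_vecD dim_mult_mat_vec index_add_vec(1) index_smult_vec(1))
      then show "(E *\<^sub>v v) $ i = ((e - 1) \<cdot>\<^sub>v v) $ i" using v i by (simp add: algebra_simps)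
    qed (use v E in auto)
    then have "eigenvalue E (e - 1)" using v E by (auto simp: eigenvalue_def eigenvector_def)
    moreover have "char_poly E \<noteq> 0" using degree_monic_char_poly[OF E] by auto
    ultimately have "e - 1 \<in># proots (char_poly E)" using eigenvalue_root_char_poly[OF E] by simp
    from eigenvalue_hs_bound[OF E this hs_norm_mult[OF E]]
    have "cmod (e - 1) \<le> hs_norm E" .
    then show ?thesis using norm_triangle_ineq2[of 1 "1 - e"] by (simp add: norm_minus_commute)
  qed
  then have "(1 - hs_norm E) ^ length es \<le> (\<Prod>e\<leftarrow>es. cmod e)"
    using h
  proof (induction es)
    case (Cons a es)
    then show ?case by (auto intro!: mult_mono)
  qed simp
  also have "\<dots> = cmod (prod_list es)" by (induction es) (auto simp: norm_mult)
  finally show ?thesis using len det by (simp add: A_def)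
qed

lemma trace_subshift_pow:
  assumes T: "subshift n T" and k: "k > 0"
  shows "mat_trace (T ^\<^sub>m k) = 0"
proof -
  have Tc: "T \<in> carrier_mat n n" using T by (simp add: subshift_def)
  have "\<forall>i<n. \<forall>j<n. j < i + k \<longrightarrow> (T ^\<^sub>m k) $$ (i, j) = 0" for k
  proof (induction k)
    case 0 then show ?case using Tc by auto
  next
    case (Suc k)
    have C: "T ^\<^sub>m k \<in> carrier_mat n n" using Tc by simp
    have "(T ^\<^sub>m k) $$ (i, l) * T $$ (l, j) = 0" if "i < n" "j < n" "l < n" "j < i + Suc k" for i j l
      using Suc subshift_zero[OF T, of l j] that by (cases "l < i + k") auto
    then show ?case
      by (auto simp: index_mult_mat_sum[OF C Tc] simp del: index_mult_mat(1) mult_eq_0_iff intro!: sum.neutral)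
  qed
  then show ?thesis using k Tc by (auto simp: mat_trace_def intro!: sum.neutral)
qed

lemma pow_mat_Suc_left:
  assumes T: "(T :: complex mat) \<in> carrier_mat n n"
  shows "T ^\<^sub>m Suc k = T * T ^\<^sub>m k"
proof (induction k)
  case 0
  then show ?case using T by simp
next
  case (Suc k)
  have "T ^\<^sub>m k \<in> carrier_mat n n" using T by simp
  have "T ^\<^sub>m Suc (Suc k) = (T * T ^\<^sub>m k) * T" by (subst pow_mat.simps, subst Suc, rule refl)
  also have "\<dots> = T * T ^\<^sub>m Suc k"
    unfolding pow_mat.simps by (rule assoc_mult_mat[OF T \<open>T ^\<^sub>m k \<in> carrier_mat n n\<close> T])
  finally show ?case .
qed

text \<open>In \<open>(T + E) ^ k - T ^ k\<close> each of the fewer than \<open>2 ^ k\<close> products contains a factor \<open>E\<close>, while the other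
factors do not increase the Hilbert-Schmidt norm. The trace costs another factor \<open>sqrt n\<close> only, so after
division by \<open>n\<close> it is negligible.\<close>
lemma trace_perturbed_subshift_pow:
  assumes T: "subshift n T" and E: "E \<in> carrier_mat n n" and h: "hs_norm E \<le> 1" and k: "k > 0"
  shows "cmod (mat_trace ((T + E) ^\<^sub>m k)) \<le> sqrt n * (2 ^ k * hs_norm E)"
proof -
  have Tc: "T \<in> carrier_mat n n" using T by (simp add: subshift_def)
  have "\<exists>R \<in> carrier_mat n n. (T + E) ^\<^sub>m k = T ^\<^sub>m k + R \<and> hs_norm R \<le> (2 ^ k - 1) * hs_norm E
     \<and> hs_norm (T ^\<^sub>m k * E) \<le> hs_norm E" for k
  proof (induction k)
    case 0
    have "hs_norm (0\<^sub>m n n) = 0" by (auto simp: hs_norm_def L2_set_def intro!: sum.neutral)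
    then show ?case using Tc E by (intro bexI[of _ "0\<^sub>m n n"]) auto
  next
    case (Suc k)
    then obtain R where R: "R \<in> carrier_mat n n" "(T + E) ^\<^sub>m k = T ^\<^sub>m k + R"
      "hs_norm R \<le> (2 ^ k - 1) * hs_norm E" "hs_norm (T ^\<^sub>m k * E) \<le> hs_norm E" by blast
    have Tk: "T ^\<^sub>m k \<in> carrier_mat n n" using Tc by simp
    have c: "T ^\<^sub>m k * E \<in> carrier_mat n n" "R * T \<in> carrier_mat n n" "R * E \<in> carrier_mat n n" "T ^\<^sub>m k * T \<in> carrier_mat n n"
      using mult_carrier_mat[OF Tk E] mult_carrier_mat[OF R(1) Tc] mult_carrier_mat[OF R(1) E] mult_carrier_mat[OF Tk Tc] .
    have c': "R * T + R * E \<in> carrier_mat n n" by (rule add_carrier_mat[OF c(3)])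
    let ?R = "T ^\<^sub>m k * E + (R * T + R * E)"
    have "(T + E) ^\<^sub>m Suc k = (T ^\<^sub>m k + R) * (T + E)" using R by simp
    also have "\<dots> = T ^\<^sub>m k * (T + E) + R * (T + E)"
      by (rule add_mult_distrib_mat[OF Tk R(1), of _ n]) (use E in simp)
    also have "\<dots> = (T ^\<^sub>m k * T + T ^\<^sub>m k * E) + (R * T + R * E)"
      by (simp add: mult_add_distrib_mat[OF Tk Tc E] mult_add_distrib_mat[OF R(1) Tc E])
    also have "\<dots> = T ^\<^sub>m Suc k + ?R"
      unfolding pow_mat.simps by (rule assoc_add_mat[OF c(4,1) c'])
    finally have eq: "(T + E) ^\<^sub>m Suc k = T ^\<^sub>m Suc k + ?R" .
    have Rc: "?R \<in> carrier_mat n n" using c' by (rule add_carrier_mat)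
    have "hs_norm ?R \<le> hs_norm (T ^\<^sub>m k * E) + hs_norm (R * T + R * E)"
      by (rule hs_norm_add[OF c(1) c'])
    also have "hs_norm (R * T + R * E) \<le> hs_norm (R * T) + hs_norm (R * E)"
      by (rule hs_norm_add[OF c(2,3)])
    also have "hs_norm (R * E) \<le> hs_norm R * 1"
      using hs_norm_mult[OF R(1) E] h by (meson hs_norm_nonneg mult_left_mono order_trans)
    also have "hs_norm (R * T) \<le> hs_norm R" by (rule hs_norm_mult_subshift[OF T R(1)])
    finally have "hs_norm ?R \<le> (2 ^ Suc k - 1) * hs_norm E"
      using R(3,4) by (simp add: algebra_simps)
    moreover have "hs_norm (T ^\<^sub>m Suc k * E) \<le> hs_norm E"
    proof -
      have "T ^\<^sub>m Suc k * E = T * (T ^\<^sub>m k * E)"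
        unfolding pow_mat_Suc_left[OF Tc] by (rule assoc_mult_mat[OF Tc Tk E])
      then show ?thesis using hs_norm_subshift_mult[OF T c(1)] R(4) by simp
    qed
    ultimately show ?case using eq Rc by blast
  qed
  from this[of k] obtain R where R: "R \<in> carrier_mat n n" "(T + E) ^\<^sub>m k = T ^\<^sub>m k + R"
      "hs_norm R \<le> (2 ^ k - 1) * hs_norm E" by blast
  have "mat_trace ((T + E) ^\<^sub>m k) = mat_trace (T ^\<^sub>m k) + mat_trace R"
    unfolding R(2) using R(1) Tc by (simp add: mat_trace_def sum.distrib)
  then have "cmod (mat_trace ((T + E) ^\<^sub>m k)) \<le> sqrt n * hs_norm R"
    using norm_mat_trace_le[OF R(1)] trace_subshift_pow[OF T k] by simp
  also have "\<dots> \<le> sqrt n * (2 ^ k * hs_norm E)"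
    by (intro mult_left_mono order_trans[OF R(3)]) (simp_all add: algebra_simps)
  finally show ?thesis .
qed

section \<open>Equidistribution on the circle from the determinant and power sums\<close>

lemma cis_measurable [measurable]: "cis \<in> borel_measurable borel"
  by (auto intro!: borel_measurable_continuous_onI continuous_intros)

lemma prob_space_uniform_circle: "prob_space uniform_circle"
proof -
  have "cis \<in> borel_measurable (uniform_measure lborel {0..2*pi})" by measurable
  then show ?thesis
    unfolding uniform_circle_def
    by (intro prob_space.prob_space_distr prob_space_uniform_measure) auto
qed

lemma sets_uniform_circle [simp, measurable_cong]: "sets uniform_circle = sets borel"
  by (simp add: uniform_circle_def)

lemma AE_uniform_circle: "AE z in uniform_circle. cmod z = 1"
  unfolding uniform_circle_def by (subst AE_distr_iff) auto

lemma integrable_uniform_circle: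
  fixes g :: "complex \<Rightarrow> 'b :: euclidean_space"
  assumes g: "continuous_on UNIV g"
  shows "integrable uniform_circle g"
proof -
  interpret prob_space uniform_circle by (rule prob_space_uniform_circle)
  have "compact (g ` sphere 0 1)"
    by (intro compact_continuous_image continuous_on_subset[OF g]) auto
  then obtain B where "\<And>z. cmod z = 1 \<Longrightarrow> norm (g z) \<le> B"
    using compact_imp_bounded bounded_iff by (metis (no_types, lifting) image_eqI mem_sphere_0)
  then show ?thesis
    using borel_measurable_continuous_onI[OF g] AE_uniform_circle
    by (intro integrable_const_bound[where B = B]) auto
qed

lemma integral_uniform_circle:
  fixes g :: "complex \<Rightarrow> real"
  assumes g: "continuous_on UNIV g"
  shows "(\<integral>z. g z \<partial>uniform_circle) = (\<integral>t. g (cis t) * indicator {0..2*pi} t \<partial>lborel) / (2 * pi)"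
proof -
  have [measurable]: "g \<in> borel_measurable borel" by (rule borel_measurable_continuous_onI[OF g])
  have dens: "uniform_measure lborel {0..2*pi} = density lborel (\<lambda>t. ennreal (indicator {0..2*pi} t / (2*pi)))"
    unfolding uniform_measure_def
    by (intro density_cong AE_I2) (auto simp: divide_ennreal[symmetric] split: split_indicator)
  have "(\<integral>z. g z \<partial>uniform_circle) = (\<integral>t. g (cis t) \<partial>uniform_measure lborel {0..2*pi})"
    unfolding uniform_circle_def by (rule integral_distr) auto
  also have "\<dots> = (\<integral>t. (indicator {0..2*pi} t / (2*pi)) *\<^sub>R g (cis t) \<partial>lborel)"
    unfolding dens by (rule integral_density) auto
  also have "\<dots> = (\<integral>t. g (cis t) * indicator {0..2*pi} t / (2*pi) \<partial>lborel)"
    by (intro Bochner_Integration.integral_cong) (auto simp: field_simps)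
  finally show ?thesis by simp
qed

text \<open>The antiderivative of \<open>t \<mapsto> Re (c * cis t ^ k)\<close> has period \<open>2 * pi\<close>.\<close>
lemma integral_monomial_uniform_circle:
  assumes "k > 0"
  shows "(\<integral>z. Re (c * z ^ k) \<partial>uniform_circle) = 0"
proof -
  define a where "a = real k"
  have a: "a > 0" using assms by (simp add: a_def)
  have 1: "Re (c * cis t ^ k) = Re c * cos (a * t) - Im c * sin (a * t)" for t
    by (simp add: Complex.DeMoivre a_def)
  let ?F = "\<lambda>t. (Re c * sin (a * t) + Im c * cos (a * t)) / a"
  have "(\<integral>t. Re (c * cis t ^ k) * indicator {0..2*pi} t \<partial>lborel) = ?F (2*pi) - ?F 0"
    unfolding 1
    by (rule integral_FTC_Icc_real)
       (use a in \<open>auto intro!: derivative_eq_intros continuous_intros simp: field_simps\<close>)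
  also have "a * (2*pi) = 2 * real k * pi" by (simp add: a_def)
  also have "(Re c * sin (2 * real k * pi) + Im c * cos (2 * real k * pi)) / a - ?F 0 = 0"
    by (simp only: sin_2npi cos_2npi) simp
  finally show ?thesis by (subst integral_uniform_circle) (auto intro!: continuous_intros)
qed

text \<open>Real trigonometric polynomials on the circle, extended to the plane as real parts of polynomials:
with this extension their averages over eigenvalues are combinations of power sums.\<close>
inductive trig_poly :: "(complex \<Rightarrow> real) \<Rightarrow> bool" where
  mono: "trig_poly (\<lambda>z. Re (c * z ^ k))"
| add: "trig_poly p \<Longrightarrow> trig_poly q \<Longrightarrow> trig_poly (\<lambda>z. p z + q z)"

lemma trig_poly_continuous: "trig_poly q \<Longrightarrow> continuous_on A q"
  by (induction rule: trig_poly.induct) (auto intro!: continuous_intros)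

text \<open>This is \<open>2 * Re a * Re b = Re (a * b) + Re (b * cnj a)\<close>, where \<open>cnj z = 1 / z\<close> on the circle turns the
second term into the real part of a monomial again. So trigonometric polynomials form an algebra on the
circle, as the Stone-Weierstrass theorem requires.\<close>
lemma trig_poly_mult_mono:
  "\<exists>q. trig_poly q \<and> (\<forall>z\<in>sphere 0 1. Re (c * z ^ j) * Re (d * z ^ k) = q z)"
proof (induction j k arbitrary: c d rule: linorder_wlog)
  case (le j k)
  define q where "q = (\<lambda>z. Re (c * d / 2 * z ^ (j + k)) + Re (d * cnj c / 2 * z ^ (k - j)))"
  have "Re (c * z ^ j) * Re (d * z ^ k) = q z" if z: "z \<in> sphere 0 1" for z
  proof -
    have zz: "cnj z * z = 1" using z by (simp add: complex_norm_square[symmetric] mult.commute)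
    have "d * z ^ k * cnj (c * z ^ j) = d * cnj c * z ^ (k - j) * (cnj z * z) ^ j"
      using le by (simp add: power_mult_distrib mult_ac flip: power_add)
    then have "d * z ^ k * cnj (c * z ^ j) = d * cnj c * z ^ (k - j)" using zz by simp
    moreover have "Re a * Re b = Re (a * b / 2) + Re (b * cnj a / 2)" for a b :: complex
      by (simp add: field_simps)
    ultimately have "Re (c * z ^ j) * Re (d * z ^ k) =
      Re (c * z ^ j * (d * z ^ k) / 2) + Re (d * cnj c * z ^ (k - j) / 2)" by metis
    then show ?thesis by (simp add: q_def power_add mult_ac)
  qed
  moreover have "trig_poly q" unfolding q_def by (intro trig_poly.intros)
  ultimately show ?case by blast
next
  case (sym j k)
  then show ?case by (metis mult.commute)
qed

lemma trig_poly_mult: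
  assumes "trig_poly p" "trig_poly q"
  shows "\<exists>r. trig_poly r \<and> (\<forall>z\<in>sphere 0 1. p z * q z = r z)"
  using assms
proof (induction arbitrary: q rule: trig_poly.induct)
  case (mono c j)
  from mono show ?case
  proof (induction rule: trig_poly.induct)
    case (mono d k)
    then show ?case by (rule trig_poly_mult_mono)
  next
    case (add p q)
    then obtain r s where "trig_poly r" "\<forall>z\<in>sphere 0 1. Re (c * z ^ j) * p z = r z"
      "trig_poly s" "\<forall>z\<in>sphere 0 1. Re (c * z ^ j) * q z = s z" by blast
    then show ?case
      by (intro exI[of _ "\<lambda>z. r z + s z"]) (auto intro: trig_poly.add simp: ring_distribs)
  qed
next
  case (add p p')
  from add.IH(1)[OF add.prems] obtain r where "trig_poly r" "\<forall>z\<in>sphere 0 1. p z * q z = r z" by blast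
  moreover from add.IH(2)[OF add.prems]
  obtain s where "trig_poly s" "\<forall>z\<in>sphere 0 1. p' z * q z = s z" by blast
  ultimately show ?case
    by (intro exI[of _ "\<lambda>z. r z + s z"]) (auto intro: trig_poly.add simp: ring_distribs)
qed

lemma trig_poly_approx:
  fixes g :: "complex \<Rightarrow> real"
  assumes g: "continuous_on (sphere 0 1) g" and \<eta>: "\<eta> > 0"
  obtains q where "trig_poly q" "\<And>z. cmod z = 1 \<Longrightarrow> \<bar>g z - q z\<bar> < \<eta>"
proof -
  define P where "P = (\<lambda>f :: complex \<Rightarrow> real. \<exists>q. trig_poly q \<and> (\<forall>z\<in>sphere 0 1. f z = q z))"
  have "\<exists>f. P f \<and> (\<forall>z\<in>sphere 0 1. \<bar>g z - f z\<bar> < \<eta>)"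
  proof (rule Stone_Weierstrass_HOL)
    show "P (\<lambda>x. c)" for c
      unfolding P_def by (intro exI[of _ "\<lambda>z. Re (of_real c * z ^ 0)"] conjI trig_poly.mono) auto
    show "continuous_on (sphere 0 1) f" if "P f" for f
      using that trig_poly_continuous continuous_on_cong unfolding P_def by metis
    show "P (\<lambda>z. f z + h z)" if "P f \<and> P h" for f h
      using that unfolding P_def
      by clarify (metis (mono_tags, lifting) trig_poly.add)
    show "P (\<lambda>z. f z * h z)" if "P f \<and> P h" for f h
    proof -
      from that obtain p q where "trig_poly p" "trig_poly q"
        "\<forall>z\<in>sphere 0 1. f z = p z" "\<forall>z\<in>sphere 0 1. h z = q z" unfolding P_def by blast
      with trig_poly_mult[of p q] show ?thesis unfolding P_def by auto
    qed
    show "\<exists>f. P f \<and> f x \<noteq> f y" if "x \<in> sphere 0 1 \<and> y \<in> sphere 0 1 \<and> x \<noteq> y" for x y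
    proof -
      have "P Re" unfolding P_def using trig_poly.mono[of 1 1] by force
      moreover have "P Im" unfolding P_def using trig_poly.mono[of "-\<i>" 1] by force
      ultimately show ?thesis using that complex_eqI by blast
    qed
  qed (use g \<eta> in auto)
  then show thesis using that unfolding P_def by (metis mem_sphere_0)
qed

text \<open>Weyl's criterion with an explicit error: apart from the constant term, which is the mean over the
circle, the average of \<open>q\<close> is a combination of power sums. Only finitely many powers \<open>L\<close> are involved.\<close>
lemma trig_poly_average:
  assumes "trig_poly q"
  shows "\<exists>L C. C \<ge> 0 \<and> (\<forall>es \<epsilon>. (\<forall>k\<in>{1..L}. cmod (\<Sum>e\<leftarrow>es. e ^ k) \<le> \<epsilon>) \<longrightarrow> 0 \<le> \<epsilon> \<longrightarrow>
     \<bar>(\<Sum>e\<leftarrow>es. q e) - length es * (\<integral>z. q z \<partial>uniform_circle)\<bar> \<le> C * \<epsilon>)"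
  using assms
proof (induction rule: trig_poly.induct)
  case (mono c k)
  have sum: "(\<Sum>e\<leftarrow>es. Re (c * e ^ k)) = Re (c * (\<Sum>e\<leftarrow>es. e ^ k))" for es
    by (induction es) (auto simp: algebra_simps)
  show ?case
  proof (cases "k = 0")
    case True
    interpret prob_space uniform_circle by (rule prob_space_uniform_circle)
    show ?thesis using True prob_space
      by (intro exI[of _ 0]) (auto simp: sum_list_triv)
  next
    case False
    show ?thesis
    proof (intro exI[of _ k] exI[of _ "cmod c"] conjI allI impI)
      fix es \<epsilon> assume *: "\<forall>k\<in>{1..k}. cmod (\<Sum>e\<leftarrow>es. e ^ k) \<le> \<epsilon>" "0 \<le> \<epsilon>"
      have "\<bar>Re (c * (\<Sum>e\<leftarrow>es. e ^ k))\<bar> \<le> cmod c * cmod (\<Sum>e\<leftarrow>es. e ^ k)"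
        using abs_Re_le_cmod norm_mult by metis
      also have "\<dots> \<le> cmod c * \<epsilon>" using * False by (intro mult_left_mono) auto
      finally show "\<bar>(\<Sum>e\<leftarrow>es. Re (c * e ^ k)) - length es * (\<integral>z. Re (c * z ^ k) \<partial>uniform_circle)\<bar>
          \<le> cmod c * \<epsilon>"
        unfolding sum integral_monomial_uniform_circle[OF False[unfolded neq0_conv]] by simp
    qed simp
  qed
next
  case (add p q)
  then obtain L C L' C' where 1: "0 \<le> C" "\<And>es \<epsilon>. \<lbrakk>\<forall>k\<in>{1..L}. cmod (\<Sum>e\<leftarrow>es. e ^ k) \<le> \<epsilon>; 0 \<le> \<epsilon>\<rbrakk> \<Longrightarrow>
       \<bar>(\<Sum>e\<leftarrow>es. p e) - length es * (\<integral>z. p z \<partial>uniform_circle)\<bar> \<le> C * \<epsilon>"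
    and 2: "0 \<le> C'" "\<And>es \<epsilon>. \<lbrakk>\<forall>k\<in>{1..L'}. cmod (\<Sum>e\<leftarrow>es. e ^ k) \<le> \<epsilon>; 0 \<le> \<epsilon>\<rbrakk> \<Longrightarrow>
       \<bar>(\<Sum>e\<leftarrow>es. q e) - length es * (\<integral>z. q z \<partial>uniform_circle)\<bar> \<le> C' * \<epsilon>"
    by metis
  have int: "(\<integral>z. p z + q z \<partial>uniform_circle) = (\<integral>z. p z \<partial>uniform_circle) + (\<integral>z. q z \<partial>uniform_circle)"
    using add.hyps by (intro Bochner_Integration.integral_add integrable_uniform_circle trig_poly_continuous)
  show ?case
  proof (intro exI[of _ "max L L'"] exI[of _ "C + C'"] conjI allI impI)
    fix es \<epsilon> assume *: "\<forall>k\<in>{1..max L L'}. cmod (\<Sum>e\<leftarrow>es. e ^ k) \<le> \<epsilon>" "0 \<le> \<epsilon>"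
    have "(\<Sum>e\<leftarrow>es. p e + q e) = (\<Sum>e\<leftarrow>es. p e) + (\<Sum>e\<leftarrow>es. q e)" by (rule sum_list_addf)
    moreover have "\<bar>(\<Sum>e\<leftarrow>es. p e) - length es * (\<integral>z. p z \<partial>uniform_circle)\<bar> \<le> C * \<epsilon>"
      using * by (intro 1(2)) auto
    moreover have "\<bar>(\<Sum>e\<leftarrow>es. q e) - length es * (\<integral>z. q z \<partial>uniform_circle)\<bar> \<le> C' * \<epsilon>"
      using * by (intro 2(2)) auto
    ultimately show "\<bar>(\<Sum>e\<leftarrow>es. p e + q e) - length es * (\<integral>z. p z + q z \<partial>uniform_circle)\<bar> \<le> (C + C') * \<epsilon>"
      unfolding int ring_distribs by linarith
  qed (use 1 2 in auto)
qed

text \<open>A factor of modulus below \<open>1 - \<theta>\<close> contributes at most \<open>exp (\<epsilon> - \<theta>)\<close> to the product and every other factor at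
most \<open>exp \<epsilon>\<close>; too many small factors would make the product too small.\<close>
lemma card_small_modulus:
  fixes es :: "complex list"
  assumes big: "\<forall>e\<in>set es. cmod e \<le> 1 + \<epsilon>" and pr: "exp (- \<epsilon> * length es) \<le> cmod (prod_list es)"
    and \<epsilon>: "0 \<le> \<epsilon>" and \<theta>: "0 \<le> \<theta>"
  shows "\<theta> * length (filter (\<lambda>e. cmod e < 1 - \<theta>) es) \<le> 2 * \<epsilon> * length es"
proof -
  have "cmod (prod_list es) \<le> exp (\<epsilon> * length es - \<theta> * length (filter (\<lambda>e. cmod e < 1 - \<theta>) es))"
    using big
  proof (induction es)
    case (Cons e es)
    have "cmod e \<le> exp (\<epsilon> - (if cmod e < 1 - \<theta> then \<theta> else 0))"
    proof (cases "cmod e < 1 - \<theta>")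
      case True
      then have "cmod e \<le> 1 + (\<epsilon> - \<theta>)" using \<epsilon> by simp
      also have "\<dots> \<le> exp (\<epsilon> - \<theta>)" by (rule exp_ge_add_one_self)
      finally show ?thesis using True by simp
    next
      case False
      have "cmod e \<le> 1 + \<epsilon>" using Cons by simp
      also have "\<dots> \<le> exp \<epsilon>" by (rule exp_ge_add_one_self)
      finally show ?thesis using False by simp
    qed
    then have "cmod (prod_list (e # es)) \<le> exp (\<epsilon> - (if cmod e < 1 - \<theta> then \<theta> else 0)) *
        exp (\<epsilon> * length es - \<theta> * length (filter (\<lambda>e. cmod e < 1 - \<theta>) es))"
      using Cons by (auto simp: norm_mult intro!: mult_mono simp del: exp_le_cancel_iff)
    then show ?case by (auto simp: algebra_simps simp flip: exp_add)
  qed simp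
  with pr have "exp (- \<epsilon> * length es) \<le> exp (\<epsilon> * length es - \<theta> * length (filter (\<lambda>e. cmod e < 1 - \<theta>) es))"
    by (rule order_trans)
  then show ?thesis by simp
qed

text \<open>Approximate \<open>g\<close> on the circle by a trigonometric polynomial \<open>q\<close>. The difference \<open>h = g - q\<close> is small
near the circle by uniform continuity, and bounded elsewhere, where only few of the points lie. The mean
of \<open>q\<close> is controlled by the power sums.\<close>
lemma equidistribution_criterion_real:
  fixes g :: "complex \<Rightarrow> real"
  assumes g: "continuous_on UNIV g" and \<eta>: "\<eta> > 0"
  obtains L \<epsilon> where "0 < \<epsilon>"
    "\<And>es. \<lbrakk>es \<noteq> []; \<forall>e\<in>set es. cmod e \<le> 1 + \<epsilon>; exp (- \<epsilon> * length es) \<le> cmod (prod_list es);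
        \<forall>k\<in>{1..L}. cmod (\<Sum>e\<leftarrow>es. e ^ k) \<le> \<epsilon> * length es\<rbrakk> \<Longrightarrow>
        \<bar>(\<Sum>e\<leftarrow>es. g e) / length es - (\<integral>z. g z \<partial>uniform_circle)\<bar> \<le> \<eta>"
proof -
  interpret C: prob_space uniform_circle by (rule prob_space_uniform_circle)
  define \<delta> where "\<delta> = \<eta> / 8"
  have \<delta>: "\<delta> > 0" using \<eta> by (simp add: \<delta>_def)
  obtain q where q: "trig_poly q" and gq: "\<And>z. cmod z = 1 \<Longrightarrow> \<bar>g z - q z\<bar> < \<delta>"
    using trig_poly_approx[OF continuous_on_subset[OF g] \<delta>] by blast
  obtain L C where C: "0 \<le> C" "\<And>es \<epsilon>. \<lbrakk>\<forall>k\<in>{1..L}. cmod (\<Sum>e\<leftarrow>es. e ^ k) \<le> \<epsilon>; 0 \<le> \<epsilon>\<rbrakk> \<Longrightarrow>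
       \<bar>(\<Sum>e\<leftarrow>es. q e) - length es * (\<integral>z. q z \<partial>uniform_circle)\<bar> \<le> C * \<epsilon>"
    using trig_poly_average[OF q] by metis
  define h where "h = (\<lambda>z. g z - q z)"
  have hc: "continuous_on A h" for A
    unfolding h_def using g trig_poly_continuous[OF q] by (auto intro!: continuous_intros intro: continuous_on_subset)
  have "uniformly_continuous_on (cball 0 2) h" using hc by (intro compact_uniformly_continuous) auto
  then obtain \<theta>' where \<theta>': "\<theta>' > 0" "\<And>z w. \<lbrakk>z \<in> cball 0 2; w \<in> cball 0 2; dist w z < \<theta>'\<rbrakk> \<Longrightarrow> dist (h w) (h z) < \<delta>"
    using \<delta> unfolding uniformly_continuous_on_def by metis
  define \<theta> where "\<theta> = min (\<theta>' / 2) (1/2)"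
  have \<theta>: "0 < \<theta>" "\<theta> < \<theta>'" "\<theta> \<le> 1/2" using \<theta>' by (auto simp: \<theta>_def)
  have near: "\<bar>h z\<bar> \<le> 2 * \<delta>" if z: "1 - \<theta> \<le> cmod z" "cmod z \<le> 1 + \<theta>" for z
  proof -
    have z0: "z \<noteq> 0" using z \<theta> by auto
    let ?w = "sgn z"
    have w: "cmod ?w = 1" using z0 by (simp add: norm_sgn)
    have "z - ?w = of_real (cmod z - 1) * ?w" using z0 by (simp add: sgn_eq field_simps)
    then have "dist ?w z = \<bar>cmod z - 1\<bar>" using w
      by (simp add: dist_norm norm_minus_commute norm_mult del: of_real_diff)
    then have "dist (h ?w) (h z) < \<delta>" using z \<theta> w by (intro \<theta>'(2)) auto
    moreover have "\<bar>h ?w\<bar> < \<delta>" using gq[OF w] by (simp add: h_def)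
    ultimately show ?thesis by (auto simp: dist_real_def)
  qed
  have "compact (h ` cball 0 2)" by (intro compact_continuous_image hc compact_cball)
  then obtain B0 where "\<forall>x\<in>h ` cball 0 2. norm x \<le> B0" using compact_imp_bounded bounded_iff by metis
  define B where "B = max B0 0"
  have B: "0 \<le> B" "\<And>z. cmod z \<le> 2 \<Longrightarrow> \<bar>h z\<bar> \<le> B"
    using \<open>\<forall>x\<in>h ` cball 0 2. norm x \<le> B0\<close> by (force simp: B_def)+
  \<comment> \<open>The denominator collects the error \<open>C\<close> of the power sums and the share \<open>2 * B / \<theta>\<close> of the points far from the circle.\<close>
  define \<epsilon> where "\<epsilon> = min \<theta> (\<delta> / (1 + C + 2 * B / \<theta>))"
  have den: "1 + C + 2 * B / \<theta> > 0" using C(1) B(1) \<theta> by (intro add_pos_nonneg) auto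
  have \<epsilon>: "0 < \<epsilon>" "\<epsilon> \<le> \<theta>" using \<theta> \<delta> den by (auto simp: \<epsilon>_def)
  have "\<epsilon> * (1 + C + 2 * B / \<theta>) \<le> \<delta>" 
    unfolding pos_le_divide_eq[OF den, symmetric] by (simp add: \<epsilon>_def)
  then have \<epsilon>2: "\<epsilon> + \<epsilon> * C + \<epsilon> * (2 * B / \<theta>) \<le> \<delta>" by (simp add: algebra_simps)
  have bd: "\<epsilon> * C \<le> \<delta>" "B * (2 * \<epsilon>) / \<theta> \<le> \<delta>"
  proof -
    have "0 \<le> \<epsilon> * C" "0 \<le> \<epsilon> * (2 * B / \<theta>)" using C(1) B(1) \<epsilon> \<theta> by auto
    then show "\<epsilon> * C \<le> \<delta>" "B * (2 * \<epsilon>) / \<theta> \<le> \<delta>" using \<epsilon>2 \<epsilon> by (simp_all add: mult_ac)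
  qed
  have intgq: "\<bar>(\<integral>z. g z \<partial>uniform_circle) - (\<integral>z. q z \<partial>uniform_circle)\<bar> \<le> \<delta>"
  proof -
    have ig: "integrable uniform_circle g" by (rule integrable_uniform_circle[OF g])
    have iq: "integrable uniform_circle q" by (rule integrable_uniform_circle[OF trig_poly_continuous[OF q]])
    have "\<bar>\<integral>z. g z - q z \<partial>uniform_circle\<bar> \<le> (\<integral>z. \<bar>g z - q z\<bar> \<partial>uniform_circle)"
      by (rule integral_abs_bound)
    also have "\<dots> \<le> (\<integral>z. \<delta> \<partial>uniform_circle)"
      using AE_uniform_circle gq ig iq by (intro integral_mono_AE) (auto intro: less_imp_le)
    finally show ?thesis using ig iq C.prob_space by simp
  qed
  show thesis
  proof (rule that[OF \<epsilon>(1), of L])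
    fix es :: "complex list"
    assume ne: "es \<noteq> []" and big: "\<forall>e\<in>set es. cmod e \<le> 1 + \<epsilon>"
      and pr: "exp (- \<epsilon> * length es) \<le> cmod (prod_list es)"
      and mom: "\<forall>k\<in>{1..L}. cmod (\<Sum>e\<leftarrow>es. e ^ k) \<le> \<epsilon> * length es"
    let ?n = "real (length es)"
    have n: "?n > 0" using ne by simp
    have "\<bar>\<Sum>e\<leftarrow>es. h e\<bar> \<le> 2 * \<delta> * ?n + B * length (filter (\<lambda>e. cmod e < 1 - \<theta>) es)"
      using big
    proof (induction es)
      case (Cons e es)
      have "\<bar>h e\<bar> \<le> 2 * \<delta> + (if cmod e < 1 - \<theta> then B else 0)"
        using Cons.prems near[of e] B(2)[of e] \<epsilon> \<theta> \<delta> by (auto simp: not_less)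
      with Cons show ?case by (auto simp: algebra_simps)
    qed simp
    also have "B * length (filter (\<lambda>e. cmod e < 1 - \<theta>) es) \<le> B * (2 * \<epsilon> * ?n / \<theta>)"
      using card_small_modulus[OF big pr, of \<theta>] \<epsilon> \<theta> B(1)
      by (intro mult_left_mono) (auto simp: field_simps)
    also have "\<dots> \<le> \<delta> * ?n"
      using mult_right_mono[OF bd(2), of ?n] by simp
    finally have h: "\<bar>\<Sum>e\<leftarrow>es. h e\<bar> \<le> 3 * \<delta> * ?n" by simp
    have "\<bar>(\<Sum>e\<leftarrow>es. q e) - ?n * (\<integral>z. q z \<partial>uniform_circle)\<bar> \<le> C * (\<epsilon> * ?n)"
      using mom \<epsilon> by (intro C(2)) auto
    also have "\<dots> \<le> \<delta> * ?n" using mult_right_mono[OF bd(1), of ?n] by (simp add: mult_ac)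
    finally have qq: "\<bar>(\<Sum>e\<leftarrow>es. q e) - ?n * (\<integral>z. q z \<partial>uniform_circle)\<bar> \<le> \<delta> * ?n" .
    have "(\<Sum>e\<leftarrow>es. g e) = (\<Sum>e\<leftarrow>es. h e) + (\<Sum>e\<leftarrow>es. q e)"
      by (simp add: h_def flip: sum_list_addf)
    moreover have "\<bar>?n * (\<integral>z. g z \<partial>uniform_circle) - ?n * (\<integral>z. q z \<partial>uniform_circle)\<bar> \<le> \<delta> * ?n"
      unfolding right_diff_distrib[symmetric] abs_mult
      using mult_left_mono[OF intgq, of ?n] by (simp add: mult.commute)
    ultimately have "\<bar>(\<Sum>e\<leftarrow>es. g e) - ?n * (\<integral>z. g z \<partial>uniform_circle)\<bar> \<le> 5 * \<delta> * ?n"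
      using h qq by linarith
    also have "\<dots> \<le> \<eta> * ?n" using \<eta> by (intro mult_right_mono) (auto simp: \<delta>_def)
    finally have "\<bar>((\<Sum>e\<leftarrow>es. g e) - ?n * (\<integral>z. g z \<partial>uniform_circle)) / ?n\<bar> \<le> \<eta>"
      using n by (simp add: abs_divide field_simps)
    then show "\<bar>(\<Sum>e\<leftarrow>es. g e) / length es - (\<integral>z. g z \<partial>uniform_circle)\<bar> \<le> \<eta>"
      using n by (simp add: diff_divide_distrib)
  qed
qed

text \<open>The real and the imaginary part of \<open>g\<close> are treated separately.\<close>
lemma equidistribution_criterion:
  fixes g :: "complex \<Rightarrow> complex"
  assumes g: "continuous_on UNIV g" and \<eta>: "\<eta> > 0"
  obtains L \<epsilon> where "0 < \<epsilon>"
    "\<And>es. \<lbrakk>es \<noteq> []; \<forall>e\<in>set es. cmod e \<le> 1 + \<epsilon>; exp (- \<epsilon> * length es) \<le> cmod (prod_list es);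
        \<forall>k\<in>{1..L}. cmod (\<Sum>e\<leftarrow>es. e ^ k) \<le> \<epsilon> * length es\<rbrakk> \<Longrightarrow>
        dist ((\<Sum>e\<leftarrow>es. g e) /\<^sub>R length es) (\<integral>z. g z \<partial>uniform_circle) \<le> \<eta>"
proof -
  define P where "P = (\<lambda>\<epsilon> L es. (\<forall>e\<in>set es. cmod e \<le> 1 + \<epsilon>) \<and> exp (- \<epsilon> * length es) \<le> cmod (prod_list es) \<and>
      (\<forall>k\<in>{1..L::nat}. cmod (\<Sum>e\<leftarrow>es. e ^ k) \<le> \<epsilon> * length es))"
  have P_mono: "P \<epsilon>' L' es" if "P \<epsilon> L es" "\<epsilon> \<le> \<epsilon>'" "L' \<le> L" for \<epsilon> \<epsilon>' L L' es
  proof -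
    have le: "\<epsilon> * length es \<le> \<epsilon>' * length es" using that by (intro mult_right_mono) auto
    then have "exp (- \<epsilon>' * length es) \<le> exp (- \<epsilon> * length es)" by simp
    also have "\<dots> \<le> cmod (prod_list es)" using \<open>P \<epsilon> L es\<close> unfolding P_def by blast
    finally have "exp (- \<epsilon>' * length es) \<le> cmod (prod_list es)" .
    moreover have "cmod (\<Sum>e\<leftarrow>es. e ^ k) \<le> \<epsilon>' * length es" if k: "k \<in> {1..L'}" for k
    proof -
      have "k \<in> {1..L}" using k \<open>L' \<le> L\<close> by simp
      then have "cmod (\<Sum>e\<leftarrow>es. e ^ k) \<le> \<epsilon> * length es" using \<open>P \<epsilon> L es\<close> unfolding P_def by blast
      then show ?thesis using le by (rule order_trans)
    qed
    moreover have "\<forall>e\<in>set es. cmod e \<le> 1 + \<epsilon>'"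
      using \<open>P \<epsilon> L es\<close> that(2) unfolding P_def by (auto intro: order_trans)
    ultimately show ?thesis unfolding P_def by blast
  qed
  have gr: "continuous_on UNIV (\<lambda>z. Re (g z))" "continuous_on UNIV (\<lambda>z. Im (g z))"
    using g by (auto intro!: continuous_intros)
  have \<eta>2: "0 < \<eta> / 2" using \<eta> by simp
  obtain L1 \<epsilon>1 where R0: "0 < \<epsilon>1"
    "\<And>es. \<lbrakk>es \<noteq> []; \<forall>e\<in>set es. cmod e \<le> 1 + \<epsilon>1; exp (- \<epsilon>1 * length es) \<le> cmod (prod_list es);
        \<forall>k\<in>{1..L1}. cmod (\<Sum>e\<leftarrow>es. e ^ k) \<le> \<epsilon>1 * length es\<rbrakk> \<Longrightarrow>
        \<bar>(\<Sum>e\<leftarrow>es. Re (g e)) / length es - (\<integral>z. Re (g z) \<partial>uniform_circle)\<bar> \<le> \<eta> / 2"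
    using equidistribution_criterion_real[OF gr(1) \<eta>2] by metis
  have R: "\<bar>(\<Sum>e\<leftarrow>es. Re (g e)) / length es - (\<integral>z. Re (g z) \<partial>uniform_circle)\<bar> \<le> \<eta> / 2"
    if "es \<noteq> []" "P \<epsilon>1 L1 es" for es
    using that unfolding P_def by (elim conjE) (rule R0(2))
  obtain L2 \<epsilon>2 where J0: "0 < \<epsilon>2"
    "\<And>es. \<lbrakk>es \<noteq> []; \<forall>e\<in>set es. cmod e \<le> 1 + \<epsilon>2; exp (- \<epsilon>2 * length es) \<le> cmod (prod_list es);
        \<forall>k\<in>{1..L2}. cmod (\<Sum>e\<leftarrow>es. e ^ k) \<le> \<epsilon>2 * length es\<rbrakk> \<Longrightarrow>
        \<bar>(\<Sum>e\<leftarrow>es. Im (g e)) / length es - (\<integral>z. Im (g z) \<partial>uniform_circle)\<bar> \<le> \<eta> / 2"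
    using equidistribution_criterion_real[OF gr(2) \<eta>2] by metis
  have J: "\<bar>(\<Sum>e\<leftarrow>es. Im (g e)) / length es - (\<integral>z. Im (g z) \<partial>uniform_circle)\<bar> \<le> \<eta> / 2"
    if "es \<noteq> []" "P \<epsilon>2 L2 es" for es
    using that unfolding P_def by (elim conjE) (rule J0(2))
  show thesis
  proof (rule that[of "min \<epsilon>1 \<epsilon>2" "max L1 L2"])
    show "0 < min \<epsilon>1 \<epsilon>2" using R0(1) J0(1) by simp
    fix es :: "complex list"
    assume ne: "es \<noteq> []" and "\<forall>e\<in>set es. cmod e \<le> 1 + min \<epsilon>1 \<epsilon>2"
      "exp (- min \<epsilon>1 \<epsilon>2 * length es) \<le> cmod (prod_list es)"
      "\<forall>k\<in>{1..max L1 L2}. cmod (\<Sum>e\<leftarrow>es. e ^ k) \<le> min \<epsilon>1 \<epsilon>2 * length es"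
    then have P: "P (min \<epsilon>1 \<epsilon>2) (max L1 L2) es" unfolding P_def by blast
    let ?d = "(\<Sum>e\<leftarrow>es. g e) /\<^sub>R length es - (\<integral>z. g z \<partial>uniform_circle)"
    have sum_parts: "Re (\<Sum>e\<leftarrow>fs. g e) = (\<Sum>e\<leftarrow>fs. Re (g e))" "Im (\<Sum>e\<leftarrow>fs. g e) = (\<Sum>e\<leftarrow>fs. Im (g e))" for fs
      by (induction fs) auto
    have ig: "integrable uniform_circle g" by (rule integrable_uniform_circle[OF g])
    have "Re ?d = (\<Sum>e\<leftarrow>es. Re (g e)) / length es - (\<integral>z. Re (g z) \<partial>uniform_circle)"
      "Im ?d = (\<Sum>e\<leftarrow>es. Im (g e)) / length es - (\<integral>z. Im (g z) \<partial>uniform_circle)"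
      using integral_Re[OF ig] integral_Im[OF ig] by (simp_all add: sum_parts divide_inverse mult.commute)
    then have "cmod ?d \<le> \<eta> / 2 + \<eta> / 2"
      using R[OF ne P_mono[OF P min.cobounded1 max.cobounded1]]
        J[OF ne P_mono[OF P min.cobounded2 max.cobounded2]] cmod_le[of ?d] by linarith
    then show "dist ((\<Sum>e\<leftarrow>es. g e) /\<^sub>R length es) (\<integral>z. g z \<partial>uniform_circle) \<le> \<eta>"
      by (simp add: dist_norm)
  qed
qed

section \<open>Measurability of spectral averages\<close>

text \<open>The average is stated for a list of the eigenvalues, because the Schur form produces a list.\<close>
lemma integral_esd:
  fixes g :: "complex \<Rightarrow> 'b :: {euclidean_space, real_normed_field}"
  assumes g: "continuous_on UNIV g" and es: "proots (char_poly A) = mset es" "es \<noteq> []"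
  shows "(\<integral>z. g z \<partial>esd A) = (\<Sum>e\<leftarrow>es. g e) /\<^sub>R length es"
proof -
  have [measurable]: "g \<in> borel_measurable borel" by (rule borel_measurable_continuous_onI[OF g])
  have ne: "mset es \<noteq> {#}" using es by simp
  have count: "(\<Sum>a\<in>B. real (count (mset xs) a) *\<^sub>R g a) = (\<Sum>e\<leftarrow>xs. g e)"
    if "finite B" "set xs \<subseteq> B" for B xs
    using that
  proof (induction xs)
    case (Cons x xs)
    have "(\<Sum>a\<in>B. real (count (mset (x # xs)) a) *\<^sub>R g a)
        = (\<Sum>a\<in>B. (if a = x then g a else 0) + real (count (mset xs) a) *\<^sub>R g a)"
      by (intro sum.cong) (auto simp: algebra_simps)
    then show ?case using Cons by (simp add: sum.distrib)
  qed simp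
  have "(\<integral>z. g z \<partial>esd A) = (\<integral>z. g z \<partial>measure_pmf (pmf_of_multiset (mset es)))"
    unfolding esd_def es by (rule integral_distr) auto
  also have "\<dots> = (\<Sum>a\<in>set es. pmf (pmf_of_multiset (mset es)) a *\<^sub>R g a)"
    by (rule integral_measure_pmf) (use ne in auto)
  also have "\<dots> = (\<Sum>a\<in>set es. (real (count (mset es) a) *\<^sub>R g a) /\<^sub>R length es)"
    using ne by (intro sum.cong) (auto simp: divide_inverse mult.commute)
  also have "\<dots> = (\<Sum>e\<leftarrow>es. g e) /\<^sub>R length es"
    unfolding scaleR_sum_right[symmetric] using count[of "set es" es] by simp
  finally show ?thesis .
qed

lemma compact_polydisc:
  "compact {r :: nat \<Rightarrow> complex. \<forall>i. r i \<in> (if i < n then cball 0 R else {0})}"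
proof -
  have "compactin (product_topology (\<lambda>i. euclidean) UNIV) (PiE UNIV (\<lambda>i. if i < n then cball (0::complex) R else {0}))"
    by (subst compactin_PiE) auto
  moreover have "PiE UNIV (\<lambda>i. if i < n then cball (0::complex) R else {0})
      = {r. \<forall>i. r i \<in> (if i < n then cball 0 R else {0})}"
    by (simp only: PiE_UNIV_domain Pi_def UNIV_I simp_thms)
  ultimately show ?thesis
    unfolding euclidean_product_topology compactin_euclidean_iff by (simp only:)
qed

text \<open>The roots range over sequences, so that the number of roots, which is the dimension of the random
matrix, can be a variable. Continuity refers to the product topology.\<close>
lemma continuous_coeff_prod_roots:
  "continuous_on UNIV (\<lambda>r :: nat \<Rightarrow> complex. coeff (\<Prod>i<n. [:- r i, 1:]) k)"
proof (induction n arbitrary: k)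
  case (Suc n)
  have "coeff (\<Prod>i<Suc n. [:- r i, 1:]) k =
      (case k of 0 \<Rightarrow> 0 | Suc k' \<Rightarrow> coeff (\<Prod>i<n. [:- r i, 1:]) k') - r n * coeff (\<Prod>i<n. [:- r i, 1:]) k"
    for r :: "nat \<Rightarrow> complex"
    by (cases k) (simp_all add: mult.commute[of _ "[:- r n, 1:]"] algebra_simps)
  then show ?case
    using Suc.IH by (cases k) (auto intro!: continuous_intros)
qed (auto intro!: continuous_intros)

lemma measurable_coeff_char_poly:
  fixes A :: "'a \<Rightarrow> complex mat"
  assumes A: "\<And>\<omega>. \<omega> \<in> space M \<Longrightarrow> A \<omega> \<in> carrier_mat n n"
    and meas: "\<And>i j. i < n \<Longrightarrow> j < n \<Longrightarrow> (\<lambda>\<omega>. A \<omega> $$ (i, j)) \<in> borel_measurable M"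
  shows "(\<lambda>\<omega>. coeff (char_poly (A \<omega>)) k) \<in> borel_measurable M"
proof -
  have prod: "(\<lambda>\<omega>. coeff (\<Prod>i\<in>I. p i \<omega>) k) \<in> borel_measurable M"
    if "finite I" "\<And>i k. i \<in> I \<Longrightarrow> (\<lambda>\<omega>. coeff (p i \<omega>) k) \<in> borel_measurable M"
    for I :: "nat set" and p :: "nat \<Rightarrow> 'a \<Rightarrow> complex poly" and k
    using that by (induction I arbitrary: k rule: finite_induct) (auto simp: coeff_mult intro!: borel_measurable_sum borel_measurable_times)
  let ?e = "\<lambda>i j \<omega>. if i = j then [:- (A \<omega> $$ (i, j)), 1:] else [:- (A \<omega> $$ (i, j)):]"
  have e: "(\<lambda>\<omega>. coeff (?e i j \<omega>) k) \<in> borel_measurable M" if "i < n" "j < n" for i j k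
  proof -
    have [measurable]: "(\<lambda>\<omega>. A \<omega> $$ (i, j)) \<in> borel_measurable M" by (rule meas[OF that])
    have "(\<lambda>\<omega>. - (A \<omega> $$ (i, j))) \<in> borel_measurable M" by measurable
    then show ?thesis by (cases "i = j"; cases k) (auto simp: coeff_pCons)
  qed
  have "(\<lambda>\<omega>. coeff (char_poly (A \<omega>)) k) \<in> borel_measurable M \<longleftrightarrow>
    (\<lambda>\<omega>. \<Sum>p | p permutes {0..<n}. of_int (sign p) * coeff (\<Prod>i = 0..<n. ?e i (p i) \<omega>) k) \<in> borel_measurable M"
  proof (rule measurable_cong)
    fix \<omega> assume \<omega>: "\<omega> \<in> space M"
    have cpm: "char_poly_matrix (A \<omega>) \<in> carrier_mat n n" using A[OF \<omega>] by simp
    have "char_poly (A \<omega>) = (\<Sum>p | p permutes {0..<n}. of_int (sign p) * (\<Prod>i = 0..<n. ?e i (p i) \<omega>))"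
      unfolding char_poly_def det_def'[OF cpm]
    proof (intro sum.cong refl arg_cong2[of _ _ _ _ "(*)"] prod.cong)
      fix p i assume "p \<in> {p. p permutes {0..<n}}" "i \<in> {0..<n}"
      then show "char_poly_matrix (A \<omega>) $$ (i, p i) = ?e i (p i) \<omega>"
        using A[OF \<omega>] permutes_in_image[of p "{0..<n}" i] by (auto simp: char_poly_matrix_def)
    qed
    then show "coeff (char_poly (A \<omega>)) k =
      (\<Sum>p | p permutes {0..<n}. of_int (sign p) * coeff (\<Prod>i = 0..<n. ?e i (p i) \<omega>) k)"
      by (simp add: coeff_sum of_int_poly)
  qed
  moreover have "(\<lambda>\<omega>. \<Sum>p | p permutes {0..<n}. of_int (sign p) * coeff (\<Prod>i = 0..<n. ?e i (p i) \<omega>) k) \<in> borel_measurable M"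
  proof (intro borel_measurable_sum borel_measurable_times borel_measurable_const prod)
    fix p i k assume "p \<in> {p. p permutes {0..<n}}" "i \<in> {0..<n}"
    then show "(\<lambda>\<omega>. coeff (?e i (p i) \<omega>) k) \<in> borel_measurable M"
      using permutes_in_image[of p "{0..<n}" i] by (intro e) auto
  qed simp
  ultimately show ?thesis by blast
qed

text \<open>Numbering the roots in a measurable way is avoided as follows. The set of coefficient
vectors for which the sum over the roots lies in a closed set \<open>C\<close> is the image under the continuous map
from roots to coefficients of a closed set of root vectors. Cutting by the size of the roots makes it a
countable union of compact sets.\<close>
lemma measurable_root_sum:
  fixes g :: "complex \<Rightarrow> complex"
  assumes g: "continuous_on UNIV g"
    and A: "\<And>\<omega>. \<omega> \<in> space M \<Longrightarrow> A \<omega> \<in> carrier_mat n n"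
    and meas: "\<And>i j. i < n \<Longrightarrow> j < n \<Longrightarrow> (\<lambda>\<omega>. A \<omega> $$ (i, j)) \<in> borel_measurable M"
  shows "(\<lambda>\<omega>. \<Sum>e\<in>#proots (char_poly (A \<omega>)). g e) \<in> borel_measurable M"
proof -
  let ?S = "\<lambda>\<omega>. \<Sum>e\<in>#proots (char_poly (A \<omega>)). g e"
  define cf where "cf = (\<lambda>\<omega> k. coeff (char_poly (A \<omega>)) k)"
  define V where "V = (\<lambda>r :: nat \<Rightarrow> complex. \<lambda>k. coeff (\<Prod>i<n. [:- r i, 1:]) k)"
  have cf: "cf \<in> borel_measurable M"
    unfolding cf_def by (intro measurable_coordinatewise_then_product measurable_coeff_char_poly[OF A meas])
  have V: "continuous_on UNIV V"
    unfolding V_def by (intro continuous_on_coordinatewise_then_product continuous_coeff_prod_roots)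
  have gc: "continuous_on UNIV (\<lambda>r. \<Sum>i<n. g (r i))" for r
    by (intro continuous_on_sum continuous_on_compose2[OF g]) auto
  have closed: "?S -` C \<inter> space M \<in> sets M" if C: "closed C" for C
  proof -
    \<comment> \<open>Root vectors with all entries beyond \<open>n\<close> equal to \<open>0\<close> and the others of modulus at most \<open>R\<close>.\<close>
    define K where "K = (\<lambda>R. {r :: nat \<Rightarrow> complex. \<forall>i. r i \<in> (if i < n then cball 0 R else {0})} \<inter>
      ((\<lambda>r. \<Sum>i<n. g (r i)) -` C))"
    have "compact (K R)" for R
      unfolding K_def using C continuous_closed_vimage[of C "\<lambda>r. \<Sum>i<n. g (r i)"] gc
      by (intro compact_Int_closed compact_polydisc) (auto simp: continuous_on_eq_continuous_at)
    then have "compact (V ` K R)" for R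
      by (intro compact_continuous_image continuous_on_subset[OF V]) auto
    then have VK: "V ` K R \<in> sets borel" for R by (intro borel_closed compact_imp_closed)
    have "?S -` C \<inter> space M = (\<Union>R::nat. cf -` (V ` K (real R)) \<inter> space M)"
    proof (intro subset_antisym subsetI)
      fix \<omega> assume \<omega>: "\<omega> \<in> ?S -` C \<inter> space M"
      then have A\<omega>: "A \<omega> \<in> carrier_mat n n" using A by blast
      have deg: "degree (char_poly (A \<omega>)) = n" "lead_coeff (char_poly (A \<omega>)) = 1"
        using degree_monic_char_poly[OF A\<omega>] by auto
      obtain es where es: "mset es = proots (char_poly (A \<omega>))" using ex_mset by blast
      have len: "length es = n" using size_proots_complex[of "char_poly (A \<omega>)"] deg es by (metis size_mset)
      define r where "r = (\<lambda>i. if i < n then es ! i else 0)"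
      have "char_poly (A \<omega>) = (\<Prod>x\<in>#mset es. [:- x, 1:])"
        using complex_poly_decompose_multiset[of "char_poly (A \<omega>)"] deg es by simp
      also have "\<dots> = (\<Prod>x\<leftarrow>es. [:- x, 1:])" by (metis mset_map prod_mset_prod_list)
      also have "\<dots> = (\<Prod>i<n. [:- r i, 1:])"
        using len by (simp add: prod.list_conv_set_nth r_def lessThan_atLeast0)
      finally have "cf \<omega> = V r" by (simp add: cf_def V_def)
      have "?S \<omega> = (\<Sum>x\<leftarrow>es. g x)" unfolding es[symmetric] by (metis mset_map sum_mset_sum_list)
      also have "\<dots> = (\<Sum>i<n. g (r i))"
        using len by (simp add: sum_list_sum_nth r_def lessThan_atLeast0)
      finally have "(\<Sum>i<n. g (r i)) \<in> C" using \<omega> by simp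
      obtain R :: nat where R: "(\<Sum>i<n. cmod (r i)) \<le> R" using real_arch_simple by blast
      have "cmod (r i) \<le> R" if "i < n" for i
        using member_le_sum[of i "{..<n}" "\<lambda>i. cmod (r i)"] that R by simp
      then have "r \<in> K R" using \<open>(\<Sum>i<n. g (r i)) \<in> C\<close> by (auto simp: K_def r_def)
      then show "\<omega> \<in> (\<Union>R::nat. cf -` (V ` K (real R)) \<inter> space M)"
        using \<open>cf \<omega> = V r\<close> \<omega> by blast
    next
      fix \<omega> assume "\<omega> \<in> (\<Union>R::nat. cf -` (V ` K (real R)) \<inter> space M)"
      then obtain R r where \<omega>: "\<omega> \<in> space M" and r: "r \<in> K R" "cf \<omega> = V r" by blast
      have "char_poly (A \<omega>) = (\<Prod>i<n. [:- r i, 1:])"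
        using r(2) by (intro poly_eqI) (simp add: cf_def V_def fun_eq_iff)
      then have "proots (char_poly (A \<omega>)) = (\<Sum>i<n. {#r i#})" by (simp add: proots_prod)
      moreover have "(\<Sum>e\<in>#(\<Sum>i<m. {#r i#}). g e) = (\<Sum>i<m. g (r i))" for m
        by (induction m) auto
      ultimately have "?S \<omega> = (\<Sum>i<n. g (r i))" by simp
      then show "\<omega> \<in> ?S -` C \<inter> space M" using r \<omega> by (simp add: K_def)
    qed
    also have "\<dots> \<in> sets M" using measurable_sets[OF cf VK] by (intro sets.countable_UN) auto
    finally show ?thesis .
  qed
  show ?thesis
  proof (rule borel_measurableI)
    fix U :: "complex set" assume "open U"
    then have "?S -` (- U) \<inter> space M \<in> sets M" by (intro closed) auto
    moreover have "?S -` U \<inter> space M = space M - (?S -` (- U) \<inter> space M)" by auto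
    ultimately show "?S -` U \<inter> space M \<in> sets M" by auto
  qed
qed

lemma measurable_integral_esd:
  fixes g :: "complex \<Rightarrow> complex"
  assumes g: "continuous_on UNIV g"
    and A: "\<And>\<omega>. \<omega> \<in> space M \<Longrightarrow> A \<omega> \<in> carrier_mat n n"
    and meas: "\<And>i j. i < n \<Longrightarrow> j < n \<Longrightarrow> (\<lambda>\<omega>. A \<omega> $$ (i, j)) \<in> borel_measurable M"
  shows "(\<lambda>\<omega>. \<integral>z. g z \<partial>esd (A \<omega>)) \<in> borel_measurable M"
proof (cases "n = 0")
  case True
  have "(\<lambda>\<omega>. \<integral>z. g z \<partial>esd (A \<omega>)) \<in> borel_measurable M \<longleftrightarrow> (\<lambda>\<omega>. \<integral>z. g z \<partial>esd (mat 0 0 (\<lambda>_. 0))) \<in> borel_measurable M"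
  proof (rule measurable_cong)
    fix \<omega> assume "\<omega> \<in> space M"
    then have "A \<omega> = mat 0 0 (\<lambda>_. 0)" using A True by (intro eq_matI) auto
    then show "(\<integral>z. g z \<partial>esd (A \<omega>)) = (\<integral>z. g z \<partial>esd (mat 0 0 (\<lambda>_. 0)))" by simp
  qed
  then show ?thesis by simp
next
  case False
  have "(\<lambda>\<omega>. \<integral>z. g z \<partial>esd (A \<omega>)) \<in> borel_measurable M \<longleftrightarrow>
     (\<lambda>\<omega>. (\<Sum>e\<in>#proots (char_poly (A \<omega>)). g e) /\<^sub>R n) \<in> borel_measurable M"
  proof (rule measurable_cong)
    fix \<omega> assume "\<omega> \<in> space M"
    then have A\<omega>: "A \<omega> \<in> carrier_mat n n" using A by blast
    obtain es where es: "mset es = proots (char_poly (A \<omega>))" using ex_mset by blast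
    have len: "length es = n"
      using size_proots_complex[of "char_poly (A \<omega>)"] degree_monic_char_poly[OF A\<omega>] es by (metis size_mset)
    have "(\<Sum>e\<in>#proots (char_poly (A \<omega>)). g e) = (\<Sum>x\<leftarrow>es. g x)"
      unfolding es[symmetric] by (metis mset_map sum_mset_sum_list)
    then show "(\<integral>z. g z \<partial>esd (A \<omega>)) = (\<Sum>e\<in>#proots (char_poly (A \<omega>)). g e) /\<^sub>R n"
      using integral_esd[OF g es[symmetric]] len False by auto
  qed
  then show ?thesis using measurable_root_sum[OF g A meas] by simp
qed

section \<open>Conditioning and concentration of independent sums\<close>

lemma (in prob_space) product_prob_space_const: "product_prob_space (\<lambda>_. M)"
  by unfold_locales

text \<open>Fubini's theorem in the form of conditioning: a bound for the probability of an event given the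
coordinates in \<open>K\<close>, if it is uniform, bounds the probability of the event.\<close>
lemma (in prob_space) prob_section_bound:
  assumes I: "I = K \<union> J" "K \<inter> J = {}" "finite K" "finite J"
    and E: "E \<in> sets (PiM I (\<lambda>_. M))" and \<epsilon>: "0 \<le> \<epsilon>"
    and sec: "\<And>y. y \<in> space (PiM K (\<lambda>_. M)) \<Longrightarrow>
      measure (PiM J (\<lambda>_. M)) {x \<in> space (PiM J (\<lambda>_. M)). merge K J (y, x) \<in> E} \<le> \<epsilon>"
  shows "measure (PiM I (\<lambda>_. M)) E \<le> \<epsilon>"
proof -
  interpret P: product_prob_space "\<lambda>_. M" UNIV by (rule product_prob_space_const)
  interpret J: prob_space "PiM J (\<lambda>_. M)" by (intro prob_space_PiM) unfold_locales
  interpret K: prob_space "PiM K (\<lambda>_. M)" by (intro prob_space_PiM) unfold_locales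
  interpret IP: prob_space "PiM I (\<lambda>_. M)" by (intro prob_space_PiM) unfold_locales
  have [measurable]: "E \<in> sets (PiM (K \<union> J) (\<lambda>_. M))" using E I by simp
  have "emeasure (PiM I (\<lambda>_. M)) E = (\<integral>\<^sup>+ x. indicator E x \<partial>PiM (K \<union> J) (\<lambda>_. M))"
    using E I by simp
  also have "\<dots> = (\<integral>\<^sup>+ y. \<integral>\<^sup>+ x. indicator E (merge K J (y, x)) \<partial>PiM J (\<lambda>_. M) \<partial>PiM K (\<lambda>_. M))"
    using I by (intro P.product_nn_integral_fold) auto
  also have "\<dots> \<le> (\<integral>\<^sup>+ y. ennreal \<epsilon> \<partial>PiM K (\<lambda>_. M))"
  proof (intro nn_integral_mono)
    fix y assume y: "y \<in> space (PiM K (\<lambda>_. M))"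
    let ?S = "{x \<in> space (PiM J (\<lambda>_. M)). merge K J (y, x) \<in> E}"
    have "(\<lambda>x. merge K J (y, x)) \<in> measurable (PiM J (\<lambda>_. M)) (PiM (K \<union> J) (\<lambda>_. M))"
      using y by (intro measurable_compose[OF measurable_Pair1' measurable_merge])
    then have S: "?S \<in> sets (PiM J (\<lambda>_. M))" by measurable
    have "(\<integral>\<^sup>+ x. indicator E (merge K J (y, x)) \<partial>PiM J (\<lambda>_. M)) = (\<integral>\<^sup>+ x. indicator ?S x \<partial>PiM J (\<lambda>_. M))"
      by (intro nn_integral_cong) (auto split: split_indicator)
    also have "\<dots> = ennreal (measure (PiM J (\<lambda>_. M)) ?S)"
      using S by (simp add: J.emeasure_eq_measure)
    also have "\<dots> \<le> ennreal \<epsilon>" using sec[OF y] by (rule ennreal_leI)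
    finally show "(\<integral>\<^sup>+ x. indicator E (merge K J (y, x)) \<partial>PiM J (\<lambda>_. M)) \<le> ennreal \<epsilon>" .
  qed
  also have "\<dots> = ennreal \<epsilon>" by (simp add: K.emeasure_space_1)
  finally show ?thesis using \<epsilon> by (simp add: IP.emeasure_eq_measure)
qed

text \<open>If every coordinate is drawn twice, the law does not depend on which of the two copies is read at which
place.\<close>
lemma (in prob_space) distr_PiM_mix:
  assumes J: "finite J"
  shows "distr (PiM J (\<lambda>_. M \<Otimes>\<^sub>M M)) (PiM J (\<lambda>_. M)) (\<lambda>z. \<lambda>j\<in>J. if j \<in> S then fst (z j) else snd (z j))
     = PiM J (\<lambda>_. M)"
proof -
  interpret P: product_prob_space "\<lambda>_. M" UNIV by (rule product_prob_space_const)
  interpret MM: pair_prob_space M M ..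
  interpret P2: product_prob_space "\<lambda>_. M \<Otimes>\<^sub>M M" UNIV by (rule MM.product_prob_space_const)
  let ?f = "\<lambda>z. \<lambda>j\<in>J. if j \<in> S then fst (z j) else snd (z j)"
  have f[measurable]: "?f \<in> measurable (PiM J (\<lambda>_. M \<Otimes>\<^sub>M M)) (PiM J (\<lambda>_. M))"
    by (intro measurable_restrict) auto
  show ?thesis
  proof (rule P.PiM_eqI[OF J])
    fix A :: "'b \<Rightarrow> 'a set" assume A: "\<And>i. i \<in> J \<Longrightarrow> A i \<in> sets M"
    let ?B = "\<lambda>j. if j \<in> S then A j \<times> space M else space M \<times> A j"
    have "PiE J A \<in> sets (PiM J (\<lambda>_. M))" using A J by (intro sets_PiM_I_finite) auto
    then have "emeasure (distr (PiM J (\<lambda>_. M \<Otimes>\<^sub>M M)) (PiM J (\<lambda>_. M)) ?f) (PiE J A)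
      = emeasure (PiM J (\<lambda>_. M \<Otimes>\<^sub>M M)) (?f -` (PiE J A) \<inter> space (PiM J (\<lambda>_. M \<Otimes>\<^sub>M M)))"
      by (intro emeasure_distr f)
    also have "?f -` (PiE J A) \<inter> space (PiM J (\<lambda>_. M \<Otimes>\<^sub>M M)) = PiE J ?B"
      using sets.sets_into_space[OF A] by (auto simp: space_PiM space_pair_measure PiE_iff split: if_splits) force+
    also have "emeasure (PiM J (\<lambda>_. M \<Otimes>\<^sub>M M)) (PiE J ?B) = (\<Prod>j\<in>J. emeasure (M \<Otimes>\<^sub>M M) (?B j))"
      using A J by (intro P2.emeasure_PiM) auto
    also have "\<dots> = (\<Prod>j\<in>J. emeasure M (A j))"
      using A by (intro prod.cong) (auto simp: emeasure_pair_measure_Times emeasure_space_1)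
    finally show "emeasure (distr (PiM J (\<lambda>_. M \<Otimes>\<^sub>M M)) (PiM J (\<lambda>_. M)) ?f) (PiE J A) = (\<Prod>j\<in>J. emeasure M (A j))" .
  qed simp
qed

text \<open>The supremum over \<open>a\<close> is Levy's concentration function. An integral is used so that Fubini's theorem applies to it directly,
and the window is half-open so that values at least \<open>h\<close> apart never share it.\<close>
definition conc :: "'a measure \<Rightarrow> ('i \<Rightarrow> 'a \<Rightarrow> real) \<Rightarrow> real \<Rightarrow> 'i set \<Rightarrow> real \<Rightarrow> ennreal" where
  "conc D f h J a = (\<integral>\<^sup>+ x. indicator {a..<a + h} (\<Sum>j\<in>J. f j (x j)) \<partial>PiM J (\<lambda>_. D))"

text \<open>Draw every coordinate of the block \<open>J\<close> twice. With probability \<open>(prob A * prob B) ^ r\<close> all first copies lie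
in \<open>A\<close> and all second copies in \<open>B\<close>. Read the first copy at the places of rank below \<open>i\<close> and the second
copy at the others; as \<open>i\<close> runs from \<open>0\<close> to \<open>r\<close> the sum grows by at least \<open>h\<close> in every step, so at most
one of the \<open>r + 1\<close> sums meets a window of length \<open>h\<close>. As all \<open>r + 1\<close> sums have the same law, the
conditional probability is at most \<open>1 / (r + 1)\<close>. In the other case the bound \<open>F\<close> for the remaining
coordinates is used.\<close>
lemma (in prob_space) conc_block_step:
  fixes f :: "'i \<Rightarrow> 'a \<Rightarrow> real" and \<rho> :: "'i \<Rightarrow> nat"
  assumes fin: "finite J" "finite K" "J \<inter> K = {}" and \<rho>: "bij_betw \<rho> J {..<r}"
    and f[measurable]: "\<And>j. f j \<in> borel_measurable M"
    and A: "A \<in> sets M" and B: "B \<in> sets M"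
    and gap: "\<And>j x y. j \<in> J \<Longrightarrow> x \<in> A \<Longrightarrow> y \<in> B \<Longrightarrow> f j x - f j y \<ge> h" and h: "h > 0"
    and F: "\<And>a. conc M f h K a \<le> ennreal F" "0 \<le> F"
  shows "conc M f h (J \<union> K) a \<le> ennreal ((prob A * prob B) ^ r / (real r + 1) + (1 - (prob A * prob B) ^ r) * F)"
proof -
  interpret P: product_prob_space "\<lambda>_. M" UNIV by (rule product_prob_space_const)
  interpret MM: pair_prob_space M M ..
  interpret P2: product_prob_space "\<lambda>_. M \<Otimes>\<^sub>M M" UNIV by (rule MM.product_prob_space_const)
  interpret PK: prob_space "PiM K (\<lambda>_. M)" by (intro prob_space_PiM) unfold_locales
  interpret PJ: prob_space "PiM J (\<lambda>_. M)" by (intro prob_space_PiM) unfold_locales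
  interpret PP: prob_space "PiM J (\<lambda>_. M \<Otimes>\<^sub>M M)" by (intro prob_space_PiM) unfold_locales
  define I where "I = {a..<a + h}"
  define \<beta> where "\<beta> = (prob A * prob B) ^ r"
  have \<beta>: "0 \<le> \<beta>" "\<beta> \<le> 1" unfolding \<beta>_def by (auto intro!: power_le_one mult_le_one)
  have [measurable]: "I \<in> sets borel" by (simp add: I_def)
  define sK where "sK = (\<lambda>y. \<Sum>j\<in>K. f j (y j))"
  have sK[measurable]: "sK \<in> borel_measurable (PiM K (\<lambda>_. M))" unfolding sK_def by measurable
  define \<Psi> where "\<Psi> = (\<lambda>s. \<integral>\<^sup>+ y. indicator I (s + sK y) \<partial>PiM K (\<lambda>_. M))"
  have \<Psi>[measurable]: "\<Psi> \<in> borel_measurable borel" unfolding \<Psi>_def by measurable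
  have \<Psi>F: "\<Psi> s \<le> ennreal F" for s
  proof -
    have "\<Psi> s = conc M f h K (a - s)"
      unfolding \<Psi>_def conc_def sK_def I_def
      by (intro nn_integral_cong) (auto split: split_indicator)
    then show ?thesis using F by simp
  qed
  define sJ where "sJ = (\<lambda>x. \<Sum>j\<in>J. f j (x j))"
  have sJ[measurable]: "sJ \<in> borel_measurable (PiM J (\<lambda>_. M))" unfolding sJ_def by measurable
  have sum_merge: "(\<Sum>j\<in>J \<union> K. f j (merge J K (x, y) j)) = sJ x + sK y" for x y
  proof -
    have "(\<Sum>j\<in>J. f j (merge J K (x, y) j)) = sJ x"
      unfolding sJ_def by (intro sum.cong) (auto simp: merge_def)
    moreover have "(\<Sum>j\<in>K. f j (merge J K (x, y) j)) = sK y"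
      unfolding sK_def using fin by (intro sum.cong) (auto simp: merge_def)
    ultimately show ?thesis using fin by (simp add: sum.union_disjoint)
  qed
  have split: "conc M f h (J \<union> K) a = (\<integral>\<^sup>+ x. \<Psi> (sJ x) \<partial>PiM J (\<lambda>_. M))"
  proof -
    have "conc M f h (J \<union> K) a = (\<integral>\<^sup>+ x. \<integral>\<^sup>+ y.
        indicator I (\<Sum>j\<in>J \<union> K. f j (merge J K (x, y) j)) \<partial>PiM K (\<lambda>_. M) \<partial>PiM J (\<lambda>_. M))"
      unfolding conc_def I_def[symmetric] using fin by (intro P.product_nn_integral_fold) auto
    then show ?thesis unfolding sum_merge \<Psi>_def .
  qed
  define mix where "mix = (\<lambda>i z. \<lambda>j\<in>J. if j \<in> {j. \<rho> j < i} then fst (z j :: 'a \<times> 'a) else snd (z j))"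
  have mixm[measurable]: "mix i \<in> measurable (PiM J (\<lambda>_. M \<Otimes>\<^sub>M M)) (PiM J (\<lambda>_. M))" for i
    unfolding mix_def by (intro measurable_restrict) auto
  have mixed: "conc M f h (J \<union> K) a = (\<integral>\<^sup>+ z. \<Psi> (sJ (mix i z)) \<partial>PiM J (\<lambda>_. M \<Otimes>\<^sub>M M))" for i
  proof -
    have "conc M f h (J \<union> K) a
        = (\<integral>\<^sup>+ x. \<Psi> (sJ x) \<partial>distr (PiM J (\<lambda>_. M \<Otimes>\<^sub>M M)) (PiM J (\<lambda>_. M)) (mix i))"
      unfolding split mix_def distr_PiM_mix[OF fin(1)] ..
    also have "\<dots> = (\<integral>\<^sup>+ z. \<Psi> (sJ (mix i z)) \<partial>PiM J (\<lambda>_. M \<Otimes>\<^sub>M M))"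
      by (rule nn_integral_distr) auto
    finally show ?thesis .
  qed
  define G where "G = PiE J (\<lambda>_. A \<times> B)"
  have G[measurable]: "G \<in> sets (PiM J (\<lambda>_. M \<Otimes>\<^sub>M M))"
    unfolding G_def using fin A B by (intro sets_PiM_I_finite) auto
  have card: "card J = r" using bij_betw_same_card[OF \<rho>] by simp
  have "emeasure (PiM J (\<lambda>_. M \<Otimes>\<^sub>M M)) G = (\<Prod>j\<in>J. emeasure (M \<Otimes>\<^sub>M M) (A \<times> B))"
    unfolding G_def using fin A B by (intro P2.emeasure_PiM) auto
  also have "\<dots> = ennreal \<beta>"
    using A B card by (simp add: emeasure_pair_measure_Times emeasure_eq_measure \<beta>_def ennreal_power
        flip: ennreal_mult)
  finally have probG: "PP.prob G = \<beta>" using \<beta> by (simp add: PP.emeasure_eq_measure)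
  have good: "(\<Sum>i\<le>r. \<Psi> (sJ (mix i z))) \<le> 1" if z: "z \<in> G" for z
  proof -
    \<comment> \<open>Between \<open>i\<close> and \<open>i'\<close> some places change from a point of \<open>B\<close> to a point of \<open>A\<close>, among them the place of rank \<open>i\<close>.\<close>
    have incr: "sJ (mix i z) + h \<le> sJ (mix i' z)" if ii: "i < i'" "i' \<le> r" for i i'
    proof -
      obtain j where j: "j \<in> J" "\<rho> j = i"
        using \<rho> ii unfolding bij_betw_def by (metis (no_types, lifting) imageE less_le_trans lessThan_iff)
      have zj: "fst (z k) \<in> A" "snd (z k) \<in> B" if "k \<in> J" for k
        using z that by (auto simp: G_def PiE_iff mem_Times_iff)
      have "sJ (mix i z) + h = (\<Sum>k\<in>J. f k (mix i z k) + (if k = j then h else 0))"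
        using j fin by (simp add: sJ_def sum.distrib)
      also have "\<dots> \<le> sJ (mix i' z)"
        unfolding sJ_def
      proof (intro sum_mono)
        fix k assume k: "k \<in> J"
        show "f k (mix i z k) + (if k = j then h else 0) \<le> f k (mix i' z k)"
          using gap[OF k zj[OF k]] h ii j k by (auto simp: mix_def)
      qed
      finally show ?thesis .
    qed
    have one: "(\<Sum>i\<le>r. indicator I (sJ (mix i z) + t)) \<le> (1 :: ennreal)" for t
    proof (cases "\<exists>i\<le>r. sJ (mix i z) + t \<in> I")
      case True
      then obtain i where i: "i \<le> r" "sJ (mix i z) + t \<in> I" by blast
      have uniq: "i' = i" if "i' \<le> r" "sJ (mix i' z) + t \<in> I" for i'
      proof (rule ccontr)
        assume "i' \<noteq> i"
        then consider "i' < i" | "i < i'" by linarith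
        then show False
        proof cases
          case 1
          from incr[OF 1 i(1)] i(2) that(2) show False by (simp add: I_def)
        next
          case 2
          from incr[OF 2 that(1)] i(2) that(2) show False by (simp add: I_def)
        qed
      qed
      have "(\<Sum>i'\<le>r. indicator I (sJ (mix i' z) + t)) = (\<Sum>i'\<le>r. if i' = i then 1 else (0::ennreal))"
      proof (intro sum.cong refl)
        fix i' assume i': "i' \<in> {..r}"
        show "indicator I (sJ (mix i' z) + t) = (if i' = i then 1 else (0::ennreal))"
        proof (cases "i' = i")
          case True
          show ?thesis unfolding True indicator_def using i(2) by (simp only: if_True of_bool_eq simp_thms)
        next
          case False
          then have "sJ (mix i' z) + t \<notin> I" using uniq i' by blast
          then show ?thesis unfolding indicator_def using False by (simp only: if_False of_bool_eq simp_thms)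
        qed
      qed
      then show ?thesis using i by simp
    next
      case False
      then have "(\<Sum>i\<le>r. indicator I (sJ (mix i z) + t)) = (0 :: ennreal)" by (intro sum.neutral) auto
      then show ?thesis by simp
    qed
    have "(\<Sum>i\<le>r. \<Psi> (sJ (mix i z))) = (\<integral>\<^sup>+ y. (\<Sum>i\<le>r. indicator I (sJ (mix i z) + sK y)) \<partial>PiM K (\<lambda>_. M))"
      unfolding \<Psi>_def by (intro nn_integral_sum[symmetric]) measurable
    also have "\<dots> \<le> (\<integral>\<^sup>+ y. 1 \<partial>PiM K (\<lambda>_. M))" by (intro nn_integral_mono one)
    finally show ?thesis by (simp add: PK.emeasure_space_1)
  qed
  have "of_nat (Suc r) * conc M f h (J \<union> K) a = (\<Sum>i\<le>r. conc M f h (J \<union> K) a)" by simp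
  also have "\<dots> = (\<Sum>i\<le>r. \<integral>\<^sup>+ z. \<Psi> (sJ (mix i z)) \<partial>PiM J (\<lambda>_. M \<Otimes>\<^sub>M M))"
    by (intro sum.cong mixed refl)
  also have "\<dots> = (\<integral>\<^sup>+ z. (\<Sum>i\<le>r. \<Psi> (sJ (mix i z))) \<partial>PiM J (\<lambda>_. M \<Otimes>\<^sub>M M))"
    by (intro nn_integral_sum[symmetric]) measurable
  also have "\<dots> \<le> (\<integral>\<^sup>+ z. indicator G z + ennreal ((real r + 1) * F) * indicator (space (PiM J (\<lambda>_. M \<Otimes>\<^sub>M M)) - G) z
      \<partial>PiM J (\<lambda>_. M \<Otimes>\<^sub>M M))"
  proof (intro nn_integral_mono)
    fix z assume z: "z \<in> space (PiM J (\<lambda>_. M \<Otimes>\<^sub>M M))"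
    have "(\<Sum>i\<le>r. \<Psi> (sJ (mix i z))) \<le> (\<Sum>i\<le>r. ennreal F)" by (intro sum_mono \<Psi>F)
    also have "\<dots> = ennreal ((real r + 1) * F)" using F by (simp add: ennreal_mult ennreal_of_nat_eq_real_of_nat add.commute)
    finally show "(\<Sum>i\<le>r. \<Psi> (sJ (mix i z))) \<le> indicator G z +
        ennreal ((real r + 1) * F) * indicator (space (PiM J (\<lambda>_. M \<Otimes>\<^sub>M M)) - G) z"
      using good z by (cases "z \<in> G") auto
  qed
  also have "\<dots> = ennreal (PP.prob G) + ennreal ((real r + 1) * F) * ennreal (1 - PP.prob G)"
    by (subst nn_integral_add) (auto simp: nn_integral_cmult PP.emeasure_eq_measure PP.prob_compl)
  also have "\<dots> = ennreal (\<beta> + (real r + 1) * F * (1 - \<beta>))"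
    unfolding probG using \<beta> F by (subst ennreal_mult[symmetric]) (auto simp: ennreal_plus[symmetric] simp del: ennreal_plus)
  finally have main: "of_nat (Suc r) * conc M f h (J \<union> K) a \<le> ennreal (\<beta> + (real r + 1) * F * (1 - \<beta>))" .
  have "conc M f h (J \<union> K) a = ennreal (1 / (real r + 1)) * (of_nat (Suc r) * conc M f h (J \<union> K) a)"
  proof -
    have "ennreal (1 / (real r + 1)) * of_nat (Suc r) = ennreal (1 / (real r + 1) * real (Suc r))"
      unfolding ennreal_of_nat_eq_real_of_nat by (rule ennreal_mult[symmetric]) auto
    also have "1 / (real r + 1) * real (Suc r) = 1" by simp
    finally show ?thesis by (simp add: mult.assoc[symmetric] del: of_nat_Suc)
  qed
  also have "\<dots> \<le> ennreal (1 / (real r + 1)) * ennreal (\<beta> + (real r + 1) * F * (1 - \<beta>))"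
    by (intro mult_left_mono main) auto
  also have "\<dots> = ennreal (1 / (real r + 1) * (\<beta> + (real r + 1) * F * (1 - \<beta>)))"
    using \<beta> F by (intro ennreal_mult[symmetric]) auto
  also have "1 / (real r + 1) * (\<beta> + (real r + 1) * F * (1 - \<beta>)) = \<beta> / (real r + 1) + (1 - \<beta>) * F"
    by (simp add: field_simps)
  finally show ?thesis unfolding \<beta>_def .
qed

text \<open>Iterating over \<open>q\<close> disjoint blocks: it suffices that one of them is good.\<close>
lemma (in prob_space) conc_blocks:
  fixes f :: "'i \<Rightarrow> 'a \<Rightarrow> real"
  assumes f[measurable]: "\<And>j. f j \<in> borel_measurable M"
    and A: "A \<in> sets M" and B: "B \<in> sets M"
    and J: "finite J" "card J = q * r"
    and gap: "\<And>j x y. j \<in> J \<Longrightarrow> x \<in> A \<Longrightarrow> y \<in> B \<Longrightarrow> f j x - f j y \<ge> h" and h: "h > 0"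
  shows "conc M f h J a \<le> ennreal (1 / (real r + 1) + (1 - (prob A * prob B) ^ r) ^ q)"
  using J gap
proof (induction q arbitrary: J a)
  case 0
  interpret PJ: prob_space "PiM J (\<lambda>_. M)" by (intro prob_space_PiM) unfold_locales
  have "conc M f h J a \<le> (\<integral>\<^sup>+ x. 1 \<partial>PiM J (\<lambda>_. M))"
    unfolding conc_def by (intro nn_integral_mono) (auto split: split_indicator)
  also have "\<dots> = ennreal 1" by (simp add: PJ.emeasure_space_1)
  also have "\<dots> \<le> ennreal (1 / (real r + 1) + 1)" by (intro ennreal_leI) simp
  finally show ?case by (simp add: add.commute)
next
  case (Suc q)
  let ?\<beta> = "(prob A * prob B) ^ r" and ?F = "1 / (real r + 1) + (1 - (prob A * prob B) ^ r) ^ q"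
  have \<beta>: "0 \<le> ?\<beta>" "?\<beta> \<le> 1" by (auto intro!: power_le_one mult_le_one)
  have "r \<le> card J" using Suc.prems(2) by simp
  then obtain J1 where J1: "J1 \<subseteq> J" "card J1 = r" by (metis obtain_subset_with_card_n)
  have fin1: "finite J1" using J1 Suc.prems finite_subset by blast
  obtain \<rho> where \<rho>: "bij_betw \<rho> J1 {..<r}"
    using ex_bij_betw_finite_nat[OF fin1] J1 by (auto simp: lessThan_atLeast0)
  have "conc M f h (J1 \<union> (J - J1)) a \<le> ennreal (?\<beta> / (real r + 1) + (1 - ?\<beta>) * ?F)"
  proof (rule conc_block_step[OF fin1 _ _ \<rho> f A B _ h])
    show "conc M f h (J - J1) a \<le> ennreal ?F" for a
      using Suc.prems J1 fin1 by (intro Suc.IH) (auto simp: card_Diff_subset)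
    show "0 \<le> ?F" using \<beta> by simp
  qed (use Suc.prems J1 in auto)
  also have "J1 \<union> (J - J1) = J" using J1 by auto
  also have "?\<beta> / (real r + 1) + (1 - ?\<beta>) * ?F = 1 / (real r + 1) + (1 - ?\<beta>) ^ Suc q"
    by (simp add: diff_divide_distrib ring_distribs)
  finally show ?case .
qed

section \<open>A weak Littlewood-Offord inequality\<close>

text \<open>Non-degeneracy is what the lower bound for the determinant draws from the law of the entries.\<close>
locale plane_law = prob_space M for M :: "complex measure" +
  assumes sets_law [measurable_cong]: "sets M = sets borel"
    and nondegenerate: "\<And>a. \<not> (AE x in M. x = a)"

text \<open>The support of the law, that is the complement of the largest open null set, has at least two points.
The largest open null set exists by the Lindelof property.\<close>
lemma (in plane_law) two_support_points:
  obtains a b where "a \<noteq> b" "\<And>\<rho>. \<rho> > 0 \<Longrightarrow> prob (ball a \<rho>) > 0" "\<And>\<rho>. \<rho> > 0 \<Longrightarrow> prob (ball b \<rho>) > 0"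
proof -
  define F where "F = {U. open U \<and> prob U = 0}"
  obtain F' where F': "F' \<subseteq> F" "countable F'" "\<Union>F' = \<Union>F"
    using Lindelof[of F] by (auto simp: F_def)
  have "(\<Union>U\<in>F'. U) \<in> null_sets M"
  proof (rule null_sets_UN'[OF F'(2)])
    fix U assume "U \<in> F'"
    then have "open U" "prob U = 0" using F' by (auto simp: F_def)
    then show "U \<in> null_sets M" by (intro null_setsI) (auto simp: emeasure_eq_measure sets_law)
  qed
  then have AE: "AE x in M. x \<notin> \<Union>F" using AE_not_in F' by force
  have supp: "prob (ball a \<rho>) > 0" if "a \<notin> \<Union>F" "\<rho> > 0" for a \<rho>
    using that measure_nonneg[of M "ball a \<rho>"] by (force simp: F_def less_le)
  have "\<not> (\<Union>F = UNIV)" using AE prob_space.AE_const prob_space_axioms by force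
  then obtain a where a: "a \<notin> \<Union>F" by blast
  have "\<exists>b. b \<notin> \<Union>F \<and> b \<noteq> a"
  proof (rule ccontr)
    assume "\<not> ?thesis"
    then have "AE x in M. x = a" using AE by (auto elim!: eventually_mono)
    then show False using nondegenerate by blast
  qed
  then show thesis using that a supp by metis
qed

text \<open>The constant only has to be below \<open>1 / sqrt 2\<close>. Rotating by one of four directions makes it possible to
treat complex coefficients by a one-dimensional inequality.\<close>
lemma quadrant_direction:
  fixes w :: complex
  shows "\<exists>\<theta>\<in>{1, -1, \<i>, -\<i>}. Re (\<theta> * w) \<ge> 7/10 * cmod w"
proof -
  have "7/10 * cmod w \<le> max \<bar>Re w\<bar> \<bar>Im w\<bar>"
  proof (rule power2_le_imp_le)
    have avg: "49/100 * (x + y) \<le> y" if "x \<le> y" "0 \<le> y" for x y :: real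
      using that by simp
    have "(7/10 * cmod w)\<^sup>2 = 49/100 * ((Re w)\<^sup>2 + (Im w)\<^sup>2)"
      by (simp add: power_mult_distrib cmod_power2 power_divide)
    also have "\<dots> \<le> (max \<bar>Re w\<bar> \<bar>Im w\<bar>)\<^sup>2"
    proof (cases "\<bar>Re w\<bar> \<le> \<bar>Im w\<bar>")
      case True
      then have "(Re w)\<^sup>2 \<le> (Im w)\<^sup>2" by (simp add: abs_le_square_iff)
      then have "49/100 * ((Re w)\<^sup>2 + (Im w)\<^sup>2) \<le> (Im w)\<^sup>2"
        by (intro avg) simp_all
      with True show ?thesis by (simp add: max_def)
    next
      case False
      then have "(Im w)\<^sup>2 \<le> (Re w)\<^sup>2" by (simp add: abs_le_square_iff)
      then have "49/100 * ((Im w)\<^sup>2 + (Re w)\<^sup>2) \<le> (Re w)\<^sup>2"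
        by (intro avg) simp_all
      with False show ?thesis by (simp add: max_def add.commute)
    qed
    finally show "(7/10 * cmod w)\<^sup>2 \<le> (max \<bar>Re w\<bar> \<bar>Im w\<bar>)\<^sup>2" .
  qed simp
  then consider "7/10 * cmod w \<le> \<bar>Re w\<bar>" | "7/10 * cmod w \<le> \<bar>Im w\<bar>" by linarith
  then show ?thesis
  proof cases
    case 1
    then show ?thesis by (cases "0 \<le> Re w") simp_all
  next
    case 2
    then show ?thesis by (cases "0 \<le> Im w") simp_all
  qed
qed

text \<open>An anti-concentration bound that is uniform in the number of variables, the coefficients and the shift:
only the number of large coefficients counts. The variables are indexed by pairs, as they will be the
entries of a matrix.\<close>
definition spreads :: "complex measure \<Rightarrow> real \<Rightarrow> real \<Rightarrow> nat \<Rightarrow> bool" where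
  "spreads D \<tau> \<epsilon> K \<longleftrightarrow> (\<forall>(J :: (nat \<times> nat) set) v a \<sigma>. finite J \<longrightarrow> \<sigma> > 0 \<longrightarrow> K \<le> card {j\<in>J. \<sigma> \<le> cmod (v j)} \<longrightarrow>
     measure (PiM J (\<lambda>_. D)) {x \<in> space (PiM J (\<lambda>_. D)). cmod ((\<Sum>j\<in>J. v j * x j) + a) < \<sigma> * \<tau>} \<le> \<epsilon>)"

text \<open>Two small discs \<open>A\<close> and \<open>B\<close> around two points of the support are used: the differences of their
points are all close to one vector \<open>u\<close>. At least a quarter of the large coefficients lie in one of the four
directions, and after this rotation exchanging a point of \<open>B\<close> for a point of \<open>A\<close> in such a coordinate
increases the real part of the sum by a fixed amount. The other coordinates are fixed by conditioning.
The block argument gives a bound that vanishes as \<open>K\<close> grows, without the classical rate \<open>1 / sqrt K\<close>, which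
would come from Sperner's theorem.\<close>
lemma (in plane_law) weak_littlewood_offord:
  obtains \<tau> c where "0 < \<tau>" "0 < c" "c \<le> 1" "\<And>a. prob (ball a \<tau>) \<le> 1 - c"
    "\<And>\<epsilon>. \<epsilon> > 0 \<Longrightarrow> \<exists>K. spreads M \<tau> \<epsilon> K"
proof -
  obtain a0 b0 where ab: "a0 \<noteq> b0" "\<And>\<rho>. \<rho> > 0 \<Longrightarrow> prob (ball a0 \<rho>) > 0" "\<And>\<rho>. \<rho> > 0 \<Longrightarrow> prob (ball b0 \<rho>) > 0"
    using two_support_points by blast
  define u where "u = a0 - b0"
  define d where "d = cmod u"
  have d: "d > 0" using ab by (simp add: u_def d_def)
  define A where "A = ball a0 (d/50)"
  define B where "B = ball b0 (d/50)"
  define \<tau> where "\<tau> = d / 8"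
  define c where "c = min (prob A) (prob B)"
  have AB: "prob A > 0" "prob B > 0" using ab d by (auto simp: A_def B_def)
  have sA: "A \<in> sets M" "B \<in> sets M" by (auto simp: A_def B_def sets_law)
  have diff: "cmod (x - y - u) \<le> d / 25" if "x \<in> A" "y \<in> B" for x y
  proof -
    have "cmod ((x - a0) - (y - b0)) \<le> cmod (x - a0) + cmod (y - b0)" by (rule norm_triangle_ineq4)
    also have "\<dots> \<le> d/50 + d/50"
      using that by (intro add_mono) (auto simp: A_def B_def dist_norm norm_minus_commute intro: less_imp_le)
    finally show ?thesis by (simp add: u_def algebra_simps)
  qed
  show thesis
  proof (rule that[of \<tau> c])
    show "0 < \<tau>" "0 < c" "c \<le> 1" using d AB by (auto simp: \<tau>_def c_def intro: min.coboundedI1)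
    fix a
    have "ball a \<tau> \<inter> A = {} \<or> ball a \<tau> \<inter> B = {}"
    proof (rule ccontr)
      assume "\<not> ?thesis"
      then obtain x y where xy: "x \<in> A" "dist a x < \<tau>" "y \<in> B" "dist a y < \<tau>" by auto
      have "d = cmod ((x - y) - (x - y - u))" by (simp add: d_def)
      also have "\<dots> \<le> cmod (x - y) + cmod (x - y - u)" by (rule norm_triangle_ineq4)
      also have "cmod (x - y) \<le> 2 * \<tau>"
        using dist_triangle[of x y a] xy by (simp add: dist_norm norm_minus_commute)
      finally show False using diff[OF xy(1,3)] d by (simp add: \<tau>_def)
    qed
    then show "prob (ball a \<tau>) \<le> 1 - c"
    proof
      assume "ball a \<tau> \<inter> A = {}"
      then have "prob (ball a \<tau>) + prob A = prob (ball a \<tau> \<union> A)"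
        using sA by (intro finite_measure_Union[symmetric]) (auto simp: sets_law)
      then show ?thesis using prob_le_1[of "ball a \<tau> \<union> A"] unfolding c_def by linarith
    next
      assume "ball a \<tau> \<inter> B = {}"
      then have "prob (ball a \<tau>) + prob B = prob (ball a \<tau> \<union> B)"
        using sA by (intro finite_measure_Union[symmetric]) (auto simp: sets_law)
      then show ?thesis using prob_le_1[of "ball a \<tau> \<union> B"] unfolding c_def by linarith
    qed
  next
    fix \<epsilon> :: real assume \<epsilon>: "\<epsilon> > 0"
    obtain r :: nat where r: "1 / (real r + 1) < \<epsilon> / 2"
      using reals_Archimedean[of "\<epsilon>/2"] \<epsilon> by (auto simp: inverse_eq_divide add.commute)
    define \<beta> where "\<beta> = (prob A * prob B) ^ r"
    have "prob A * prob B \<le> 1" by (intro mult_le_one) auto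
    then have \<beta>: "0 < \<beta>" "\<beta> \<le> 1" using AB by (auto simp: \<beta>_def intro!: power_le_one)
    obtain q where q: "(1 - \<beta>) ^ q < \<epsilon> / 2"
      using real_arch_pow_inv[of "\<epsilon>/2" "1 - \<beta>"] \<epsilon> \<beta> by auto
    \<comment> \<open>The factor \<open>4\<close> pays for the pigeonhole principle over the four directions.\<close>
    have "spreads M \<tau> \<epsilon> (4 * (q * r))"
      unfolding spreads_def
    proof (intro allI impI)
      fix J :: "(nat \<times> nat) set" and v a and \<sigma> :: real
      assume J: "finite J" and \<sigma>: "\<sigma> > 0" and K: "4 * (q * r) \<le> card {j\<in>J. \<sigma> \<le> cmod (v j)}"
      define W where "W = (\<lambda>\<theta>. {j\<in>J. \<sigma> \<le> cmod (v j) \<and> 7/10 * (cmod (v j) * d) \<le> Re (\<theta> * (v j * u))})"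
      have "\<exists>\<theta>\<in>{1, -1, \<i>, -\<i>}. q * r \<le> card (W \<theta>)"
      proof (rule ccontr)
        assume no: "\<not> ?thesis"
        have "{j\<in>J. \<sigma> \<le> cmod (v j)} \<subseteq> (\<Union>\<theta>\<in>{1, -1, \<i>, -\<i>}. W \<theta>)"
        proof
          fix j assume "j \<in> {j\<in>J. \<sigma> \<le> cmod (v j)}"
          with quadrant_direction[of "v j * u"] show "j \<in> (\<Union>\<theta>\<in>{1, -1, \<i>, -\<i>}. W \<theta>)"
            unfolding W_def d_def norm_mult by blast
        qed
        then have "card {j\<in>J. \<sigma> \<le> cmod (v j)} \<le> card (\<Union>\<theta>\<in>{1, -1, \<i>, -\<i>}. W \<theta>)"
          using J by (intro card_mono) (auto simp: W_def)
        also have "\<dots> \<le> (\<Sum>\<theta>\<in>{1, -1, \<i>, -\<i>}. card (W \<theta>))" by (rule card_UN_le) simp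
        also have "\<dots> < (\<Sum>\<theta>\<in>{1, -1, \<i>, -\<i> :: complex}. q * r)"
          using no by (intro sum_strict_mono) (auto simp: not_le)
        also have "\<dots> = card {1, -1, \<i>, -\<i> :: complex} * (q * r)" by simp
        also have "\<dots> \<le> 4 * (q * r)"
          by (intro mult_right_mono) (auto intro: order_trans[OF card_insert_le_m1] simp: card_insert_if)
        finally show False using K by simp
      qed
      then obtain \<theta> where \<theta>: "\<theta> \<in> {1, -1, \<i>, -\<i>}" "q * r \<le> card (W \<theta>)" by blast
      then have n\<theta>: "cmod \<theta> = 1" by auto
      obtain J0 where J0: "J0 \<subseteq> W \<theta>" "card J0 = q * r" using \<theta>(2) by (metis obtain_subset_with_card_n)
      have J0J: "J0 \<subseteq> J" using J0 by (auto simp: W_def)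
      have fin: "finite J0" using J0J J finite_subset by blast
      define f where "f = (\<lambda>j x. Re (\<theta> * (v j * x)))"
      have f[measurable]: "f j \<in> borel_measurable M" for j
        unfolding f_def by (auto simp: measurable_cong_sets[OF sets_law refl] intro!: borel_measurable_continuous_onI continuous_intros)
      define h where "h = \<sigma> * d / 2"
      have h: "h > 0" using \<sigma> d by (simp add: h_def)
      have gap: "h \<le> f j x - f j y" if "j \<in> J0" "x \<in> A" "y \<in> B" for j x y
      proof -
        have vj: "\<sigma> \<le> cmod (v j)" "7/10 * (cmod (v j) * d) \<le> Re (\<theta> * (v j * u))"
          using that J0 by (auto simp: W_def)
        have "f j x - f j y = Re (\<theta> * (v j * u)) + Re (\<theta> * (v j * (x - y - u)))"
          by (simp add: f_def algebra_simps)
        moreover have "\<bar>Re (\<theta> * (v j * (x - y - u)))\<bar> \<le> cmod (v j) * d / 25"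
        proof -
          have "\<bar>Re (\<theta> * (v j * (x - y - u)))\<bar> \<le> cmod (\<theta> * (v j * (x - y - u)))" by (rule abs_Re_le_cmod)
          also have "\<dots> = cmod (v j) * cmod (x - y - u)" by (simp add: norm_mult n\<theta>)
          also have "\<dots> \<le> cmod (v j) * (d / 25)" using diff that by (intro mult_left_mono) auto
          finally show ?thesis by simp
        qed
        moreover have "\<sigma> * d \<le> cmod (v j) * d" using vj d by (intro mult_right_mono) auto
        moreover have "0 \<le> \<sigma> * d" using \<sigma> d by simp
        ultimately show ?thesis using vj(2) unfolding h_def abs_le_iff by linarith
      qed
      have conc: "conc M f h J0 b \<le> ennreal (1 / (real r + 1) + (1 - \<beta>) ^ q)" for b
        unfolding \<beta>_def by (rule conc_blocks[OF f sA fin J0(2) gap h]) auto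
      let ?E = "{x \<in> space (PiM J (\<lambda>_. M)). cmod ((\<Sum>j\<in>J. v j * x j) + a) < \<sigma> * \<tau>}"
      show "measure (PiM J (\<lambda>_. M)) ?E \<le> \<epsilon>"
      proof (rule prob_section_bound)
        show "J = (J - J0) \<union> J0" using J0J by auto
        show "?E \<in> sets (PiM J (\<lambda>_. M))" by measurable
        fix y assume y: "y \<in> space (PiM (J - J0) (\<lambda>_. M))"
        interpret P0: prob_space "PiM J0 (\<lambda>_. M)" by (intro prob_space_PiM) unfold_locales
        define w where "w = (\<Sum>j\<in>J - J0. v j * y j) + a"
        define b where "b = - Re (\<theta> * w) - h / 4"
        let ?S = "{x \<in> space (PiM J0 (\<lambda>_. M)). (\<Sum>j\<in>J0. f j (x j)) \<in> {b..<b + h}}"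
        have S: "?S \<in> sets (PiM J0 (\<lambda>_. M))" by measurable
        have sub: "{x \<in> space (PiM J0 (\<lambda>_. M)). merge (J - J0) J0 (y, x) \<in> ?E} \<subseteq> ?S"
        proof safe
          fix x assume x: "x \<in> space (PiM J0 (\<lambda>_. M))"
            and E: "cmod ((\<Sum>j\<in>J. v j * merge (J - J0) J0 (y, x) j) + a) < \<sigma> * \<tau>"
          have "(\<Sum>j\<in>J. v j * merge (J - J0) J0 (y, x) j)
            = (\<Sum>j\<in>J - J0. v j * merge (J - J0) J0 (y, x) j) + (\<Sum>j\<in>J0. v j * merge (J - J0) J0 (y, x) j)"
            using J J0J by (simp add: sum.subset_diff)
          also have "(\<Sum>j\<in>J - J0. v j * merge (J - J0) J0 (y, x) j) = (\<Sum>j\<in>J - J0. v j * y j)"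
            by (intro sum.cong) (auto simp: merge_def)
          also have "(\<Sum>j\<in>J0. v j * merge (J - J0) J0 (y, x) j) = (\<Sum>j\<in>J0. v j * x j)"
            by (intro sum.cong) (auto simp: merge_def)
          finally have "cmod (w + (\<Sum>j\<in>J0. v j * x j)) < \<sigma> * \<tau>" using E by (simp add: w_def add_ac)
          then have "\<bar>Re (\<theta> * (w + (\<Sum>j\<in>J0. v j * x j)))\<bar> < h / 4"
            using abs_Re_le_cmod[of "\<theta> * (w + (\<Sum>j\<in>J0. v j * x j))"] n\<theta>
            by (simp add: norm_mult h_def \<tau>_def)
          moreover have "Re (\<theta> * (w + (\<Sum>j\<in>J0. v j * x j))) = Re (\<theta> * w) + (\<Sum>j\<in>J0. f j (x j))"
            unfolding f_def ring_distribs sum_distrib_left by (simp only: plus_complex.sel Re_sum)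
          ultimately show "(\<Sum>j\<in>J0. f j (x j)) \<in> {b..<b + h}" using h unfolding b_def atLeastLessThan_iff by linarith
        qed
        have "P0.prob {x \<in> space (PiM J0 (\<lambda>_. M)). merge (J - J0) J0 (y, x) \<in> ?E} \<le> P0.prob ?S"
          by (rule P0.finite_measure_mono[OF sub S])
        also have "\<dots> \<le> \<epsilon>"
        proof -
          have "ennreal (P0.prob ?S) = (\<integral>\<^sup>+ x. indicator ?S x \<partial>PiM J0 (\<lambda>_. M))"
            using S by (simp add: P0.emeasure_eq_measure)
          also have "\<dots> = conc M f h J0 b"
            unfolding conc_def by (intro nn_integral_cong) (auto split: split_indicator)
          also have "\<dots> \<le> ennreal \<epsilon>"
            by (rule order_trans[OF conc ennreal_leI]) (use r q in linarith)
          finally show ?thesis using \<epsilon> by simp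
        qed
        finally show "P0.prob {x \<in> space (PiM J0 (\<lambda>_. M)). merge (J - J0) J0 (y, x) \<in> ?E} \<le> \<epsilon>" .
      qed (use J fin \<epsilon> in auto)
    qed
    then show "\<exists>K. spreads M \<tau> \<epsilon> K" ..
  qed
qed

section \<open>Minors, cofactors and maximal minors\<close>

text \<open>The determinant of the leading part of an infinite array. Submatrices are formed by composing the array
with functions that select rows and columns, also with repetitions.\<close>
definition minor :: "nat \<Rightarrow> (nat \<Rightarrow> nat \<Rightarrow> complex) \<Rightarrow> complex" where
  "minor k G = det (mat k k (\<lambda>(a, b). G a b))"

lemma minor_0 [simp]: "minor 0 G = 1"
  by (simp add: minor_def)

lemma minor_cong: "(\<And>a b. a < k \<Longrightarrow> b < k \<Longrightarrow> G a b = H a b) \<Longrightarrow> minor k G = minor k H"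
  unfolding minor_def by (intro arg_cong[where f = det] cong_mat) auto

lemma minor_transpose: "minor k (\<lambda>a b. G b a) = minor k G"
proof -
  have "transpose_mat (mat k k (\<lambda>(a, b). G a b)) = mat k k (\<lambda>(a, b). G b a)"
    by (intro eq_matI) auto
  then show ?thesis unfolding minor_def using det_transpose[of "mat k k (\<lambda>(a, b). G a b)" k] by simp
qed

lemma minor_expand:
  "minor k G = (\<Sum>p | p permutes {..<k}. of_int (sign p) * (\<Prod>i<k. G i (p i)))"
proof -
  have "minor k G = (\<Sum>p | p permutes {0..<k}. of_int (sign p) * (\<Prod>i = 0..<k. (mat k k (\<lambda>(a, b). G a b)) $$ (i, p i)))"
    unfolding minor_def by (rule det_def') simp
  also have "\<dots> = (\<Sum>p | p permutes {0..<k}. of_int (sign p) * (\<Prod>i = 0..<k. G i (p i)))"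
    by (intro sum.cong refl arg_cong2[of _ _ _ _ "(*)"] prod.cong) (auto simp: permutes_in_image[where S = "{0..<k}", simplified])
  finally show ?thesis by (simp add: lessThan_atLeast0)
qed

lemma norm_minor_le:
  assumes "\<And>a b. a < k \<Longrightarrow> b < k \<Longrightarrow> cmod (G a b) \<le> B b"
  shows "cmod (minor k G) \<le> fact k * (\<Prod>b<k. B b)"
proof -
  have "cmod (minor k G) \<le> (\<Sum>p | p permutes {..<k}. \<Prod>b<k. B b)"
    unfolding minor_expand
  proof (intro sum_norm_le)
    fix p assume p: "p \<in> {p. p permutes {..<k}}"
    then have img: "p i < k" if "i < k" for i using that permutes_in_image[of p "{..<k}" i] by simp
    have "cmod (of_int (sign p) * (\<Prod>i<k. G i (p i))) = (\<Prod>i<k. cmod (G i (p i)))"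
      by (cases p rule: sign_cases) (simp_all add: norm_mult prod_norm)
    also have "\<dots> \<le> (\<Prod>i<k. B (p i))" using assms img by (intro prod_mono) auto
    also have "\<dots> = (\<Prod>b<k. B b)" using p prod.permute[of p "{..<k}" B] by (simp add: comp_def)
    finally show "cmod (of_int (sign p) * (\<Prod>i<k. G i (p i))) \<le> (\<Prod>b<k. B b)" .
  qed
  also have "\<dots> = fact k * (\<Prod>b<k. B b)" by (simp add: card_permutations)
  finally show ?thesis .
qed

lemma minor_eq_0_rows:
  assumes "i < k" "j < k" "i \<noteq> j" "\<And>b. b < k \<Longrightarrow> G i b = G j b"
  shows "minor k G = 0"
proof -
  have "row (mat k k (\<lambda>(a, b). G a b)) i = row (mat k k (\<lambda>(a, b). G a b)) j"
    using assms by (intro eq_vecI) simp_all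
  then show ?thesis
    unfolding minor_def using assms(1-3) det_identical_rows[of "mat k k (\<lambda>(a, b). G a b)" k i j] by simp
qed

lemma minor_eq_0_cols:
  assumes "i < k" "j < k" "i \<noteq> j" "\<And>a. a < k \<Longrightarrow> G a i = G a j"
  shows "minor k G = 0"
  using minor_eq_0_rows[of i k j "\<lambda>a b. G b a"] assms unfolding minor_transpose[of k G] by blast

lemma norm_minor_permute_rows:
  assumes "p permutes {..<k}"
  shows "cmod (minor k (\<lambda>a b. G (p a) b)) = cmod (minor k G)"
proof -
  have img: "p i < k" if "i < k" for i using that assms permutes_in_image[of p "{..<k}" i] by simp
  let ?A = "mat k k (\<lambda>(a, b). G a b)"
  have "mat k k (\<lambda>(i, j). ?A $$ (p i, j)) = mat k k (\<lambda>(a, b). G (p a) b)"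
    using img by (intro cong_mat) auto
  then have "minor k (\<lambda>a b. G (p a) b) = of_int (sign p) * minor k G"
    unfolding minor_def using det_permute_rows[of ?A k p] assms by (simp add: lessThan_atLeast0)
  moreover have "cmod (of_int (sign p)) = 1" by (cases p rule: sign_cases) simp_all
  ultimately show ?thesis by (simp only: norm_mult mult_1)
qed

lemma norm_minor_permute_cols:
  assumes "p permutes {..<k}"
  shows "cmod (minor k (\<lambda>a b. G a (p b))) = cmod (minor k G)"
  using norm_minor_permute_rows[OF assms, of "\<lambda>a b. G b a"]
  unfolding minor_transpose[of k G] minor_transpose[of k "\<lambda>a b. G a (p b)"] .

definition skip :: "nat \<Rightarrow> nat \<Rightarrow> nat" where
  "skip b i = (if i < b then i else Suc i)"

text \<open>The cofactors of the last row in an array with \<open>k + 1\<close> rows and columns; they depend on the first \<open>k\<close>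
rows only.\<close>
definition cof :: "nat \<Rightarrow> (nat \<Rightarrow> nat \<Rightarrow> complex) \<Rightarrow> nat \<Rightarrow> complex" where
  "cof k G b = (-1) ^ (k + b) * minor k (\<lambda>a i. G a (skip b i))"

lemma minor_last_row:
  "minor (Suc k) G = (\<Sum>b\<le>k. G k b * cof k G b)"
proof -
  let ?A = "mat (Suc k) (Suc k) (\<lambda>(a, b). G a b)"
  have "minor (Suc k) G = (\<Sum>b<Suc k. ?A $$ (k, b) * cofactor ?A k b)"
    unfolding minor_def by (rule laplace_expansion_row) auto
  also have "\<dots> = (\<Sum>b\<le>k. G k b * cof k G b)"
    unfolding lessThan_Suc_atMost
  proof (intro sum.cong refl)
    fix b assume b: "b \<in> {..k}"
    have "mat_delete ?A k b = mat k k (\<lambda>(a, i). G a (skip b i))"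
      unfolding mat_delete_def skip_def by (intro eq_matI) (use b in auto)
    then show "?A $$ (k, b) * cofactor ?A k b = G k b * cof k G b"
      using b by (simp add: cofactor_def cof_def minor_def)
  qed
  finally show ?thesis .
qed

lemma cof_cong: "(\<And>a b. a < k \<Longrightarrow> b \<le> k \<Longrightarrow> G a b = H a b) \<Longrightarrow> cof k G b = cof k H b"
  unfolding cof_def by (intro arg_cong2[of _ _ _ _ "(*)"] minor_cong) (auto simp: skip_def)

lemma cof_last: "cof k G k = minor k G"
  unfolding cof_def by (simp add: skip_def flip: mult_2) (rule minor_cong, simp)

text \<open>The vector of cofactors is normal to the first \<open>k\<close> rows: replacing the last row by another one gives a
determinant with two equal rows.\<close>
lemma cof_orthogonal:
  assumes "a < k"
  shows "(\<Sum>b\<le>k. G a b * cof k G b) = 0"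
proof -
  let ?H = "\<lambda>i b. if i = k then G a b else G i b"
  have "(\<Sum>b\<le>k. G a b * cof k G b) = (\<Sum>b\<le>k. ?H k b * cof k ?H b)"
    by (intro sum.cong refl arg_cong2[of _ _ _ _ "(*)"] cof_cong) auto
  also have "\<dots> = minor (Suc k) ?H" by (rule minor_last_row[symmetric])
  also have "\<dots> = 0" by (rule minor_eq_0_rows[of a _ k]) (use assms in auto)
  finally show ?thesis .
qed

text \<open>Cramer's rule, with the Leibniz formula as a crude bound for the determinant whose column \<open>i\<close> is
replaced by the right-hand side.\<close>
lemma cramer_bound:
  assumes Q: "\<And>a b. a < K \<Longrightarrow> b < K \<Longrightarrow> cmod (Q a b) \<le> 2"
    and eq: "\<And>a. a < K \<Longrightarrow> cmod (\<Sum>b<K. Q a b * u b) \<le> \<zeta>" and i: "i < K" and \<zeta>: "0 \<le> \<zeta>"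
  shows "cmod (u i) * cmod (minor K Q) \<le> fact K * 2 ^ K * \<zeta>"
proof -
  let ?A = "mat K K (\<lambda>(a, b). Q a b)" and ?x = "vec K u"
  let ?R = "\<lambda>a b. if b = i then (\<Sum>b<K. Q a b * u b) else Q a b"
  have "replace_col ?A (?A *\<^sub>v ?x) i = mat K K (\<lambda>(a, b). ?R a b)"
    unfolding replace_col_def
    by (intro eq_matI) (auto simp: scalar_prod_def lessThan_atLeast0)
  then have "minor K ?R = u i * minor K Q"
    unfolding minor_def using cramer_lemma_mat[of ?A K ?x i] i by simp
  then have "cmod (u i) * cmod (minor K Q) = cmod (minor K ?R)" by (simp add: norm_mult)
  also have "\<dots> \<le> fact K * (\<Prod>b<K. if b = i then \<zeta> else 2)"
    using Q eq by (intro norm_minor_le) auto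
  also have "(\<Prod>b<K. if b = i then \<zeta> else 2) = \<zeta> * 2 ^ (K - 1)"
    using i by (subst prod.remove[of _ i]) (auto simp: prod.If_cases)
  also have "fact K * (\<zeta> * 2 ^ (K - 1)) \<le> fact K * (\<zeta> * 2 ^ K)"
    using \<zeta> by (intro mult_left_mono power_increasing) auto
  finally show ?thesis by (simp add: mult_ac)
qed

text \<open>All maps are admitted as column choices, for those that are not injective give \<open>0\<close>.\<close>
definition maxminor :: "nat \<Rightarrow> nat \<Rightarrow> (nat \<Rightarrow> nat \<Rightarrow> complex) \<Rightarrow> real" where
  "maxminor k n G = Max ((\<lambda>c. cmod (minor k (\<lambda>a b. G a (c b)))) ` ({..<k} \<rightarrow>\<^sub>E {..<n}))"

lemma maxminor_ge:
  assumes "\<And>b. b < k \<Longrightarrow> c b < n"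
  shows "cmod (minor k (\<lambda>a b. G a (c b))) \<le> maxminor k n G"
proof -
  have "minor k (\<lambda>a b. G a (c b)) = minor k (\<lambda>a b. G a (restrict c {..<k} b))"
    by (intro minor_cong) auto
  moreover have "restrict c {..<k} \<in> {..<k} \<rightarrow>\<^sub>E {..<n}" using assms by auto
  ultimately have "cmod (minor k (\<lambda>a b. G a (c b))) \<in> (\<lambda>c. cmod (minor k (\<lambda>a b. G a (c b)))) ` ({..<k} \<rightarrow>\<^sub>E {..<n})"
    by (intro image_eqI[where x = "restrict c {..<k}"]) simp_all
  then show ?thesis
    unfolding maxminor_def by (intro Max_ge finite_imageI finite_PiE) auto
qed

lemma maxminor_attained:
  assumes "n > 0 \<or> k = 0"
  obtains c where "\<And>b. b < k \<Longrightarrow> c b < n" "maxminor k n G = cmod (minor k (\<lambda>a b. G a (c b)))"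
proof -
  have "{..<k} \<rightarrow>\<^sub>E {..<n} \<noteq> {}" using assms by (auto simp: PiE_eq_empty_iff)
  then have "maxminor k n G \<in> (\<lambda>c. cmod (minor k (\<lambda>a b. G a (c b)))) ` ({..<k} \<rightarrow>\<^sub>E {..<n})"
    unfolding maxminor_def by (intro Max_in) (auto intro!: finite_imageI finite_PiE)
  then show thesis using that by (auto simp: PiE_iff)
qed

lemma maxminor_0: "maxminor 0 n G = 1"
  by (simp add: maxminor_def)

lemma maxminor_nonneg: "n > 0 \<or> k = 0 \<Longrightarrow> 0 \<le> maxminor k n G"
  by (metis maxminor_attained norm_ge_zero)

lemma maxminor_cong:
  "(\<And>a j. a < k \<Longrightarrow> j < n \<Longrightarrow> G a j = H a j) \<Longrightarrow> maxminor k n G = maxminor k n H"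
  unfolding maxminor_def
  by (intro arg_cong[where f = Max] image_cong refl arg_cong[where f = cmod] minor_cong) (auto simp: PiE_iff)

lemma minor_nonzero_inj: "minor k (\<lambda>a b. G a (c b)) \<noteq> 0 \<Longrightarrow> inj_on c {..<k}"
  by (rule inj_onI, rule ccontr) (metis lessThan_iff minor_eq_0_cols)

text \<open>For square arrays every injective column choice is a permutation.\<close>
lemma maxminor_full: "n > 0 \<Longrightarrow> maxminor n n G \<le> cmod (minor n G)"
proof -
  assume "n > 0"
  then obtain c where c: "\<And>b. b < n \<Longrightarrow> c b < n" "maxminor n n G = cmod (minor n (\<lambda>a b. G a (c b)))"
    using maxminor_attained by blast
  show ?thesis
  proof (cases "minor n (\<lambda>a b. G a (c b)) = 0")
    case False
    then have inj: "inj_on c {..<n}" by (rule minor_nonzero_inj)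
    define p where "p = (\<lambda>b. if b < n then c b else b)"
    have "p permutes {..<n}"
    proof (rule bij_imp_permutes)
      have "inj_on p {..<n}" using inj by (auto simp: p_def inj_on_def)
      moreover have "p ` {..<n} \<subseteq> {..<n}" using c(1) by (auto simp: p_def)
      ultimately show "bij_betw p {..<n} {..<n}"
        by (simp add: bij_betw_def endo_inj_surj)
    qed (auto simp: p_def)
    then have "cmod (minor n (\<lambda>a b. G a (p b))) = cmod (minor n G)" by (rule norm_minor_permute_cols)
    moreover have "minor n (\<lambda>a b. G a (p b)) = minor n (\<lambda>a b. G a (c b))"
      by (intro minor_cong) (auto simp: p_def)
    ultimately show ?thesis using c by simp
  qed (use c in simp)
qed

text \<open>If fewer than \<open>K\<close> cofactors were large, then orthogonality to the first \<open>k\<close> rows would be an almost exact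
linear relation between fewer than \<open>K\<close> columns, with one coefficient equal to the maximal minor. Cramer's
rule in \<open>K\<close> rows in which these columns have a minor of size \<open>\<delta>\<close> shows that this coefficient would be too
small. The coefficient is the cofactor of the added column \<open>j\<close>.\<close>
lemma cofactors_spread:
  fixes s :: real
  assumes G: "\<And>a j. a < k \<Longrightarrow> j < n \<Longrightarrow> cmod (G a j) \<le> 2"
    and c: "\<And>b. b < k \<Longrightarrow> c b < n" and max: "maxminor k n G = cmod (minor k (\<lambda>a b. G a (c b)))"
    and pos: "0 < maxminor k n G" and c': "c' = c(k := j)" and j: "j < n" "j \<notin> c ` {..<k}"
    and cols: "\<And>w. inj_on w {..<K} \<Longrightarrow> (\<And>i. i < K \<Longrightarrow> w i < n) \<Longrightarrow>
       \<exists>\<rho>. (\<forall>i<K. \<rho> i < k) \<and> \<delta> \<le> cmod (minor K (\<lambda>a b. G (\<rho> a) (w b)))"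
    and K: "0 < K" "K \<le> Suc k" and s: "0 < s" "s \<le> 1" "fact K * 2 ^ Suc K * real (Suc k) * s < \<delta>"
  shows "K \<le> card {b. b \<le> k \<and> s * maxminor k n G \<le> cmod (cof k (\<lambda>a b. G a (c' b)) b)}"
proof (rule ccontr)
  let ?M = "maxminor k n G" and ?V = "cof k (\<lambda>a b. G a (c' b))"
  let ?W = "{b. b \<le> k \<and> s * ?M \<le> cmod (?V b)}"
  assume "\<not> K \<le> card ?W"
  have finW: "finite ?W" by simp
  have "inj_on c {..<k}" using pos max by (intro minor_nonzero_inj) auto
  then have inj: "inj_on c' {..k}"
    using j unfolding c' lessThan_Suc_atMost[symmetric] lessThan_Suc
    by (auto simp: inj_on_def)
  have c'n: "c' b < n" if "b \<le> k" for b using that c j by (auto simp: c')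
  have "?V k = minor k (\<lambda>a b. G a (c b))"
    unfolding cof_last by (intro minor_cong) (auto simp: c')
  then have Vk: "cmod (?V k) = ?M" using max by simp
  then have kW: "k \<in> ?W" using s pos by (simp add: mult_left_le_one_le)
  \<comment> \<open>Fill up the indices of large cofactors to exactly \<open>K\<close> indices, so that the relation becomes a square system.\<close>
  have "\<exists>W'. ?W \<subseteq> W' \<and> W' \<subseteq> {..k} \<and> card W' = K"
    using \<open>\<not> K \<le> card ?W\<close> K by (intro exists_subset_between) auto
  then obtain W' where W': "?W \<subseteq> W'" "W' \<subseteq> {..k}" "card W' = K" by blast
  have finW': "finite W'" using W' finite_subset by blast
  obtain e where e: "bij_betw e {..<K} W'"
    using ex_bij_betw_nat_finite[OF finW'] W' by (auto simp: lessThan_atLeast0)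
  have eW: "e i \<in> W'" if "i < K" for i using e that by (auto simp: bij_betw_def)
  obtain i0 where i0: "i0 < K" "e i0 = k" 
  proof -
    have "k \<in> e ` {..<K}" using kW W'(1) e unfolding bij_betw_def by blast
    then show thesis using that by auto
  qed
  have "inj_on (c' \<circ> e) {..<K}"
    using e inj W' by (intro comp_inj_on) (auto simp: bij_betw_def intro: inj_on_subset)
  moreover have "(c' \<circ> e) i < n" if "i < K" for i using eW[OF that] W' by (auto intro: c'n)
  ultimately obtain \<rho> where \<rho>: "\<And>i. i < K \<Longrightarrow> \<rho> i < k"
    "\<delta> \<le> cmod (minor K (\<lambda>a b. G (\<rho> a) ((c' \<circ> e) b)))" using cols by metis
  let ?\<zeta> = "2 * real (Suc k) * s * ?M"
  have "cmod (?V (e i0)) * cmod (minor K (\<lambda>a b. G (\<rho> a) ((c' \<circ> e) b))) \<le> fact K * 2 ^ K * ?\<zeta>"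
  proof (rule cramer_bound[OF _ _ i0(1)])
    show "cmod (G (\<rho> a) ((c' \<circ> e) b)) \<le> 2" if "a < K" "b < K" for a b
      using that \<rho>(1) eW[of b] W' c'n by (intro G) auto
    show "0 \<le> ?\<zeta>" using s pos by simp
    fix a assume a: "a < K"
    have "(\<Sum>b<K. G (\<rho> a) ((c' \<circ> e) b) * ?V (e b)) = (\<Sum>b\<in>W'. G (\<rho> a) (c' b) * ?V b)"
      using sum.reindex_bij_betw[OF e, of "\<lambda>b. G (\<rho> a) (c' b) * ?V b"] by simp
    also have "\<dots> = - (\<Sum>b\<in>{..k} - W'. G (\<rho> a) (c' b) * ?V b)"
      using cof_orthogonal[OF \<rho>(1)[OF a], of "\<lambda>a b. G a (c' b)"] W'
        sum.subset_diff[of W' "{..k}" "\<lambda>b. G (\<rho> a) (c' b) * ?V b"]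
      by (simp add: add_eq_0_iff)
    finally have "cmod (\<Sum>b<K. G (\<rho> a) ((c' \<circ> e) b) * ?V (e b))
        \<le> (\<Sum>b\<in>{..k} - W'. cmod (G (\<rho> a) (c' b) * ?V b))"
      by (simp add: norm_sum)
    also have "\<dots> \<le> (\<Sum>b\<in>{..k} - W'. 2 * (s * ?M))"
    proof (intro sum_mono)
      fix b assume b: "b \<in> {..k} - W'"
      then have "cmod (?V b) \<le> s * ?M" using W' by force
      moreover have "cmod (G (\<rho> a) (c' b)) \<le> 2" using b \<rho>(1)[OF a] c'n by (intro G) auto
      ultimately show "cmod (G (\<rho> a) (c' b) * ?V b) \<le> 2 * (s * ?M)"
        unfolding norm_mult by (intro mult_mono) auto
    qed
    also have "\<dots> = card ({..k} - W') * (2 * (s * ?M))" by simp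
    also have "\<dots> \<le> Suc k * (2 * (s * ?M))"
      using s pos card_mono[of "{..k}" "{..k} - W'"] by (intro mult_right_mono) auto
    finally show "cmod (\<Sum>b<K. G (\<rho> a) ((c' \<circ> e) b) * ?V (e b)) \<le> ?\<zeta>" by (simp add: algebra_simps)
  qed
  then have "?M * cmod (minor K (\<lambda>a b. G (\<rho> a) ((c' \<circ> e) b))) \<le> fact K * 2 ^ K * ?\<zeta>"
    unfolding i0(2) Vk .
  moreover have "?M * \<delta> \<le> ?M * cmod (minor K (\<lambda>a b. G (\<rho> a) ((c' \<circ> e) b)))"
    using \<rho>(2) pos by (intro mult_left_mono) auto
  ultimately have "?M * \<delta> \<le> fact K * 2 ^ K * ?\<zeta>" by linarith
  also have "\<dots> = ?M * (fact K * 2 ^ Suc K * real (Suc k) * s)" by (simp add: mult_ac)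
  also have "\<dots> < ?M * \<delta>" using s(3) pos by (intro mult_strict_left_mono) auto
  finally show False by simp
qed

section \<open>Revealing one more row of a random matrix\<close>

lemma borel_measurable_Max_finite:
  fixes f :: "'c \<Rightarrow> 'a \<Rightarrow> real"
  assumes "finite C" "C \<noteq> {}" "\<And>c. c \<in> C \<Longrightarrow> f c \<in> borel_measurable M"
  shows "(\<lambda>x. Max ((\<lambda>c. f c x) ` C)) \<in> borel_measurable M"
  using assms
proof (induction C rule: finite_ne_induct)
  case (insert c C)
  have "(\<lambda>x. Max ((\<lambda>c. f c x) ` insert c C)) = (\<lambda>x. max (f c x) (Max ((\<lambda>c. f c x) ` C)))"
    using insert.hyps by (intro ext) (simp add: Max_insert)
  then show ?case using insert by (simp add: borel_measurable_max)
qed simp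

lemma minor_measurable:
  assumes "\<And>a b. a < k \<Longrightarrow> b < k \<Longrightarrow> (\<lambda>x. G x a b) \<in> borel_measurable M"
  shows "(\<lambda>x. minor k (G x)) \<in> borel_measurable M"
  unfolding minor_expand
proof (intro borel_measurable_sum borel_measurable_times borel_measurable_const borel_measurable_prod)
  fix p i assume "p \<in> {p. p permutes {..<k}}" "i \<in> {..<k}"
  then show "(\<lambda>x. G x i (p i)) \<in> borel_measurable M"
    using permutes_in_image[of p "{..<k}" i] assms by simp
qed

lemma maxminor_measurable:
  assumes "\<And>a j. a < k \<Longrightarrow> j < n \<Longrightarrow> (\<lambda>x. G x a j) \<in> borel_measurable M" and "n > 0 \<or> k = 0"
  shows "(\<lambda>x. maxminor k n (G x)) \<in> borel_measurable M"
  unfolding maxminor_def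
proof (rule borel_measurable_Max_finite)
  show "{..<k} \<rightarrow>\<^sub>E {..<n} \<noteq> {}" using assms by (auto simp: PiE_eq_empty_iff)
  fix c assume c: "c \<in> {..<k} \<rightarrow>\<^sub>E {..<n}"
  show "(\<lambda>x. cmod (minor k (\<lambda>a b. G x a (c b)))) \<in> borel_measurable M"
  proof -
    have [measurable]: "(\<lambda>x. minor k (\<lambda>a b. G x a (c b))) \<in> borel_measurable M"
      by (rule minor_measurable) (use c assms(1) in \<open>auto simp: PiE_iff\<close>)
    show ?thesis by measurable
  qed
qed (auto intro: finite_PiE)

context plane_law
begin

abbreviation entries :: "'i set \<Rightarrow> ('i \<Rightarrow> complex) measure" where
  "entries I \<equiv> PiM I (\<lambda>_. M)"

lemma prob_space_entries: "prob_space (entries I)"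
  by (intro prob_space_PiM) unfold_locales

lemma entry_measurable:
  assumes "i \<in> I"
  shows "(\<lambda>x. T + \<kappa> * x i) \<in> borel_measurable (entries I)"
proof -
  have "(\<lambda>x. x i) \<in> measurable (entries I) M" by (rule measurable_component_singleton[OF assms])
  then have "(\<lambda>x. x i) \<in> borel_measurable (entries I)" by (simp add: measurable_cong_sets[OF refl sets_law])
  then show ?thesis by measurable
qed

lemma prob_all_in_balls:
  assumes "finite I" and ball: "\<And>a. prob (ball a t) \<le> q"
  shows "measure (entries I) (PiE I (\<lambda>i. ball (\<beta> i) t)) \<le> q ^ card I"
proof -
  interpret P: finite_product_prob_space "\<lambda>_. M" I
    using assms by unfold_locales
  have "measure (entries I) (PiE I (\<lambda>i. ball (\<beta> i) t)) = (\<Prod>i\<in>I. prob (ball (\<beta> i) t))"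
    by (rule P.prob_times) (simp add: sets_law)
  also have "\<dots> \<le> (\<Prod>i\<in>I. q)" by (intro prod_mono) (auto intro: ball)
  finally show ?thesis by simp
qed

text \<open>Given the other rows, fix the best minor, with columns \<open>c\<close>. For a column \<open>j\<close> outside the image of \<open>c\<close>,
the minor with columns \<open>c(k := j)\<close> is affine in the entry at \<open>(k, j)\<close>, its slope is the best minor, and it
depends on the new row otherwise through the columns \<open>c\<close> only. Given also the entries in these columns, a
failure means that each of at least \<open>n - k\<close> independent entries falls into a prescribed disc.

The indexing map \<open>\<iota>\<close> lets the same statement be applied to rows and to columns of the random matrix.\<close>
lemma greedy_step:
  fixes T :: "nat \<Rightarrow> nat \<Rightarrow> complex" and \<kappa> t q :: real and \<iota> :: "nat \<Rightarrow> nat \<Rightarrow> 'i"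
  defines "H \<equiv> \<lambda>x a j. T a j + complex_of_real \<kappa> * x (\<iota> a j)"
  assumes ball: "\<And>a. prob (ball a t) \<le> q" and q: "0 \<le> q" "q \<le> 1" and \<kappa>: "0 < \<kappa>" and t: "0 < t"
    and \<iota>: "\<And>a j a' j'. a \<le> k \<Longrightarrow> a' \<le> k \<Longrightarrow> j < n \<Longrightarrow> j' < n \<Longrightarrow> \<iota> a j = \<iota> a' j' \<Longrightarrow> a = a' \<and> j = j'"
    and I: "finite I" "\<And>a j. a \<le> k \<Longrightarrow> j < n \<Longrightarrow> \<iota> a j \<in> I"
    and n: "0 < n"
  shows "measure (entries I)
     {x \<in> space (entries I). maxminor (Suc k) n (H x) < t * \<kappa> * maxminor k n (H x)} \<le> q ^ (n - k)"
proof -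
  let ?E = "{x \<in> space (entries I). maxminor (Suc k) n (H x) < t * \<kappa> * maxminor k n (H x)}"
  define I1 where "I1 = \<iota> k ` {..<n}"
  have I1: "I1 \<subseteq> I" "finite I1" using I by (auto simp: I1_def)
  have Hm: "(\<lambda>x. H x a j) \<in> borel_measurable (entries I)" if "a \<le> k" "j < n" for a j
    unfolding H_def using I that by (intro entry_measurable) auto
  have [measurable]: "(\<lambda>x. maxminor (Suc k) n (H x)) \<in> borel_measurable (entries I)"
    "(\<lambda>x. maxminor k n (H x)) \<in> borel_measurable (entries I)"
    using n Hm by (auto intro!: maxminor_measurable)
  have E: "?E \<in> sets (entries I)" by measurable
  show ?thesis
  proof (rule prob_section_bound)
    show "I = (I - I1) \<union> I1" using I1 by auto
    show "?E \<in> sets (entries I)" by (rule E)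
    fix y assume y: "y \<in> space (entries (I - I1))"
    let ?mg = "\<lambda>x. merge (I - I1) I1 (y, x)"
    let ?S = "{x \<in> space (entries I1). ?mg x \<in> ?E}"
    have "(\<lambda>x. merge (I - I1) I1 (y, x)) \<in> measurable (entries I1) (entries ((I - I1) \<union> I1))"
      using y by (intro measurable_compose[OF measurable_Pair1' measurable_merge])
    then have mgm: "?mg \<in> measurable (entries I1) (entries I)" using I1 by (simp add: Un_absorb2)
    have S: "?S \<in> sets (entries I1)" using measurable_sets[OF mgm E] by (simp add: vimage_def Int_def conj_commute)
    define G where "G = H y"
    have HG: "H (?mg x) a j = G a j" if "a < k" "j < n" for x a j
    proof -
      have "\<iota> a j \<in> I - I1" using that I(2)[of a j] \<iota>[of a k j] by (auto simp: I1_def)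
      then show ?thesis by (simp add: H_def G_def merge_def)
    qed
    have maxG: "maxminor k n (H (?mg x)) = maxminor k n G" for x by (rule maxminor_cong) (rule HG)
    obtain c where c: "\<And>b. b < k \<Longrightarrow> c b < n" "maxminor k n G = cmod (minor k (\<lambda>a b. G a (c b)))"
      using maxminor_attained n by blast
    show "measure (entries I1) ?S \<le> q ^ (n - k)"
    proof (cases "maxminor k n G = 0")
      case True
      have empty: "?S = {}" using maxminor_nonneg[of n "Suc k"] n by (auto simp: maxG True not_less)
      show ?thesis unfolding empty using q by (simp only: measure_empty zero_le_power)
    next
      case False
      define m where "m = minor k (\<lambda>a b. G a (c b))"
      have m: "m \<noteq> 0" "maxminor k n G = cmod m" using False c by (auto simp: m_def)
      define J where "J = {..<n} - c ` {..<k}"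
      have J: "J \<subseteq> {..<n}" "finite J" "n - k \<le> card J"
      proof -
        have "n - k \<le> card {..<n} - card (c ` {..<k})" using card_image_le[of "{..<k}" c] by simp
        also have "\<dots> \<le> card J" unfolding J_def by (rule diff_card_le_card_Diff) simp
        finally show "n - k \<le> card J" .
      qed (auto simp: J_def)
      define I0 where "I0 = \<iota> k ` J"
      have inj: "inj_on (\<iota> k) {..<n}" using \<iota> by (auto simp: inj_on_def)
      have I0: "I0 \<subseteq> I1" "finite I0" "card I0 = card J"
        using J inj by (auto simp: I0_def I1_def intro: card_image inj_on_subset)
      define jj where "jj = inv_into {..<n} (\<iota> k)"
      have jj: "jj (\<iota> k j) = j" if "j < n" for j using inj that by (simp add: jj_def)
      have "measure (entries I1) ?S \<le> q ^ card I0"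
      proof (rule prob_section_bound)
        show "I1 = (I1 - I0) \<union> I0" using I0 by auto
        fix z assume z: "z \<in> space (entries (I1 - I0))"
        interpret P0: prob_space "entries I0" by (rule prob_space_entries)
        define R where "R = (\<lambda>j. \<Sum>b<k. H z k (c b) * cof k (\<lambda>a b. G a ((c(k := j)) b)) b)"
        \<comment> \<open>The zero of the affine function that expresses the new minor by the entry at \<open>i\<close>.\<close>
        define \<beta> where "\<beta> = (\<lambda>i. - (T k (jj i) / \<kappa>) - R (jj i) / (m * \<kappa>))"
        have "{x \<in> space (entries I0). merge (I1 - I0) I0 (z, x) \<in> ?S} \<subseteq> PiE I0 (\<lambda>i. ball (\<beta> i) t)"
        proof
          fix x assume "x \<in> {x \<in> space (entries I0). merge (I1 - I0) I0 (z, x) \<in> ?S}"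
          then have x: "x \<in> space (entries I0)"
            and lt: "maxminor (Suc k) n (H (?mg (merge (I1 - I0) I0 (z, x)))) < t * \<kappa> * cmod m"
            by (auto simp: maxG m)
          let ?X = "?mg (merge (I1 - I0) I0 (z, x))"
          have "x i \<in> ball (\<beta> i) t" if i: "i \<in> I0" for i
          proof -
            obtain j where j: "j \<in> J" "i = \<iota> k j" using i by (auto simp: I0_def)
            then have jn: "j < n" "j \<notin> c ` {..<k}" by (auto simp: J_def)
            define c' where "c' = c(k := j)"
            have "minor (Suc k) (\<lambda>a b. H ?X a (c' b)) =
                (\<Sum>b\<le>k. H ?X k (c' b) * cof k (\<lambda>a b. H ?X a (c' b)) b)"
              by (rule minor_last_row)
            also have "\<dots> = (\<Sum>b\<le>k. H ?X k (c' b) * cof k (\<lambda>a b. G a (c' b)) b)"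
              using c jn HG by (intro sum.cong refl arg_cong2[of _ _ _ _ "(*)"] cof_cong) (auto simp: c'_def)
            also have "\<dots> = (\<Sum>b<k. H ?X k (c' b) * cof k (\<lambda>a b. G a (c' b)) b)
                + H ?X k j * cof k (\<lambda>a b. G a (c' b)) k"
              by (simp add: lessThan_Suc_atMost[symmetric] c'_def)
            also have "cof k (\<lambda>a b. G a (c' b)) k = m"
              unfolding cof_last m_def by (intro minor_cong) (auto simp: c'_def)
            also have "(\<Sum>b<k. H ?X k (c' b) * cof k (\<lambda>a b. G a (c' b)) b) = R j"
              unfolding R_def c'_def[symmetric]
            proof (intro sum.cong refl arg_cong2[of _ _ _ _ "(*)"])
              fix b assume b: "b \<in> {..<k}"
              have "\<iota> k (c b) \<in> I1" using b c by (auto simp: I1_def)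
              moreover have "\<iota> k (c b) \<notin> I0"
                using b c \<iota>[of k k "c b"] by (auto simp: I0_def J_def)
              ultimately show "H ?X k (c' b) = H z k (c b)" using b by (simp add: H_def merge_def c'_def)
            qed
            also have "H ?X k j = T k j + \<kappa> * x i"
              using i I0 j by (auto simp: H_def merge_def)
            finally have "minor (Suc k) (\<lambda>a b. H ?X a (c' b)) = R j + (T k j + \<kappa> * x i) * m" .
            also have "\<dots> = m * \<kappa> * (x i - \<beta> i)"
              using m \<kappa> j jj[OF jn(1)] by (simp add: \<beta>_def field_simps)
            finally have "cmod m * \<kappa> * cmod (x i - \<beta> i) = cmod (minor (Suc k) (\<lambda>a b. H ?X a (c' b)))"
              using \<kappa> by (simp add: norm_mult)
            also have "\<dots> \<le> maxminor (Suc k) n (H ?X)"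
              using c jn by (intro maxminor_ge) (auto simp: c'_def)
            also have "\<dots> < cmod m * \<kappa> * t" using lt by (simp add: mult_ac)
            finally have "cmod (x i - \<beta> i) < t" using m \<kappa> by simp
            then show ?thesis by (simp add: dist_norm norm_minus_commute)
          qed
          then show "x \<in> PiE I0 (\<lambda>i. ball (\<beta> i) t)" using x by (auto simp: space_PiM PiE_iff)
        qed
        then have "P0.prob {x \<in> space (entries I0). merge (I1 - I0) I0 (z, x) \<in> ?S}
            \<le> P0.prob (PiE I0 (\<lambda>i. ball (\<beta> i) t))"
          using I0 by (intro P0.finite_measure_mono sets_PiM_I_finite) (auto simp: sets_law)
        also have "\<dots> \<le> q ^ card I0" by (rule prob_all_in_balls[OF I0(2) ball])
        finally show "P0.prob {x \<in> space (entries I0). merge (I1 - I0) I0 (z, x) \<in> ?S} \<le> q ^ card I0" .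
      qed (use I0 I1 S q in auto)
      also have "\<dots> \<le> q ^ (n - k)" using I0 J q by (intro power_decreasing) auto
      finally show ?thesis .
    qed
  qed (use I I1 q in auto)
qed

text \<open>Given the other rows, the minor that extends the best one is a linear form in the new row, whose
coefficients are the cofactors; \<open>cofactors_spread\<close> provides \<open>K\<close> large ones.\<close>
lemma spread_step:
  fixes \<kappa> \<tau> s \<epsilon> \<delta> :: real and T :: "nat \<Rightarrow> nat \<Rightarrow> complex"
  defines "H \<equiv> \<lambda>x a j. T a j + complex_of_real \<kappa> * x (a, j)"
  assumes spr: "spreads M \<tau> \<epsilon> K" and \<epsilon>: "0 \<le> \<epsilon>" and \<kappa>: "0 < \<kappa>" and k: "k < n"
    and K: "0 < K" "K \<le> Suc k" and s: "0 < s" "s \<le> 1" "fact K * 2 ^ Suc K * real (Suc k) * s < \<delta>"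
    and E: "E \<in> sets (entries ({..<n} \<times> {..<n}))"
    and good: "\<And>x. x \<in> E \<Longrightarrow> (\<forall>a<k. \<forall>j<n. cmod (H x a j) \<le> 2) \<and>
       (\<forall>w. inj_on w {..<K} \<longrightarrow> (\<forall>i<K. w i < n) \<longrightarrow>
       (\<exists>\<rho>. (\<forall>i<K. \<rho> i < k) \<and> \<delta> \<le> cmod (minor K (\<lambda>a b. H x (\<rho> a) (w b)))))"
    and small: "\<And>x. x \<in> E \<Longrightarrow> maxminor (Suc k) n (H x) < s * \<kappa> * \<tau> * maxminor k n (H x)"
  shows "measure (entries ({..<n} \<times> {..<n})) E \<le> \<epsilon>"
proof (rule prob_section_bound)
  let ?I = "{..<n} \<times> {..<n}" and ?I1 = "{k} \<times> {..<n}"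
  show "?I = (?I - ?I1) \<union> ?I1" using k by auto
  fix y assume y: "y \<in> space (entries (?I - ?I1))"
  let ?mg = "\<lambda>x. merge (?I - ?I1) ?I1 (y, x)"
  let ?S = "{x \<in> space (entries ?I1). ?mg x \<in> E}"
  interpret P1: prob_space "entries ?I1" by (rule prob_space_entries)
  show "measure (entries ?I1) ?S \<le> \<epsilon>"
  proof (cases "?S = {}")
    case True
    then show ?thesis using \<epsilon> by (simp only: measure_empty)
  next
    case False
    then obtain x0 where x0: "?mg x0 \<in> E" by blast
    have n: "0 < n" using k by simp
    define G where "G = H y"
    have HG: "H (?mg x) a j = G a j" if "a < k" "j < n" for x a j
      using that k by (simp add: H_def G_def merge_def)
    have maxG: "maxminor k n (H (?mg x)) = maxminor k n G" for x by (rule maxminor_cong) (rule HG)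
    have Gbd: "cmod (G a j) \<le> 2" if "a < k" "j < n" for a j
      using good[OF x0] HG that by metis
    have Gcols: "\<exists>\<rho>. (\<forall>i<K. \<rho> i < k) \<and> \<delta> \<le> cmod (minor K (\<lambda>a b. G (\<rho> a) (w b)))"
      if w: "inj_on w {..<K}" "\<And>i. i < K \<Longrightarrow> w i < n" for w
    proof -
      obtain \<rho> where \<rho>: "\<forall>i<K. \<rho> i < k" "\<delta> \<le> cmod (minor K (\<lambda>a b. H (?mg x0) (\<rho> a) (w b)))"
        using good[OF x0] w by blast
      moreover have "minor K (\<lambda>a b. H (?mg x0) (\<rho> a) (w b)) = minor K (\<lambda>a b. G (\<rho> a) (w b))"
        using \<rho> w HG by (intro minor_cong) auto
      ultimately show ?thesis by metis
    qed
    obtain c where c: "\<And>b. b < k \<Longrightarrow> c b < n" "maxminor k n G = cmod (minor k (\<lambda>a b. G a (c b)))"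
      using maxminor_attained n by blast
    have pos: "0 < maxminor k n G"
    proof -
      have "maxminor k n G \<noteq> 0"
      proof
        assume "maxminor k n G = 0"
        then show False using small[OF x0] maxminor_nonneg[of n "Suc k" "H (?mg x0)"] n maxG[of x0] by simp
      qed
      then show ?thesis using maxminor_nonneg[of n k G] n by simp
    qed
    have "card (c ` {..<k}) < card {..<n}" using card_image_le[of "{..<k}" c] k by simp
    then obtain j where j: "j < n" "j \<notin> c ` {..<k}"
      by (metis card_mono finite_imageI finite_lessThan lessThan_iff not_less subsetI)
    define c' where "c' = c(k := j)"
    have c'n: "c' b < n" if "b \<le> k" for b using that c j by (auto simp: c'_def)
    have "inj_on c {..<k}" using pos c by (intro minor_nonzero_inj[of k G]) auto
    then have inj: "inj_on c' {..k}"
      using j unfolding c'_def lessThan_Suc_atMost[symmetric] lessThan_Suc by (auto simp: inj_on_def)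
    define V where "V = cof k (\<lambda>a b. G a (c' b))"
    let ?M = "maxminor k n G"
    have spread: "K \<le> card {b. b \<le> k \<and> s * ?M \<le> cmod (V b)}"
      unfolding V_def by (rule cofactors_spread[OF Gbd c pos c'_def j Gcols K s])
    define v where "v = (\<lambda>i :: nat \<times> nat. if snd i \<in> c' ` {..k} then \<kappa> * V (inv_into {..k} c' (snd i)) else 0)"
    define w where "w = (\<Sum>b\<le>k. T k (c' b) * V b)"
    define \<sigma> where "\<sigma> = \<kappa> * s * ?M"
    have \<sigma>: "\<sigma> > 0" using \<kappa> s pos by (simp add: \<sigma>_def)
    have vb: "v (k, c' b) = \<kappa> * V b" if "b \<le> k" for b using inj that by (simp add: v_def)
    have "card {b. b \<le> k \<and> s * ?M \<le> cmod (V b)} \<le> card {i \<in> ?I1. \<sigma> \<le> cmod (v i)}"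
    proof (rule card_inj_on_le[where f = "\<lambda>b. (k, c' b)"])
      show "inj_on (\<lambda>b. (k, c' b)) {b. b \<le> k \<and> s * ?M \<le> cmod (V b)}"
        using inj by (auto simp: inj_on_def)
      show "(\<lambda>b. (k, c' b)) ` {b. b \<le> k \<and> s * ?M \<le> cmod (V b)} \<subseteq> {i \<in> ?I1. \<sigma> \<le> cmod (v i)}"
        using c'n vb \<kappa> by (auto simp: \<sigma>_def norm_mult)
    qed simp
    with spread have big: "K \<le> card {i \<in> ?I1. \<sigma> \<le> cmod (v i)}" by simp
    let ?B = "{x \<in> space (entries ?I1). cmod ((\<Sum>i\<in>?I1. v i * x i) + w) < \<sigma> * \<tau>}"
    have Bm: "?B \<in> sets (entries ?I1)"
    proof -
      have "(\<lambda>x. v i * x i) \<in> borel_measurable (entries ?I1)" if "i \<in> ?I1" for i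
        using entry_measurable[OF that, of 0 "v i"] by simp
      then have [measurable]: "(\<lambda>x. \<Sum>i\<in>?I1. v i * x i) \<in> borel_measurable (entries ?I1)"
        by (intro borel_measurable_sum)
      show ?thesis by measurable
    qed
    have "?S \<subseteq> ?B"
    proof
      fix x assume "x \<in> ?S"
      then have x: "x \<in> space (entries ?I1)" "?mg x \<in> E" by auto
      have "minor (Suc k) (\<lambda>a b. H (?mg x) a (c' b)) =
          (\<Sum>b\<le>k. H (?mg x) k (c' b) * cof k (\<lambda>a b. H (?mg x) a (c' b)) b)"
        by (rule minor_last_row)
      also have "\<dots> = (\<Sum>b\<le>k. (T k (c' b) + \<kappa> * x (k, c' b)) * V b)"
      proof (intro sum.cong refl arg_cong2[of _ _ _ _ "(*)"])
        fix b assume b: "b \<in> {..k}"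
        show "H (?mg x) k (c' b) = T k (c' b) + \<kappa> * x (k, c' b)"
          using b c'n by (simp add: H_def merge_def)
        show "cof k (\<lambda>a b. H (?mg x) a (c' b)) b = V b"
          unfolding V_def using c'n HG by (intro cof_cong) auto
      qed
      also have "\<dots> = w + (\<Sum>b\<le>k. v (k, c' b) * x (k, c' b))"
        unfolding w_def sum.distrib[symmetric] by (intro sum.cong refl) (simp add: vb algebra_simps)
      also have "(\<Sum>b\<le>k. v (k, c' b) * x (k, c' b)) = (\<Sum>j\<in>c' ` {..k}. v (k, j) * x (k, j))"
        using inj by (simp add: sum.reindex)
      also have "\<dots> = (\<Sum>j<n. v (k, j) * x (k, j))"
        using c'n by (intro sum.mono_neutral_left) (auto simp: v_def)
      also have "\<dots> = (\<Sum>i\<in>?I1. v i * x i)"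
        by (simp add: sum.cartesian_product')
      finally have "cmod ((\<Sum>i\<in>?I1. v i * x i) + w) = cmod (minor (Suc k) (\<lambda>a b. H (?mg x) a (c' b)))"
        by (simp add: add.commute)
      also have "\<dots> \<le> maxminor (Suc k) n (H (?mg x))" using c'n by (intro maxminor_ge) auto
      also have "\<dots> < \<sigma> * \<tau>" using small[OF x(2)] by (simp add: maxG \<sigma>_def mult_ac)
      finally show "x \<in> ?B" using x by simp
    qed
    then have "P1.prob ?S \<le> P1.prob ?B" using Bm by (rule P1.finite_measure_mono)
    also have "\<dots> \<le> \<epsilon>"
      using spr[unfolded spreads_def, rule_format, OF _ \<sigma> big] by simp
    finally show ?thesis .
  qed
qed (use E \<epsilon> in auto)

end

section \<open>The lower tail of the determinant\<close>

text \<open>The failure of the greedy argument for the columns \<open>w\<close> in the first \<open>L\<close> rows: in one of the \<open>K\<close> steps the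
largest minor drops by more than the factor \<open>\<eta>\<close>. Rows and columns have exchanged their roles here.\<close>
definition dep_cols :: "(nat \<Rightarrow> nat \<Rightarrow> complex) \<Rightarrow> real \<Rightarrow> nat \<Rightarrow> nat \<Rightarrow> (nat \<Rightarrow> nat) \<Rightarrow> bool" where
  "dep_cols G \<eta> L K w \<longleftrightarrow> (\<exists>i<K. maxminor (Suc i) L (\<lambda>i a. G a (w i)) < \<eta> * maxminor i L (\<lambda>i a. G a (w i)))"

text \<open>Without a failure the largest minor of these columns is at least \<open>\<eta> ^ K\<close>; the transposition restores the
roles of rows and columns.\<close>
lemma not_dep_cols_minor:
  assumes "\<not> dep_cols G \<eta> L K w" "0 \<le> \<eta>" "0 < L"
  shows "\<exists>\<rho>. (\<forall>i<K. \<rho> i < L) \<and> \<eta> ^ K \<le> cmod (minor K (\<lambda>a b. G (\<rho> a) (w b)))"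
proof -
  let ?G = "\<lambda>i a. G a (w i)"
  have "\<eta> ^ i \<le> maxminor i L ?G" if "i \<le> K" for i
    using that
  proof (induction i)
    case (Suc i)
    then have "\<eta> * \<eta> ^ i \<le> \<eta> * maxminor i L ?G" using assms by (intro mult_left_mono) auto
    also have "\<dots> \<le> maxminor (Suc i) L ?G" 
      using assms(1) Suc_le_lessD[OF Suc.prems] unfolding dep_cols_def by (meson not_less)
    finally show ?case by simp
  qed (simp add: maxminor_0)
  moreover obtain \<rho> where "\<And>b. b < K \<Longrightarrow> \<rho> b < L" "maxminor K L ?G = cmod (minor K (\<lambda>a b. ?G a (\<rho> b)))"
    using maxminor_attained assms by blast
  moreover have "minor K (\<lambda>a b. ?G a (\<rho> b)) = minor K (\<lambda>a b. G (\<rho> a) (w b))"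
    by (rule minor_transpose)
  ultimately show ?thesis by (metis order_refl)
qed

lemma geometric_tail:
  fixes q :: real
  assumes "0 \<le> q" "q < 1" and A: "finite A" "inj_on f A" "\<And>k. k \<in> A \<Longrightarrow> d \<le> f k"
  shows "(\<Sum>k\<in>A. q ^ f k) \<le> q ^ d / (1 - q)"
proof -
  have "(\<Sum>k\<in>A. q ^ f k) = (\<Sum>k\<in>f ` A. q ^ k)" using A by (simp add: sum.reindex)
  also have "\<dots> = (\<Sum>k\<in>(\<lambda>k. k - d) ` f ` A. q ^ (d + k))"
  proof (rule sum.reindex_cong[symmetric, where l = "\<lambda>k. k - d"])
    show "inj_on (\<lambda>k. k - d) (f ` A)" using A by (auto simp: inj_on_def) (metis le_add_diff_inverse)
    show "(\<lambda>k. k - d) ` f ` A = (\<lambda>k. k - d) ` f ` A" ..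
    fix x assume "x \<in> f ` A"
    then show "q ^ (d + (x - d)) = q ^ x" using A by auto
  qed
  also have "\<dots> = q ^ d * (\<Sum>k\<in>(\<lambda>k. k - d) ` f ` A. q ^ k)" by (simp add: power_add sum_distrib_left)
  also have "\<dots> \<le> q ^ d * (\<Sum>k. q ^ k)"
    using assms A by (intro mult_left_mono sum_le_suminf summable_geometric) auto
  also have "\<dots> = q ^ d / (1 - q)" using assms by (simp add: suminf_geometric)
  finally show ?thesis .
qed

context plane_law
begin

text \<open>The exceptional event is covered by three kinds of events: a failure of a greedy step for a row
\<open>n - m \<le> k < n - d\<close>; near dependence of some \<open>K\<close> columns in the first \<open>n - d\<close> rows; a failure of a
Littlewood-Offord step for one of the last \<open>d\<close> rows in the absence of such a dependence. They account for
the three terms of the bound. Outside these events the maximal minor, which starts with the perturbed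
identity block, loses at most a factor \<open>\<tau> * \<kappa>\<close> per step and another factor \<open>s\<close> in each of the last \<open>d\<close>
steps.\<close>
lemma determinant_lower_tail:
  fixes \<kappa> \<tau> c \<epsilon> h s :: real and T :: "nat \<Rightarrow> nat \<Rightarrow> complex"
  defines "H \<equiv> \<lambda>x a j. T a j + complex_of_real \<kappa> * x (a, j)"
  assumes ball: "\<And>a. prob (ball a \<tau>) \<le> 1 - c" and c: "0 < c" "c \<le> 1"
    and spr: "spreads M \<tau> \<epsilon> K" and \<epsilon>: "0 \<le> \<epsilon>" and K: "0 < K"
    and \<kappa>: "0 < \<kappa>" "\<kappa> \<le> 1" and \<tau>: "0 < \<tau>" "\<tau> \<le> 1" and h: "0 \<le> h" "h \<le> 1"
    and n: "d + K < n" "m \<le> n"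
    and T1: "\<And>a j. a < n \<Longrightarrow> j < n \<Longrightarrow> cmod (T a j) \<le> 1"
    and Tid: "\<And>a j. a < n - m \<Longrightarrow> j < n - m \<Longrightarrow> T a j = (if a = j then 1 else 0)"
    and s_def: "s = (\<tau> * \<kappa>) ^ K / (fact K * 2 ^ (K + 2) * real n)"
  shows "measure (entries ({..<n} \<times> {..<n}))
     {x \<in> space (entries ({..<n} \<times> {..<n})). (\<Sum>i\<in>{..<n} \<times> {..<n}. (\<kappa> * cmod (x i))\<^sup>2) \<le> h\<^sup>2 \<and>
        cmod (minor n (H x)) < (1 - h) ^ n * (\<tau> * \<kappa>) ^ m * s ^ d}
    \<le> (1 - c) ^ d / c + real n ^ K * (real K * (1 - c) ^ (n - d - K)) + real d * \<epsilon>"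
proof -
  let ?I = "{..<n} \<times> {..<n}"
  let ?P = "entries ?I"
  interpret P: prob_space ?P by (rule prob_space_entries)
  define q where "q = 1 - c"
  have q: "0 \<le> q" "q < 1" "q \<le> 1" using c by (auto simp: q_def)
  define \<eta> where "\<eta> = \<tau> * \<kappa>"
  have \<eta>: "0 < \<eta>" "\<eta> \<le> 1" using \<tau> \<kappa> by (auto simp: \<eta>_def mult_le_one)
  have n0: "0 < n" "0 < n - d" using n by auto
  have s_eq: "s = \<eta> ^ K / (fact K * 2 ^ (K + 2) * real n)" unfolding s_def \<eta>_def ..
  have s: "0 < s" "s \<le> 1"
  proof -
    show "0 < s" using \<eta> n0 by (simp add: s_eq)
    have "\<eta> ^ K \<le> 1" using \<eta> by (intro power_le_one) auto
    also have "1 \<le> fact K * 2 ^ (K + 2) * real n"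
    proof -
      have "1 * 1 * 1 \<le> fact K * 2 ^ (K + 2) * real n"
        using n0 by (intro mult_mono fact_ge_1 one_le_power) auto
      then show ?thesis by simp
    qed
    finally show "s \<le> 1" using n0 by (simp add: s_eq divide_le_eq)
  qed
  have s\<delta>: "fact K * 2 ^ Suc K * real (Suc k) * s < \<eta> ^ K" if "k < n" for k
  proof -
    have "fact K * 2 ^ Suc K * real (Suc k) * s \<le> fact K * 2 ^ Suc K * real n * s"
      using that s by (intro mult_right_mono mult_left_mono) auto
    also have "\<dots> = \<eta> ^ K / 2" using n0 by (simp add: s_eq field_simps)
    also have "\<dots> < \<eta> ^ K" using \<eta> by simp
    finally show ?thesis .
  qed
  define D where "D = (\<lambda>k x. maxminor k n (H x))"
  have Hm: "(\<lambda>x. H x a j) \<in> borel_measurable ?P" if "a < n" "j < n" for a j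
    unfolding H_def using that by (intro entry_measurable) auto
  have Dm: "(\<lambda>x. D k x) \<in> borel_measurable ?P" if "k \<le> n" for k
    unfolding D_def using n0 Hm that by (intro maxminor_measurable) auto
  have colm: "(\<lambda>x. maxminor i (n - d) (\<lambda>i a. H x a (w i))) \<in> borel_measurable ?P"
    if "i \<le> K" "w \<in> {..<K} \<rightarrow>\<^sub>E {..<n}" for i w
    using n0 Hm that by (intro maxminor_measurable) (auto simp: PiE_iff)
  define small where "small = {x \<in> space ?P. (\<Sum>i\<in>?I. (\<kappa> * cmod (x i))\<^sup>2) \<le> h\<^sup>2}"
  have small: "small \<in> sets ?P"
  proof -
    have "(\<lambda>x. (\<kappa> * cmod (x i))\<^sup>2) \<in> borel_measurable ?P" if "i \<in> ?I" for i
    proof -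
      have [measurable]: "(\<lambda>x. x i) \<in> borel_measurable ?P" using entry_measurable[OF that, of 0 1] by simp
      show ?thesis by measurable
    qed
    then have [measurable]: "(\<lambda>x. \<Sum>i\<in>?I. (\<kappa> * cmod (x i))\<^sup>2) \<in> borel_measurable ?P"
      by (intro borel_measurable_sum)
    show ?thesis unfolding small_def by measurable
  qed
  define W where "W = {w \<in> {..<K} \<rightarrow>\<^sub>E {..<n}. inj_on w {..<K}}"
  have finW: "finite W" unfolding W_def
    by (rule finite_subset[of _ "{..<K} \<rightarrow>\<^sub>E {..<n}"]) (blast, simp add: finite_PiE)
  have cardW: "card W \<le> n ^ K"
  proof -
    have "card W \<le> card ({..<K} \<rightarrow>\<^sub>E {..<n})" unfolding W_def by (intro card_mono finite_PiE) auto
    then show ?thesis by (simp add: card_PiE)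
  qed
  define Grd where "Grd = (\<lambda>k. {x \<in> space ?P. D (Suc k) x < \<eta> * D k x})"
  define ColI where "ColI = (\<lambda>w i. {x \<in> space ?P. maxminor (Suc i) (n - d) (\<lambda>i a. H x a (w i))
      < \<eta> * maxminor i (n - d) (\<lambda>i a. H x a (w i))})"
  define Col where "Col = (\<Union>w\<in>W. \<Union>i<K. ColI w i)"
  define Spr where "Spr = (\<lambda>k. {x \<in> space ?P. D (Suc k) x < s * \<kappa> * \<tau> * D k x} \<inter> small - Col)"
  have Grdm: "Grd k \<in> sets ?P" if "k < n" for k
  proof -
    have [measurable]: "(\<lambda>x. D k x) \<in> borel_measurable ?P" "(\<lambda>x. D (Suc k) x) \<in> borel_measurable ?P"
      by (rule Dm, use that in simp)+
    show ?thesis unfolding Grd_def by measurable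
  qed
  have ColIm: "ColI w i \<in> sets ?P" if "w \<in> W" "i < K" for w i
  proof -
    have [measurable]: "(\<lambda>x. maxminor (Suc i) (n - d) (\<lambda>i a. H x a (w i))) \<in> borel_measurable ?P"
      "(\<lambda>x. maxminor i (n - d) (\<lambda>i a. H x a (w i))) \<in> borel_measurable ?P"
      by (rule colm, use that in \<open>simp add: W_def\<close>, use that in \<open>simp add: W_def\<close>)+
    show ?thesis unfolding ColI_def by measurable
  qed
  have Colm: "Col \<in> sets ?P" unfolding Col_def using finW ColIm by auto
  have Sprm: "Spr k \<in> sets ?P" if "k < n" for k
  proof -
    have [measurable]: "(\<lambda>x. D k x) \<in> borel_measurable ?P" "(\<lambda>x. D (Suc k) x) \<in> borel_measurable ?P"
      by (rule Dm, use that in simp)+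
    show ?thesis unfolding Spr_def by (intro sets.Diff sets.Int small Colm) measurable
  qed
  have pGrd: "P.prob (Grd k) \<le> q ^ (n - k)" if "k < n" for k
    unfolding Grd_def D_def H_def \<eta>_def
    by (rule greedy_step[where \<iota> = Pair]) (use ball q \<kappa> \<tau> that n0 in \<open>auto simp: q_def\<close>)
  have pCol: "P.prob (ColI w i) \<le> q ^ (n - d - K)" if w: "w \<in> W" and i: "i < K" for w i
  proof -
    have wn: "w i < n" if "i < K" for i using w that by (auto simp: W_def PiE_iff)
    have winj: "inj_on w {..<K}" using w by (simp add: W_def)
    have "P.prob (ColI w i) \<le> q ^ (n - d - i)"
      unfolding ColI_def H_def \<eta>_def
    proof (rule greedy_step[where \<iota> = "\<lambda>i a. (a, w i)" and T = "\<lambda>i a. T a (w i)"])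
      fix a j a' j'
      assume "a \<le> i" "a' \<le> i" "j < n - d" "j' < n - d" "(j, w a) = (j', w a')"
      then show "a = a' \<and> j = j'" using winj i by (auto simp: inj_on_def)
    qed (use ball q \<kappa> \<tau> n0 i wn in \<open>auto simp: q_def\<close>)
    also have "\<dots> \<le> q ^ (n - d - K)" using q i by (intro power_decreasing) auto
    finally show ?thesis .
  qed
  have entry2: "cmod (H x a j) \<le> 2" if "x \<in> small" "a < n" "j < n" for x a j
  proof -
    have "(\<kappa> * cmod (x (a, j)))\<^sup>2 \<le> (\<Sum>i\<in>?I. (\<kappa> * cmod (x i))\<^sup>2)"
      using that by (intro member_le_sum) auto
    also have "\<dots> \<le> 1\<^sup>2" using that h by (auto simp: small_def power_mono intro: order_trans power_le_one)
    finally have "\<kappa> * cmod (x (a, j)) \<le> 1" by (rule power2_le_imp_le) simp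
    then show ?thesis
      using T1[OF that(2,3)] norm_triangle_ineq[of "T a j" "\<kappa> * x (a, j)"] \<kappa>
      unfolding H_def by (simp add: norm_mult)
  qed
  have nodep: "\<not> dep_cols (H x) \<eta> (n - d) K w" if "x \<in> space ?P" "x \<notin> Col" "inj_on w {..<K}" "\<forall>i<K. w i < n" for x w
  proof -
    define w' where "w' = restrict w {..<K}"
    have "w' \<in> W" using that by (auto simp: W_def w'_def inj_on_def)
    then have "\<not> dep_cols (H x) \<eta> (n - d) K w'"
      using that by (force simp: dep_cols_def Col_def ColI_def)
    moreover have "maxminor i (n - d) (\<lambda>i a. H x a (w' i)) = maxminor i (n - d) (\<lambda>i a. H x a (w i))"
      if "i \<le> K" for i using that by (intro maxminor_cong) (auto simp: w'_def)
    ultimately show ?thesis unfolding dep_cols_def by (metis Suc_leI less_imp_le)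
  qed
  have pSpr: "P.prob (Spr k) \<le> \<epsilon>" if k: "n - d \<le> k" "k < n" for k
  proof -
    have Kk: "K \<le> Suc k" using k n by linarith
    have lt: "maxminor (Suc k) n (H x) < s * \<kappa> * \<tau> * maxminor k n (H x)" if x: "x \<in> Spr k" for x
      using x by (auto simp: Spr_def D_def)
    have good: "(\<forall>a<k. \<forall>j<n. cmod (H x a j) \<le> 2) \<and>
       (\<forall>w. inj_on w {..<K} \<longrightarrow> (\<forall>i<K. w i < n) \<longrightarrow>
       (\<exists>\<rho>. (\<forall>i<K. \<rho> i < k) \<and> \<eta> ^ K \<le> cmod (minor K (\<lambda>a b. H x (\<rho> a) (w b)))))"
      if x: "x \<in> Spr k" for x
    proof -
      have xs: "x \<in> space ?P" "x \<in> small" "x \<notin> Col" using x by (auto simp: Spr_def)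
      have "\<exists>\<rho>. (\<forall>i<K. \<rho> i < k) \<and> \<eta> ^ K \<le> cmod (minor K (\<lambda>a b. H x (\<rho> a) (w b)))"
        if "inj_on w {..<K}" "\<forall>i<K. w i < n" for w
        using not_dep_cols_minor[OF nodep[OF xs(1,3) that]] \<eta> n0 k by (meson less_le_trans less_imp_le)
      then show ?thesis using entry2[OF xs(2)] k by auto
    qed
    show ?thesis
      by (rule spread_step[OF spr \<epsilon> \<kappa>(1) k(2) K Kk s s\<delta>[OF k(2)] Sprm[OF k(2)], where T = T,
            OF good[unfolded H_def] lt[unfolded H_def]])
  qed
  let ?E = "{x \<in> space ?P. (\<Sum>i\<in>?I. (\<kappa> * cmod (x i))\<^sup>2) \<le> h\<^sup>2 \<and> cmod (minor n (H x)) < (1 - h) ^ n * \<eta> ^ m * s ^ d}"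
  define A where "A = {n - m..<n} - {n - d..<n}"
  define B where "B = {n - d..<n}"
  have cover: "?E \<subseteq> (\<Union>k\<in>A. Grd k) \<union> Col \<union> (\<Union>k\<in>B. Spr k)"
  proof (rule subsetI, rule ccontr)
    fix x assume "x \<in> ?E" and no: "x \<notin> (\<Union>k\<in>A. Grd k) \<union> Col \<union> (\<Union>k\<in>B. Spr k)"
    then have x: "x \<in> space ?P" "x \<in> small" "cmod (minor n (H x)) < (1 - h) ^ n * \<eta> ^ m * s ^ d"
      by (auto simp: small_def)
    \<comment> \<open>The factor that step \<open>k\<close> may lose.\<close>
    define g where "g = (\<lambda>k. if k < n - d then \<eta> else s * \<kappa> * \<tau>)"
    have g0: "0 \<le> g k" for k using \<eta> s \<kappa> \<tau> by (simp add: g_def)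
    have step: "g k * D k x \<le> D (Suc k) x" if "n - m \<le> k" "k < n" for k
    proof (cases "k < n - d")
      case True
      then have "k \<in> A" using that by (simp add: A_def)
      then have "x \<notin> Grd k" using no by blast
      then show ?thesis using x True by (simp add: Grd_def g_def not_less)
    next
      case False
      then have "k \<in> B" using that by (simp add: B_def)
      then have "x \<notin> Spr k" "x \<notin> Col" using no by auto
      then show ?thesis using x False by (simp add: Spr_def g_def not_less)
    qed
    have chain: "(1 - h) ^ n * (\<Prod>k\<in>{n - m..<l}. g k) \<le> D l x" if "n - m \<le> l" "l \<le> n" for l
      using that
    proof (induction l rule: dec_induct)
      case base
      define E where "E = mat (n - m) (n - m) (\<lambda>(a, b). \<kappa> * x (a, b))"
      have Ec: "E \<in> carrier_mat (n - m) (n - m)" by (simp add: E_def)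
      have "(hs_norm E)\<^sup>2 = (\<Sum>i\<in>{..<n - m} \<times> {..<n - m}. (\<kappa> * cmod (x i))\<^sup>2)"
        using \<kappa> unfolding hs_norm_sq by (simp add: E_def norm_mult sum.cartesian_product')
      also have "\<dots> \<le> (\<Sum>i\<in>?I. (\<kappa> * cmod (x i))\<^sup>2)" by (intro sum_mono2) auto
      also have "\<dots> \<le> h\<^sup>2" using x(2) by (simp add: small_def)
      finally have Eh: "hs_norm E \<le> h" by (rule power2_le_imp_le[OF _ h(1)])
      have "(1 - h) ^ n \<le> (1 - h) ^ (n - m)" using h by (intro power_decreasing) auto
      also have "\<dots> \<le> (1 - hs_norm E) ^ (n - m)" using Eh h by (intro power_mono) auto
      also have "\<dots> \<le> cmod (det (1\<^sub>m (n - m) + E))" using Eh h by (intro det_near_identity Ec) auto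
      also have "1\<^sub>m (n - m) + E = mat (n - m) (n - m) (\<lambda>(a, b). H x a b)"
        using Tid by (intro eq_matI) (auto simp: E_def H_def)
      also have "cmod (det \<dots>) = cmod (minor (n - m) (\<lambda>a b. H x a (id b)))" by (simp add: minor_def)
      also have "\<dots> \<le> D (n - m) x" unfolding D_def by (intro maxminor_ge) auto
      finally show ?case by simp
    next
      case (step l)
      have "(1 - h) ^ n * (\<Prod>k\<in>{n - m..<Suc l}. g k) = g l * ((1 - h) ^ n * (\<Prod>k\<in>{n - m..<l}. g k))"
        using step.hyps by (simp add: prod.atLeastLessThan_Suc mult_ac)
      also have "\<dots> \<le> g l * D l x" using step g0 by (intro mult_left_mono) auto
      also have "\<dots> \<le> D (Suc l) x" using step.hyps step.prems by (intro \<open>\<And>k. n - m \<le> k \<Longrightarrow> k < n \<Longrightarrow> g k * D k x \<le> D (Suc k) x\<close>) auto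
      finally show ?case .
    qed
    have "\<eta> ^ m * s ^ d \<le> (\<Prod>k\<in>{n - m..<n}. g k)"
    proof -
      have "(\<Prod>k\<in>{n - m..<n}. g k) = (\<Prod>k\<in>{n - m..<n}. \<eta>) * (\<Prod>k\<in>{n - m..<n}. if k < n - d then 1 else s)"
        unfolding prod.distrib[symmetric] by (intro prod.cong) (auto simp: g_def \<eta>_def)
      also have "(\<Prod>k\<in>{n - m..<n}. \<eta>) = \<eta> ^ m" using n by simp
      also have "(\<Prod>k\<in>{n - m..<n}. if k < n - d then 1 else s) = s ^ card ({n - m..<n} \<inter> {k. \<not> k < n - d})"
        by (simp add: prod.If_cases Int_def)
      finally have eq: "(\<Prod>k\<in>{n - m..<n}. g k) = \<eta> ^ m * s ^ card ({n - m..<n} \<inter> {k. \<not> k < n - d})" .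
      have "card ({n - m..<n} \<inter> {k. \<not> k < n - d}) \<le> card {n - d..<n}" by (intro card_mono) auto
      then have "s ^ d \<le> s ^ card ({n - m..<n} \<inter> {k. \<not> k < n - d})"
        using s by (intro power_decreasing) auto
      then show ?thesis unfolding eq using \<eta> by (intro mult_left_mono) auto
    qed
    then have "(1 - h) ^ n * (\<eta> ^ m * s ^ d) \<le> (1 - h) ^ n * (\<Prod>k\<in>{n - m..<n}. g k)"
      using h by (intro mult_left_mono) auto
    also have "\<dots> \<le> D n x" by (rule chain) auto
    also have "\<dots> \<le> cmod (minor n (H x))" unfolding D_def by (rule maxminor_full[OF n0(1)])
    finally show False using x(3) by (simp add: mult.assoc)
  qed
  have fin: "finite A" "finite B" by (auto simp: A_def B_def)
  have "P.prob ?E \<le> P.prob ((\<Union>k\<in>A. Grd k) \<union> Col \<union> (\<Union>k\<in>B. Spr k))"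
    using Grdm Sprm Colm fin by (intro P.finite_measure_mono cover) (auto simp: A_def B_def)
  also have "\<dots> \<le> P.prob ((\<Union>k\<in>A. Grd k) \<union> Col) + P.prob (\<Union>k\<in>B. Spr k)"
    using Grdm Sprm Colm fin by (intro measure_Un_le) (auto simp: A_def B_def)
  also have "P.prob ((\<Union>k\<in>A. Grd k) \<union> Col) \<le> P.prob (\<Union>k\<in>A. Grd k) + P.prob Col"
    using Grdm Colm fin by (intro measure_Un_le) (auto simp: A_def)
  also have "P.prob (\<Union>k\<in>A. Grd k) \<le> (\<Sum>k\<in>A. P.prob (Grd k))"
    using Grdm fin by (intro measure_UNION_le) (auto simp: A_def)
  also have "\<dots> \<le> (\<Sum>k\<in>A. q ^ (n - k))" by (intro sum_mono pGrd) (auto simp: A_def)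
  also have "\<dots> \<le> q ^ d / (1 - q)"
    by (rule geometric_tail) (use q fin in \<open>auto simp: A_def inj_on_def\<close>)
  also have "P.prob (\<Union>k\<in>B. Spr k) \<le> (\<Sum>k\<in>B. P.prob (Spr k))"
    using Sprm fin by (intro measure_UNION_le) (auto simp: B_def)
  also have "\<dots> \<le> (\<Sum>k\<in>B. \<epsilon>)" by (intro sum_mono pSpr) (auto simp: B_def)
  also have "\<dots> \<le> real d * \<epsilon>" using n \<epsilon> by (simp add: B_def)
  also have "P.prob Col \<le> real n ^ K * (real K * q ^ (n - d - K))"
  proof -
    have "P.prob Col \<le> (\<Sum>w\<in>W. P.prob (\<Union>i<K. ColI w i))"
      unfolding Col_def using finW ColIm by (intro measure_UNION_le) auto
    also have "\<dots> \<le> (\<Sum>w\<in>W. \<Sum>i<K. P.prob (ColI w i))"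
      using ColIm by (intro sum_mono measure_UNION_le) auto
    also have "\<dots> \<le> (\<Sum>w\<in>W. \<Sum>i<K. q ^ (n - d - K))" by (intro sum_mono pCol) auto
    also have "\<dots> = card W * (K * q ^ (n - d - K))" by simp
    also have "\<dots> \<le> real n ^ K * (real K * q ^ (n - d - K))"
      using cardW q by (intro mult_right_mono) (auto simp flip: of_nat_power)
    finally show ?thesis .
  qed
  finally show ?thesis by (simp add: q_def \<eta>_def add_ac)
qed

end

section \<open>Block shifts and their reordering\<close>

lemma block_shift_index:
  "block_shift_mat b n \<in> carrier_mat n n \<and> (\<forall>i<n. \<forall>j<n. block_shift_mat b n $$ (i, j) =
     (if j = Suc i \<and> Suc i mod Suc b \<noteq> 0 then 1 else 0))"
proof -
  define B where "B = (\<lambda>q k. diag_block_mat (replicate q (shift_mat (Suc b)) @ (if k > 0 then [shift_mat k] else [])))"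
  have "B q k \<in> carrier_mat (q * Suc b + k) (q * Suc b + k) \<and>
      (\<forall>i<q * Suc b + k. \<forall>j<q * Suc b + k. B q k $$ (i, j) = (if j = Suc i \<and> Suc i mod Suc b \<noteq> 0 then 1 else 0))"
    if k: "k < Suc b" for q k
  proof (induction q)
    case 0
    show ?case
    proof (cases "k = 0")
      case False
      then show ?thesis using k by (auto simp: B_def shift_mat_def)
    qed (simp add: B_def)
  next
    case (Suc q)
    let ?n = "q * Suc b + k"
    have dims: "B q k \<in> carrier_mat ?n ?n" using Suc by blast
    have step: "B (Suc q) k = four_block_mat (shift_mat (Suc b)) (0\<^sub>m (Suc b) ?n) (0\<^sub>m ?n (Suc b)) (B q k)"
      using dims unfolding B_def by (simp add: Let_def shift_mat_def)
    have carrier: "B (Suc q) k \<in> carrier_mat (Suc q * Suc b + k) (Suc q * Suc b + k)"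
      unfolding step using dims by (intro carrier_matI) (simp_all add: shift_mat_def)
    have "B (Suc q) k $$ (i, j) = (if j = Suc i \<and> Suc i mod Suc b \<noteq> 0 then 1 else 0)"
      if ij: "i < Suc q * Suc b + k" "j < Suc q * Suc b + k" for i j
    proof -
      consider "i < Suc b" "j < Suc b" | "i < Suc b" "Suc b \<le> j" | "Suc b \<le> i" "j < Suc b"
        | "Suc b \<le> i" "Suc b \<le> j" by linarith
      then show ?thesis
      proof cases
        case 1
        then show ?thesis unfolding step using dims by (auto simp: shift_mat_def)
      next
        case 2
        then have "B (Suc q) k $$ (i, j) = 0" unfolding step using dims ij by (auto simp: shift_mat_def)
        moreover have "Suc i mod Suc b = 0" if "j = Suc i"
        proof -
          have "i = b" using 2 that by linarith
          then show ?thesis by simp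
        qed
        ultimately show ?thesis by simp
      next
        case 3
        then show ?thesis unfolding step using dims ij by (auto simp: shift_mat_def)
      next
        case 4
        then have "B (Suc q) k $$ (i, j) = B q k $$ (i - Suc b, j - Suc b)"
          unfolding step using dims ij by (auto simp: shift_mat_def)
        also have "\<dots> = (if j - Suc b = Suc (i - Suc b) \<and> Suc (i - Suc b) mod Suc b \<noteq> 0 then 1 else 0)"
        proof -
          have "i - Suc b < ?n" "j - Suc b < ?n" using 4 ij by auto
          then show ?thesis using Suc by blast
        qed
        also have "Suc (i - Suc b) mod Suc b = Suc i mod Suc b"
          using 4 by (metis Suc_diff_le le_SucI le_mod_geq not_less)
        also have "j - Suc b = Suc (i - Suc b) \<longleftrightarrow> j = Suc i" using 4 by linarith
        finally show ?thesis .
      qed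
    qed
    with carrier show ?case by blast
  qed
  moreover define q where "q = n div Suc b"
  moreover define k where "k = n - q * Suc b"
  moreover have "k = n mod Suc b" unfolding k_def q_def by (rule minus_div_mult_eq_mod)
  then have "k < Suc b" "q * Suc b + k = n"
    unfolding q_def by (simp_all only: mod_less_divisor zero_less_Suc div_mult_mod_eq)
  moreover have "block_shift_mat b n = B q k"
    unfolding block_shift_mat_def B_def k_def q_def Let_def by (simp only: Suc_eq_plus1)
  ultimately show ?thesis by metis
qed

lemma subshift_block_shift: "subshift n (block_shift_mat b n)"
  using block_shift_index[of b n] by (auto simp: subshift_def)

lemma shift_mat_eq_block_shift: "shift_mat n = block_shift_mat (n - 1) n"
proof (rule eq_matI)
  fix i j assume "i < dim_row (block_shift_mat (n - 1) n)" "j < dim_col (block_shift_mat (n - 1) n)"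
  then have ij: "i < n" "j < n" using block_shift_index[of "n - 1" n] by auto
  have "block_shift_mat (n - 1) n $$ (i, j) = (if j = Suc i \<and> Suc i mod Suc (n - 1) \<noteq> 0 then 1 else 0)"
    using block_shift_index[of "n - 1" n] ij by blast
  then show "shift_mat n $$ (i, j) = block_shift_mat (n - 1) n $$ (i, j)"
    using ij by (auto simp: shift_mat_def)
qed (use block_shift_index[of "n - 1" n] in \<open>auto simp: shift_mat_def\<close>)

lemma norm_minor_bij:
  assumes r: "bij_betw r {..<n} {..<n}" and c: "bij_betw c {..<n} {..<n}"
  shows "cmod (minor n (\<lambda>a b. G (r a) (c b))) = cmod (minor n G)"
proof -
  have perm: "(\<lambda>a. if a < n then f a else a) permutes {..<n}" if "bij_betw f {..<n} {..<n}" for f :: "nat \<Rightarrow> nat"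
  proof (rule bij_imp_permutes)
    show "bij_betw (\<lambda>a. if a < n then f a else a) {..<n} {..<n}"
      using that by (rule bij_betw_cong[THEN iffD1, rotated]) simp
  qed simp
  have "cmod (minor n (\<lambda>a b. G (r a) (c b))) =
      cmod (minor n (\<lambda>a b. G (if a < n then r a else a) (if b < n then c b else b)))"
    by (intro arg_cong[where f = cmod] minor_cong) auto
  also have "\<dots> = cmod (minor n (\<lambda>a b. G (if a < n then r a else a) b))"
    by (rule norm_minor_permute_cols[OF perm[OF c], of "\<lambda>a b. G (if a < n then r a else a) b"])
  also have "\<dots> = cmod (minor n G)" by (rule norm_minor_permute_rows[OF perm[OF r]])
  finally show ?thesis .
qed

text \<open>List the \<open>m\<close> rows that end a block last, and give to every row \<open>i\<close> the column \<open>i + 1\<close>, cyclically. Then the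
ones of the shift are on the diagonal of the first \<open>n - m\<close> rows.\<close>
lemma block_shift_reordering:
  assumes n: "0 < n"
  obtains r c m where "bij_betw r {..<n} {..<n}" "bij_betw c {..<n} {..<n}" "m \<le> n" "m \<le> n div Suc b + 1"
    "\<And>a j. a < n - m \<Longrightarrow> j < n - m \<Longrightarrow> block_shift_mat b n $$ (r a, c j) = (if a = j then 1 else 0)"
proof -
  define E where "E = {i. i < n \<and> (Suc i mod Suc b = 0 \<or> Suc i = n)}"
  define m where "m = card E"
  have E: "E \<subseteq> {..<n}" "finite E" by (auto simp: E_def intro: finite_subset[of _ "{..<n}"])
  have mn: "m \<le> n" using card_mono[OF _ E(1)] by (simp add: m_def)
  have cardU: "card ({..<n} - E) = n - m" using E by (simp add: card_Diff_subset m_def)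
  have "m \<le> n div Suc b + 1"
  proof -
    have "E \<subseteq> (\<lambda>q. q * Suc b - 1) ` {1..n div Suc b} \<union> {n - 1}"
    proof
      fix i assume "i \<in> E"
      then have i: "i < n" "Suc i mod Suc b = 0 \<or> Suc i = n" by (auto simp: E_def)
      show "i \<in> (\<lambda>q. q * Suc b - 1) ` {1..n div Suc b} \<union> {n - 1}"
      proof (cases "Suc i = n")
        case False
        then obtain q where q: "Suc i = q * Suc b" using i by (metis mod_eq_0_iff_dvd dvdE mult.commute)
        have "q \<noteq> 0" using q by (metis mult_is_0 nat.distinct(1))
        moreover have "q \<le> n div Suc b"
          using q i by (metis Suc_leI div_le_mono nonzero_mult_div_cancel_right nat.distinct(1))
        moreover have "i = q * Suc b - 1" using q by simp
        ultimately show ?thesis by auto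
      qed auto
    qed
    then have "m \<le> card ((\<lambda>q. q * Suc b - 1) ` {1..n div Suc b} \<union> {n - 1})"
      unfolding m_def by (intro card_mono) auto
    also have "\<dots> \<le> card ((\<lambda>q. q * Suc b - 1) ` {1..n div Suc b}) + card {n - 1}" by (rule card_Un_le)
    also have "\<dots> \<le> n div Suc b + 1" using card_image_le[of "{1..n div Suc b}" "\<lambda>q. q * Suc b - 1"] by simp
    finally show ?thesis .
  qed
  obtain f where f: "bij_betw f {..<n - m} ({..<n} - E)"

    unfolding lessThan_atLeast0[of "n - m"] using ex_bij_betw_nat_finite[of "{..<n} - E"] unfolding cardU by auto
  obtain g where g: "bij_betw g {..<m} E"
    using ex_bij_betw_nat_finite[OF E(2)] by (auto simp: m_def lessThan_atLeast0)
  define r where "r = (\<lambda>a. if a < n - m then f a else g (a - (n - m)))"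
  have r: "bij_betw r {..<n} {..<n}"
  proof -
    have "bij_betw (\<lambda>a. a - (n - m)) {n - m..<n} {..<m}"
      by (rule bij_betwI[where g = "\<lambda>a. a + (n - m)"]) (use mn in auto)
    then have "bij_betw (g \<circ> (\<lambda>a. a - (n - m))) {n - m..<n} E" using g by (rule bij_betw_trans)
    then have 1: "bij_betw r {n - m..<n} E" by (rule bij_betw_cong[THEN iffD1, rotated]) (auto simp: r_def)
    have 2: "bij_betw r {..<n - m} ({..<n} - E)"
      using f by (rule bij_betw_cong[THEN iffD1, rotated]) (auto simp: r_def)
    have "bij_betw r ({..<n - m} \<union> {n - m..<n}) (({..<n} - E) \<union> E)"
      by (rule bij_betw_combine[OF 2 1]) auto
    moreover have "{..<n - m} \<union> {n - m..<n} = {..<n}" "({..<n} - E) \<union> E = {..<n}" using E by auto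
    ultimately show ?thesis by simp
  qed
  define c where "c = (\<lambda>a. if Suc (r a) = n then 0 else Suc (r a))"
  have "bij_betw (\<lambda>i. if Suc i = n then 0 else Suc i) {..<n} {..<n}"
    by (rule bij_betwI[where g = "\<lambda>i. if i = 0 then n - 1 else i - 1"]) (use n in \<open>auto split: if_splits\<close>)
  then have "bij_betw ((\<lambda>i. if Suc i = n then 0 else Suc i) \<circ> r) {..<n} {..<n}"
    using r by (rule bij_betw_trans[rotated])
  then have c: "bij_betw c {..<n} {..<n}" by (simp add: c_def comp_def)
  have "block_shift_mat b n $$ (r a, c j) = (if a = j then 1 else 0)" if a: "a < n - m" and j: "j < n - m" for a j
  proof -
    have inner: "r i < n" "Suc (r i) \<noteq> n" "Suc (r i) mod Suc b \<noteq> 0" if "i < n - m" for i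
    proof -
      have "f i \<in> {..<n} - E" using bij_betwE[OF f] that by blast
      then show "r i < n" "Suc (r i) \<noteq> n" "Suc (r i) mod Suc b \<noteq> 0"
        using that by (simp_all add: r_def E_def)
    qed
    have "c j = Suc (r j)" using inner[OF j] by (simp add: c_def)
    moreover have "c j < n" using calculation inner[OF j] by simp
    ultimately have "block_shift_mat b n $$ (r a, c j) = (if Suc (r j) = Suc (r a) then 1 else 0)"
      using block_shift_index[of b n] inner[OF a] by auto
    moreover have "r j = r a \<longleftrightarrow> a = j"
      using r a j mn by (auto simp: bij_betw_def inj_on_def)
    ultimately show ?thesis by simp
  qed
  with r c mn \<open>m \<le> n div Suc b + 1\<close> show thesis by (rule that)
qed

section \<open>The law and the size of the perturbation\<close>

text \<open>The entries of an iid matrix, read in any order and with the normalisation \<open>1 / sqrt n\<close> removed, are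
distributed according to the product measure. This is what makes the estimates on the product space
available for the given probability spaces.\<close>
lemma scaled_entries_law:
  fixes M :: "'a measure" and N :: "'b measure" and x :: "'b \<Rightarrow> complex" and n :: nat
  defines "I \<equiv> {..<n} \<times> {..<n}" and "D \<equiv> distr N borel x"
  assumes M: "prob_space M" and N: "prob_space N" and x: "x \<in> borel_measurable N" and n: "0 < n"
    and iid: "iid_matrix M n \<Phi> (distr N borel (\<lambda>\<omega>. x \<omega> / complex_of_real (sqrt (real n))))"
    and \<pi>: "inj_on \<pi> I" "\<pi> ` I \<subseteq> I"
  defines "Y \<equiv> \<lambda>\<omega>. \<lambda>i\<in>I. complex_of_real (sqrt n) * \<Phi> \<omega> $$ \<pi> i"
  shows "Y \<in> measurable M (PiM I (\<lambda>_. D))" "distr M (PiM I (\<lambda>_. D)) Y = PiM I (\<lambda>_. D)"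
proof -
  interpret M: prob_space M by (rule M)
  interpret N: prob_space N by (rule N)
  let ?b = "PiM I (\<lambda>_. borel) :: (nat \<times> nat \<Rightarrow> complex) measure"
  have setsD: "sets D = sets borel" by (simp add: D_def)
  have probD: "prob_space D" unfolding D_def by (rule N.prob_space_distr[OF x])
  have setsP: "sets (PiM I (\<lambda>_. D)) = sets ?b" by (intro sets_PiM_cong) (auto simp: setsD)
  have I: "I \<noteq> {}" using n by (auto simp: I_def)
  have ind: "M.indep_vars (\<lambda>_. borel) (\<lambda>i \<omega>. \<Phi> \<omega> $$ i) I"
    and law: "\<And>i. i \<in> I \<Longrightarrow> distr M borel (\<lambda>\<omega>. \<Phi> \<omega> $$ i) = distr N borel (\<lambda>\<omega>. x \<omega> / complex_of_real (sqrt (real n)))"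
    using iid by (auto simp: iid_matrix_def I_def)
  have rv: "(\<lambda>\<omega>. \<Phi> \<omega> $$ i) \<in> borel_measurable M" if "i \<in> I" for i
    using ind that unfolding M.indep_vars_def by blast
  let ?X = "\<lambda>i \<omega>. complex_of_real (sqrt n) * \<Phi> \<omega> $$ i"
  have indX: "M.indep_vars (\<lambda>_. borel) ?X I"
    by (rule M.indep_vars_compose2[OF ind]) measurable
  have rvX: "?X i \<in> borel_measurable M" if "i \<in> I" for i using rv[OF that] by measurable
  have lawX: "distr M borel (?X i) = D" if i: "i \<in> I" for i
  proof -
    have "distr M borel (?X i) = distr (distr M borel (\<lambda>\<omega>. \<Phi> \<omega> $$ i)) borel (\<lambda>z. complex_of_real (sqrt n) * z)"
      using rv[OF i] by (subst distr_distr) (auto simp: comp_def)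
    also have "\<dots> = distr N borel (\<lambda>\<omega>. complex_of_real (sqrt n) * (x \<omega> / complex_of_real (sqrt n)))"
      unfolding law[OF i] using x by (subst distr_distr) (auto simp: comp_def)
    also have "(\<lambda>\<omega>. complex_of_real (sqrt n) * (x \<omega> / complex_of_real (sqrt n))) = x"
      using n by auto
    finally show ?thesis by (simp add: D_def)
  qed
  define Z where "Z = (\<lambda>\<omega>. \<lambda>i\<in>I. ?X i \<omega>)"
  have Zm: "Z \<in> measurable M ?b" unfolding Z_def using rvX by (intro measurable_restrict)
  have "distr M ?b Z = PiM I (\<lambda>i. distr M borel (?X i))"
    unfolding Z_def 
    using indX M.indep_vars_iff_distr_eq_PiM'[where M' = "\<lambda>_. borel" and X = ?X, OF I rvX] by blast
  also have "\<dots> = PiM I (\<lambda>_. D)" using lawX by (intro PiM_cong) auto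
  finally have Zlaw: "distr M ?b Z = PiM I (\<lambda>_. D)" .
  let ?t = "\<lambda>\<omega>. \<lambda>i\<in>I. \<omega> (\<pi> i)"
  have re: "distr (PiM I (\<lambda>_. D)) (PiM I (\<lambda>_. D)) ?t = PiM I (\<lambda>_. D)"
    using distr_PiM_reindex[of I "\<lambda>_. D" \<pi> I] probD \<pi> by auto
  have tm: "?t \<in> measurable ?b ?b"
    using \<pi> by (intro measurable_restrict measurable_component_singleton) auto
  have YZ: "Y = ?t \<circ> Z" using \<pi> by (auto simp: Y_def Z_def fun_eq_iff)
  have Ym: "Y \<in> measurable M ?b" unfolding YZ by (rule measurable_comp[OF Zm tm])
  then show "Y \<in> measurable M (PiM I (\<lambda>_. D))" using measurable_cong_sets[OF refl setsP] by blast
  have "distr M (PiM I (\<lambda>_. D)) Y = distr M ?b (?t \<circ> Z)"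
    unfolding YZ using setsP by (intro distr_cong) auto
  also have "\<dots> = distr (distr M ?b Z) ?b ?t" using Zm tm by (simp add: distr_distr)
  also have "\<dots> = distr (PiM I (\<lambda>_. D)) (PiM I (\<lambda>_. D)) ?t"
    unfolding Zlaw using setsP by (intro distr_cong) auto
  finally show "distr M (PiM I (\<lambda>_. D)) Y = PiM I (\<lambda>_. D)" using re by simp
qed

text \<open>Markov's inequality for the squared Hilbert-Schmidt norm, which is a sum of \<open>n\<^sup>2\<close> terms with mean
\<open>\<delta>\<^sup>2 / n\<close> each.\<close>
lemma perturbation_hs_small:
  fixes M :: "'a measure" and N :: "'b measure" and x :: "'b \<Rightarrow> complex" and n :: nat
  assumes M: "prob_space M" and x: "x \<in> borel_measurable N"
    and x2: "integrable N (\<lambda>\<omega>. (cmod (x \<omega>))\<^sup>2)" "(\<integral>\<omega>. (cmod (x \<omega>))\<^sup>2 \<partial>N) = 1"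
    and n: "0 < n"
    and iid: "iid_matrix M n \<Phi> (distr N borel (\<lambda>\<omega>. x \<omega> / complex_of_real (sqrt (real n))))"
    and h: "0 < h" and \<delta>: "0 \<le> \<delta>"
  shows "{\<omega> \<in> space M. h < hs_norm (complex_of_real \<delta> \<cdot>\<^sub>m \<Phi> \<omega>)} \<in> sets M"
    "measure M {\<omega> \<in> space M. h < hs_norm (complex_of_real \<delta> \<cdot>\<^sub>m \<Phi> \<omega>)} \<le> \<delta>\<^sup>2 * n / h\<^sup>2"
proof -
  interpret M: prob_space M by (rule M)
  let ?I = "{..<n} \<times> {..<n}"
  have ind: "M.indep_vars (\<lambda>_. borel) (\<lambda>i \<omega>. \<Phi> \<omega> $$ i) ?I"
    and law: "\<And>i. i \<in> ?I \<Longrightarrow> distr M borel (\<lambda>\<omega>. \<Phi> \<omega> $$ i) = distr N borel (\<lambda>\<omega>. x \<omega> / complex_of_real (sqrt (real n)))"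
    and dim: "\<And>\<omega>. \<omega> \<in> space M \<Longrightarrow> \<Phi> \<omega> \<in> carrier_mat n n"
    using iid by (auto simp: iid_matrix_def)
  have rv[measurable]: "(\<lambda>\<omega>. \<Phi> \<omega> $$ i) \<in> borel_measurable M" if "i \<in> ?I" for i
    using ind that unfolding M.indep_vars_def by blast
  have xn: "(\<lambda>\<omega>. x \<omega> / complex_of_real (sqrt (real n))) \<in> borel_measurable N" using x by measurable
  have x2n: "(\<lambda>\<omega>. (cmod (x \<omega> / complex_of_real (sqrt (real n))))\<^sup>2) = (\<lambda>\<omega>. (cmod (x \<omega>))\<^sup>2 / n)"
    by (auto simp: norm_divide power_divide)
  have sq: "(\<lambda>z :: complex. (cmod z)\<^sup>2) \<in> borel_measurable borel" by measurable
  have int: "integrable M (\<lambda>\<omega>. (cmod (\<Phi> \<omega> $$ i))\<^sup>2)" if i: "i \<in> ?I" for i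
  proof -
    have "integrable (distr N borel (\<lambda>\<omega>. x \<omega> / complex_of_real (sqrt (real n)))) (\<lambda>z. (cmod z)\<^sup>2)"
      unfolding integrable_distr_eq[OF xn sq] x2n using x2 by simp
    then show ?thesis unfolding law[OF i, symmetric] integrable_distr_eq[OF rv[OF i] sq] .
  qed
  have val: "(\<integral>\<omega>. (cmod (\<Phi> \<omega> $$ i))\<^sup>2 \<partial>M) = 1 / n" if i: "i \<in> ?I" for i
  proof -
    have "(\<integral>\<omega>. (cmod (\<Phi> \<omega> $$ i))\<^sup>2 \<partial>M) = (\<integral>z. (cmod z)\<^sup>2 \<partial>distr M borel (\<lambda>\<omega>. \<Phi> \<omega> $$ i))"
      by (rule integral_distr[OF rv[OF i] sq, symmetric])
    also have "\<dots> = (\<integral>\<omega>. (cmod (x \<omega>))\<^sup>2 / n \<partial>N)"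
      unfolding law[OF i] integral_distr[OF xn sq] x2n ..
    finally show ?thesis using x2 by simp
  qed
  define u where "u = (\<lambda>\<omega>. \<Sum>i\<in>?I. \<delta>\<^sup>2 * (cmod (\<Phi> \<omega> $$ i))\<^sup>2)"
  have u[measurable]: "u \<in> borel_measurable M" unfolding u_def by measurable
  have uint: "integrable M u" unfolding u_def using int by (intro Bochner_Integration.integrable_sum) auto
  have "(\<integral>\<omega>. u \<omega> \<partial>M) = (\<Sum>i\<in>?I. \<delta>\<^sup>2 * (1 / n))"
    unfolding u_def using int val by (subst Bochner_Integration.integral_sum) auto
  also have "\<dots> = \<delta>\<^sup>2 * n" using n by (simp add: field_simps)
  finally have uval: "(\<integral>\<omega>. u \<omega> \<partial>M) = \<delta>\<^sup>2 * n" .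
  have hu: "(hs_norm (complex_of_real \<delta> \<cdot>\<^sub>m \<Phi> \<omega>))\<^sup>2 = u \<omega>" if "\<omega> \<in> space M" for \<omega>
    unfolding hs_norm_sq u_def sum.cartesian_product' using dim[OF that] \<delta>
    by (auto simp: norm_mult power_mult_distrib intro!: sum.cong)
  have "{\<omega> \<in> space M. h < hs_norm (complex_of_real \<delta> \<cdot>\<^sub>m \<Phi> \<omega>)} = {\<omega> \<in> space M. h\<^sup>2 < u \<omega>}"
  proof (intro Collect_cong conj_cong refl)
    fix \<omega> assume "\<omega> \<in> space M"
    then show "h < hs_norm (complex_of_real \<delta> \<cdot>\<^sub>m \<Phi> \<omega>) \<longleftrightarrow> h\<^sup>2 < u \<omega>"
      using h hs_norm_nonneg unfolding hu[OF \<open>\<omega> \<in> space M\<close>, symmetric]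
      by (auto intro: power_strict_mono power2_less_imp_less)
  qed
  moreover have "{\<omega> \<in> space M. h\<^sup>2 < u \<omega>} \<in> sets M" by measurable
  moreover have "measure M {\<omega> \<in> space M. h\<^sup>2 < u \<omega>} \<le> \<delta>\<^sup>2 * n / h\<^sup>2"
  proof -
    have "measure M {\<omega> \<in> space M. h\<^sup>2 < u \<omega>} \<le> measure M {\<omega> \<in> space M. h\<^sup>2 \<le> u \<omega>}"
      by (intro M.finite_measure_mono) auto
    also have "\<dots> \<le> (\<integral>\<omega>. u \<omega> \<partial>M) / h\<^sup>2"
      by (rule integral_Markov_inequality_measure[OF uint, of "{}"])
         (use h in \<open>auto simp: u_def intro!: sum_nonneg\<close>)
    finally show ?thesis by (simp add: uval)
  qed
  ultimately show "{\<omega> \<in> space M. h < hs_norm (complex_of_real \<delta> \<cdot>\<^sub>m \<Phi> \<omega>)} \<in> sets M"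
    "measure M {\<omega> \<in> space M. h < hs_norm (complex_of_real \<delta> \<cdot>\<^sub>m \<Phi> \<omega>)} \<le> \<delta>\<^sup>2 * n / h\<^sup>2"
    by simp_all
qed

section \<open>Asymptotics of the determinant\<close>

context plane_law
begin

lemma spreads_mono:
  assumes spr: "spreads M \<tau> \<epsilon> K" and le: "\<tau>' \<le> \<tau>" "K \<le> K'"
  shows "spreads M \<tau>' \<epsilon> K'"
  unfolding spreads_def
proof (intro allI impI)
  fix J :: "(nat \<times> nat) set" and v a and \<sigma> :: real
  assume J: "finite J" and \<sigma>: "0 < \<sigma>" and card: "K' \<le> card {j\<in>J. \<sigma> \<le> cmod (v j)}"
  interpret P: prob_space "entries J" by (rule prob_space_entries)
  have "P.prob {x \<in> space (entries J). cmod ((\<Sum>j\<in>J. v j * x j) + a) < \<sigma> * \<tau>'}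
     \<le> P.prob {x \<in> space (entries J). cmod ((\<Sum>j\<in>J. v j * x j) + a) < \<sigma> * \<tau>}"
  proof (rule P.finite_measure_mono)
    show "{x \<in> space (entries J). cmod ((\<Sum>j\<in>J. v j * x j) + a) < \<sigma> * \<tau>} \<in> P.events" by measurable
    have "\<sigma> * \<tau>' \<le> \<sigma> * \<tau>" using le \<sigma> by (intro mult_left_mono) auto
    then show "{x \<in> space (entries J). cmod ((\<Sum>j\<in>J. v j * x j) + a) < \<sigma> * \<tau>'}
        \<subseteq> {x \<in> space (entries J). cmod ((\<Sum>j\<in>J. v j * x j) + a) < \<sigma> * \<tau>}" by auto
  qed
  also have "\<dots> \<le> \<epsilon>"
    using spr[unfolded spreads_def, rule_format, OF J \<sigma>] card le by simp
  finally show "P.prob {x \<in> space (entries J). cmod ((\<Sum>j\<in>J. v j * x j) + a) < \<sigma> * \<tau>'} \<le> \<epsilon>" .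
qed

text \<open>The normalisations \<open>\<tau> \<le> 1\<close> and \<open>c \<le> 1 / 2\<close> keep the factors lost per step at most \<open>1\<close> and the ratio \<open>1 - c\<close> of the
geometric series positive.\<close>
lemma anticoncentration_constants:
  obtains \<tau> c where "0 < \<tau>" "\<tau> \<le> 1" "0 < c" "c \<le> 1/2" "\<And>a. prob (ball a \<tau>) \<le> 1 - c"
    "\<And>\<epsilon>. \<epsilon> > 0 \<Longrightarrow> \<exists>K>0. spreads M \<tau> \<epsilon> K"
proof (rule weak_littlewood_offord)
  fix \<tau> c :: real
  assume 1: "0 < \<tau>" "0 < c" "c \<le> 1" "\<And>a. prob (ball a \<tau>) \<le> 1 - c"
    "\<And>\<epsilon>. \<epsilon> > 0 \<Longrightarrow> \<exists>K. spreads M \<tau> \<epsilon> K"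
  show thesis
  proof (rule that[of "min \<tau> 1" "min c (1/2)"])
    fix a
    have "prob (ball a (min \<tau> 1)) \<le> prob (ball a \<tau>)"
      by (intro finite_measure_mono) (auto simp: sets_law)
    also have "\<dots> \<le> 1 - c" by (rule 1)
    also have "\<dots> \<le> 1 - min c (1/2)" by simp
    finally show "prob (ball a (min \<tau> 1)) \<le> 1 - min c (1/2)" .
  next
    fix \<epsilon> :: real assume "\<epsilon> > 0"
    then obtain K where "spreads M \<tau> \<epsilon> K" using 1 by blast
    then have "spreads M (min \<tau> 1) \<epsilon> (Suc K)" by (rule spreads_mono) auto
    then show "\<exists>K>0. spreads M (min \<tau> 1) \<epsilon> K" by blast
  qed (use 1 in auto)
qed

end

lemma power_times_geometric_tendsto_0:
  fixes q :: real
  assumes q: "0 < q" "q < 1" and K: "0 < K"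
  shows "(\<lambda>n. real n ^ K * q ^ n) \<longlonglongrightarrow> 0"
proof -
  define r where "r = root K q"
  have r: "0 < r" "r < 1" "r ^ K = q" using q K by (auto simp: r_def)
  have "(\<lambda>n. (real n * r ^ n) ^ K) \<longlonglongrightarrow> 0 ^ K"
    using r by (intro tendsto_power powser_times_n_limit_0) auto
  moreover have "(real n * r ^ n) ^ K = real n ^ K * q ^ n" for n
    unfolding power_mult_distrib by (metis power_mult mult.commute r(3))
  ultimately show ?thesis using K by (simp add: zero_power)
qed

text \<open>With \<open>L = ln n\<close>, each of the \<open>m \<le> n / b + 1\<close> factors is at least \<open>exp (- C1 * L)\<close>, and the last \<open>d\<close> steps cost a
factor \<open>exp (- O(L))\<close>. The exponent is \<open>O((n / b + 1) * L)\<close>, which is \<open>o(n)\<close> because \<open>b / L\<close> tends to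
infinity. The factor \<open>(1 - h) ^ n\<close> of the identity block is not subexponential; it uses up the part
\<open>- ln (1 - h)\<close> of \<open>\<epsilon>\<close>.\<close>
lemma subexponential_loss:
  fixes b :: "nat \<Rightarrow> nat" and \<gamma> \<tau> h \<epsilon> :: real and d K :: nat
  assumes b: "\<forall>n\<ge>2. b n > 0" "filterlim (\<lambda>n. real (b n) / ln (real n)) at_top sequentially"
    and \<tau>: "0 < \<tau>" "\<tau> \<le> 1" and \<gamma>: "0 \<le> \<gamma>" and h: "0 \<le> h" "h < 1" "0 < \<epsilon> + ln (1 - h)"
  shows "eventually (\<lambda>n. \<forall>m \<le> n div Suc (b n) + 1. exp (- \<epsilon> * n) \<le>
    (1 - h) ^ n * (\<tau> * (real n powr (- \<gamma>) / sqrt n)) ^ m *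
      ((\<tau> * (real n powr (- \<gamma>) / sqrt n)) ^ K / (fact K * 2 ^ (K + 2) * real n)) ^ d) sequentially"
proof -
  \<comment> \<open>\<open>C1\<close> bounds the loss of one step, \<open>C2\<close> the combinatorial constant in \<open>s\<close>, and \<open>C3\<close> all losses together, in units of \<open>ln n\<close>.\<close>
  define C1 where "C1 = \<gamma> + 1/2 - ln \<tau>"
  define C2 where "C2 = ln (fact K * 2 ^ (K + 2) :: real)"
  define C3 where "C3 = C1 + d * (K * C1 + C2 + 1)"
  have ln\<tau>: "ln \<tau> \<le> 0" using \<tau> by simp
  have C1: "0 \<le> C1" using \<gamma> ln\<tau> by (simp add: C1_def)
  have "1 * 1 \<le> fact K * (2 ^ (K + 2) :: real)" by (intro mult_mono fact_ge_1 one_le_power) auto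
  then have C2: "0 \<le> C2" unfolding C2_def by (intro ln_ge_zero) simp
  have C3: "C1 \<le> C3" "d * (K * C1 + C2 + 1) \<le> C3" "0 \<le> C3" using C1 C2 by (auto simp: C3_def)
  have "(\<lambda>n. inverse (real (b n) / ln (real n))) \<longlonglongrightarrow> 0"
    by (rule tendsto_inverse_0_at_top[OF b(2)])
  then have l1: "(\<lambda>n. ln (real n) / real (b n)) \<longlonglongrightarrow> 0" by (simp add: inverse_eq_divide)
  have "(\<lambda>n. C3 * (ln (real n) / real (b n) + 2 * (ln (real n) / real n))) \<longlonglongrightarrow> C3 * (0 + 2 * 0)"
    by (intro tendsto_intros l1 lim_ln_over_n)
  then have ev: "eventually (\<lambda>n. C3 * (ln (real n) / real (b n) + 2 * (ln (real n) / real n)) < \<epsilon> + ln (1 - h)) sequentially"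
    using h(3) by (intro order_tendstoD) auto
  show ?thesis
    using ev eventually_ge_at_top[of 3]
  proof eventually_elim
    case (elim n)
    define L where "L = ln (real n)"
    have L: "1 \<le> L"
    proof -
      have "exp 1 \<le> real n" using elim(2) exp_le by linarith
      then show ?thesis unfolding L_def using elim(2) by (subst ln_ge_iff) auto
    qed
    have n: "real n = exp L" using elim(2) by (simp add: L_def)
    have bn: "0 < b n" using b(1) elim(2) by simp
    define \<kappa> where "\<kappa> = \<tau> * (real n powr (- \<gamma>) / sqrt n)"
    have "sqrt (real n) = exp (L / 2)"
      unfolding n by (rule real_sqrt_unique) (simp_all flip: exp_double)
    then have "real n powr (- \<gamma>) / sqrt n = exp (- \<gamma> * L) / exp (L / 2)"
      using elim(2) by (simp add: powr_def L_def)
    then have "\<kappa> = exp (ln \<tau>) * (exp (- \<gamma> * L) / exp (L / 2))" using \<tau> by (simp add: \<kappa>_def)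
    also have "\<dots> = exp (ln \<tau> + (- \<gamma> * L - L / 2))" by (simp only: exp_add exp_diff)
    also have "\<dots> \<ge> exp (- (C1 * L))"
    proof -
      have "ln \<tau> * L \<le> ln \<tau> * 1" using ln\<tau> L by (intro mult_left_mono_neg) auto
      moreover have "C1 * L = \<gamma> * L + L / 2 - ln \<tau> * L"
        unfolding C1_def left_diff_distrib distrib_right by simp
      ultimately show ?thesis by simp
    qed
    finally have \<kappa>: "exp (- (C1 * L)) \<le> \<kappa>" .
    have pow: "exp (- (j * (C1 * L))) \<le> \<kappa> ^ j" for j :: nat
    proof -
      have "exp (- (C1 * L)) ^ j \<le> \<kappa> ^ j" by (intro power_mono \<kappa>) auto
      then show ?thesis by (simp add: exp_of_nat_mult[symmetric])
    qed
    define s where "s = \<kappa> ^ K / (fact K * 2 ^ (K + 2) * real n)"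
    have s: "exp (- ((K * C1 + C2 + 1) * L)) \<le> s"
    proof -
      have den: "fact K * 2 ^ (K + 2) * real n = exp (C2 + L)"
        unfolding C2_def exp_add n by simp
      have "exp (- ((K * C1 + C2 + 1) * L)) \<le> exp (- (K * (C1 * L)) - (C2 + L))"
        using mult_left_mono[OF L C2] by (simp add: algebra_simps)
      also have "\<dots> = exp (- (K * (C1 * L))) / exp (C2 + L)" by (rule exp_diff)
      also have "\<dots> \<le> s" unfolding s_def den by (intro divide_right_mono pow) auto
      finally show ?thesis .
    qed
    have sd: "exp (- (d * (K * C1 + C2 + 1) * L)) \<le> s ^ d"
    proof -
      have "exp (- ((K * C1 + C2 + 1) * L)) ^ d \<le> s ^ d" by (intro power_mono s) auto
      then show ?thesis by (simp add: exp_of_nat_mult[symmetric] mult.assoc)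
    qed
    show ?case
    proof (intro allI impI)
      fix m assume m: "m \<le> n div Suc (b n) + 1"
      have "real m \<le> real (n div Suc (b n)) + 1" using m by linarith
      also have "real (n div Suc (b n)) \<le> real n / real (Suc (b n))" by (rule of_nat_div_le_of_nat)
      also have "\<dots> \<le> real n / real (b n)" using bn by (intro divide_left_mono) auto
      finally have mb: "real m \<le> n / b n + 1" by simp
      have "exp (- \<epsilon> * n) \<le> exp (n * ln (1 - h) - C3 * (m + 1) * L)"
      proof -
        have "C3 * (m + 1) * L \<le> C3 * (n / b n + 2) * L"
          using mb C3 L by (intro mult_right_mono mult_left_mono) auto
        also have "\<dots> = n * (C3 * (ln (real n) / real (b n) + 2 * (ln (real n) / real n)))"
          using elim(2) by (simp add: L_def field_simps)
        also have "\<dots> \<le> n * (\<epsilon> + ln (1 - h))" using elim(1) by (intro mult_left_mono) auto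
        finally show ?thesis by (simp add: algebra_simps)
      qed
      also have "\<dots> \<le> exp (n * ln (1 - h) + - (m * (C1 * L)) + - (d * (K * C1 + C2 + 1) * L))"
      proof -
        have "m * C1 \<le> m * C3" using C3 by (intro mult_left_mono) auto
        then have "m * C1 + d * (K * C1 + C2 + 1) \<le> C3 * (m + 1)" using C3(2) by (simp add: algebra_simps)
        then have "(m * C1 + d * (K * C1 + C2 + 1)) * L \<le> C3 * (m + 1) * L" using L by (intro mult_right_mono) auto
        then show ?thesis by (simp add: algebra_simps)
      qed
      also have "\<dots> = exp (n * ln (1 - h)) * exp (- (m * (C1 * L))) * exp (- (d * (K * C1 + C2 + 1) * L))"
        by (simp only: exp_add)
      also have "exp (n * ln (1 - h)) = (1 - h) ^ n" using h by (simp add: exp_of_nat_mult)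
      also have "(1 - h) ^ n * exp (- (m * (C1 * L))) * exp (- (d * (K * C1 + C2 + 1) * L)) \<le> (1 - h) ^ n * \<kappa> ^ m * s ^ d"
        using h pow sd by (intro mult_mono) (auto intro!: mult_nonneg_nonneg order_trans[OF _ pow])
      finally show "exp (- \<epsilon> * n) \<le> (1 - h) ^ n * (\<tau> * (real n powr (- \<gamma>) / sqrt n)) ^ m *
        ((\<tau> * (real n powr (- \<gamma>) / sqrt n)) ^ K / (fact K * 2 ^ (K + 2) * real n)) ^ d"
        unfolding s_def \<kappa>_def .
    qed
  qed
qed

lemma iid_matrix_entry_measurable:
  assumes "prob_space M" "iid_matrix M n \<Phi> D" "i < n" "j < n"
  shows "(\<lambda>\<omega>. \<Phi> \<omega> $$ (i, j)) \<in> borel_measurable M"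
  using assms by (auto simp: iid_matrix_def prob_space.indep_vars_def)

lemma det_eq_minor:
  assumes "A \<in> carrier_mat n n"
  shows "det A = minor n (\<lambda>i j. A $$ (i, j))"
proof -
  have "A = mat n n (\<lambda>(i, j). A $$ (i, j))" using assms by (intro eq_matI) auto
  then show ?thesis unfolding minor_def by simp
qed

text \<open>A variable that is almost surely equal to its mean has variance \<open>0\<close>.\<close>
lemma plane_law_distr:
  fixes x :: "'b \<Rightarrow> complex"
  assumes N: "prob_space N" and x: "x \<in> borel_measurable N"
    and mean: "(\<integral>\<omega>. x \<omega> \<partial>N) = 0" and var: "(\<integral>\<omega>. (cmod (x \<omega>))\<^sup>2 \<partial>N) = 1"
  shows "plane_law (distr N borel x)"
proof -
  interpret N: prob_space N by (rule N)
  interpret D: prob_space "distr N borel x" by (rule N.prob_space_distr[OF x])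
  show ?thesis
  proof
    fix a
    show "\<not> (AE z in distr N borel x. z = a)"
    proof
      assume "AE z in distr N borel x. z = a"
      then have AE: "AE \<omega> in N. x \<omega> = a" using x by (subst (asm) AE_distr_iff) auto
      then have "(\<integral>\<omega>. x \<omega> \<partial>N) = (\<integral>\<omega>. a \<partial>N)" using x by (intro integral_cong_AE) auto
      then have "a = 0" using mean N.prob_space by simp
      then have "(\<integral>\<omega>. (cmod (x \<omega>))\<^sup>2 \<partial>N) = (\<integral>\<omega>. 0 \<partial>N)"
        using AE x by (intro integral_cong_AE) auto
      then show False using var by simp
    qed
  qed simp
qed

text \<open>The parameters are chosen in the order \<open>d\<close>, \<open>K\<close>, \<open>n\<close>, each making one of the three terms in
\<open>determinant_lower_tail\<close> smaller than a third of the given bound \<open>\<eta>\<close>.\<close>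
lemma determinant_not_small:
  fixes N :: "'b measure" and x :: "'b \<Rightarrow> complex"
    and M :: "nat \<Rightarrow> 'a measure" and \<Phi> :: "nat \<Rightarrow> 'a \<Rightarrow> complex mat"
    and \<gamma> \<epsilon> h :: real and b :: "nat \<Rightarrow> nat"
  defines "\<delta> \<equiv> \<lambda>n. complex_of_real (real n powr (- \<gamma>))"
  assumes \<gamma>: "0 \<le> \<gamma>" and N: "prob_space N" and x: "x \<in> borel_measurable N"
    and mean: "(\<integral>\<omega>. x \<omega> \<partial>N) = 0" and var: "(\<integral>\<omega>. (cmod (x \<omega>))\<^sup>2 \<partial>N) = 1"
    and M: "\<And>n. prob_space (M n)"
    and iid: "\<And>n. iid_matrix (M n) n (\<Phi> n) (distr N borel (\<lambda>\<omega>. x \<omega> / complex_of_real (sqrt (real n))))"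
    and b: "\<forall>n\<ge>2. b n > 0" "filterlim (\<lambda>n. real (b n) / ln (real n)) at_top sequentially"
    and h: "0 \<le> h" "h < 1" "0 < \<epsilon> + ln (1 - h)"
  shows "(\<lambda>n. measure (M n) {\<omega> \<in> space (M n). hs_norm (\<delta> n \<cdot>\<^sub>m \<Phi> n \<omega>) \<le> h \<and>
     cmod (det (block_shift_mat (b n) n + \<delta> n \<cdot>\<^sub>m \<Phi> n \<omega>)) < exp (- \<epsilon> * n)}) \<longlonglongrightarrow> 0"
proof (rule tendstoI)
  define D where "D = distr N borel x"
  interpret L: plane_law D unfolding D_def by (rule plane_law_distr[OF N x mean var])
  fix \<eta> :: real assume \<eta>: "0 < \<eta>"
  show "eventually (\<lambda>n. dist (measure (M n) {\<omega> \<in> space (M n). hs_norm (\<delta> n \<cdot>\<^sub>m \<Phi> n \<omega>) \<le> h \<and>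
     cmod (det (block_shift_mat (b n) n + \<delta> n \<cdot>\<^sub>m \<Phi> n \<omega>)) < exp (- \<epsilon> * n)}) 0 < \<eta>) sequentially"
  proof (rule L.anticoncentration_constants)
    fix \<tau> c :: real
    assume \<tau>: "0 < \<tau>" "\<tau> \<le> 1" and c: "0 < c" "c \<le> 1/2" and ball: "\<And>a. L.prob (ball a \<tau>) \<le> 1 - c"
      and spr: "\<And>\<epsilon>. \<epsilon> > 0 \<Longrightarrow> \<exists>K>0. spreads D \<tau> \<epsilon> K"
    obtain d where d: "(1 - c) ^ d < \<eta> / 3 * c"
      using real_arch_pow_inv[of "\<eta> / 3 * c" "1 - c"] \<eta> c by auto
    define \<epsilon>' where "\<epsilon>' = \<eta> / (3 * (d + 1))"
    have \<epsilon>': "0 < \<epsilon>'" "real d * \<epsilon>' \<le> \<eta> / 3" using \<eta> by (auto simp: \<epsilon>'_def field_simps)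
    obtain K where K: "0 < K" "spreads D \<tau> \<epsilon>' K" using spr[OF \<epsilon>'(1)] by blast
    let ?q = "1 - c"
    have q: "0 < ?q" "?q < 1" using c by auto
    have "(\<lambda>n. real n ^ K * ?q ^ n * (real K / ?q ^ (d + K))) \<longlonglongrightarrow> 0 * (real K / ?q ^ (d + K))"
      by (intro tendsto_mult power_times_geometric_tendsto_0 q K tendsto_const)
    then have ev1: "eventually (\<lambda>n. real n ^ K * ?q ^ n * (real K / ?q ^ (d + K)) < \<eta> / 3) sequentially"
      using \<eta> by (intro order_tendstoD) auto
    show ?thesis
      using ev1 subexponential_loss[OF b \<tau> \<gamma> h, where d = d and K = K] eventually_gt_at_top[of "d + K"]
    proof eventually_elim
      case (elim n)
      then have n: "0 < n" "d + K < n" by auto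
      interpret Mn: prob_space "M n" by (rule M)
      obtain r cc m where rc: "bij_betw r {..<n} {..<n}" "bij_betw cc {..<n} {..<n}" "m \<le> n" "m \<le> n div Suc (b n) + 1"
        "\<And>a j. a < n - m \<Longrightarrow> j < n - m \<Longrightarrow> block_shift_mat (b n) n $$ (r a, cc j) = (if a = j then 1 else 0)"
        using block_shift_reordering[OF n(1), of "b n"] by metis
      let ?I = "{..<n} \<times> {..<n}"
      define \<pi> where "\<pi> = (\<lambda>i :: nat \<times> nat. (r (fst i), cc (snd i)))"
      have \<pi>: "bij_betw \<pi> ?I ?I"
        using bij_betw_map_prod[OF rc(1,2)] by (simp add: \<pi>_def map_prod_def case_prod_beta')
      define Y where "Y = (\<lambda>\<omega>. \<lambda>i\<in>?I. complex_of_real (sqrt n) * \<Phi> n \<omega> $$ \<pi> i)"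
      have Y: "Y \<in> measurable (M n) (PiM ?I (\<lambda>_. D))" "distr (M n) (PiM ?I (\<lambda>_. D)) Y = PiM ?I (\<lambda>_. D)"
        unfolding Y_def D_def
        using scaled_entries_law[OF M N x n(1) iid, of \<pi>] \<pi> by (auto simp: bij_betw_def)
      define \<kappa> where "\<kappa> = real n powr (- \<gamma>) / sqrt n"
      have \<kappa>: "0 < \<kappa>" "\<kappa> \<le> 1"
      proof -
        show "0 < \<kappa>" using n by (simp add: \<kappa>_def)
        have "real n powr (- \<gamma>) \<le> real n powr 0" using n \<gamma> by (intro powr_mono) auto
        also have "\<dots> \<le> sqrt n" using n by simp
        finally show "\<kappa> \<le> 1" using n by (simp add: \<kappa>_def)
      qed
      define T where "T = (\<lambda>a j. block_shift_mat (b n) n $$ (r a, cc j))"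
      define H where "H = (\<lambda>y a j. T a j + complex_of_real \<kappa> * y (a, j))"
      have rn: "r a < n" "cc a < n" if "a < n" for a using rc(1,2) that by (auto simp: bij_betw_def)
      define s where "s = (\<tau> * \<kappa>) ^ K / (fact K * 2 ^ (K + 2) * real n)"
      let ?E = "{y \<in> space (PiM ?I (\<lambda>_. D)). (\<Sum>i\<in>?I. (\<kappa> * cmod (y i))\<^sup>2) \<le> h\<^sup>2 \<and>
        cmod (minor n (H y)) < (1 - h) ^ n * (\<tau> * \<kappa>) ^ m * s ^ d}"
      have bound: "measure (PiM ?I (\<lambda>_. D)) ?E \<le> ?q ^ d / c + real n ^ K * (real K * ?q ^ (n - d - K)) + real d * \<epsilon>'"
        unfolding H_def
      proof (rule L.determinant_lower_tail[OF ball _ _ K(2) _ K(1) \<kappa> \<tau> h(1) _ n(2) rc(3)])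
        show "cmod (T a j) \<le> 1" if "a < n" "j < n" for a j
          unfolding T_def using subshift_le_1[OF subshift_block_shift rn(1)[OF that(1)] rn(2)[OF that(2)]] .
        show "T a j = (if a = j then 1 else 0)" if "a < n - m" "j < n - m" for a j
          unfolding T_def using rc(5)[OF that] .
      qed (use c \<epsilon>' h s_def in auto)
      have E: "?E \<in> sets (PiM ?I (\<lambda>_. D))"
      proof -
        have ent: "(\<lambda>y. H y a j) \<in> borel_measurable (PiM ?I (\<lambda>_. D))" if "a < n" "j < n" for a j
          unfolding H_def using that by (intro L.entry_measurable) auto
        have [measurable]: "(\<lambda>y. minor n (H y)) \<in> borel_measurable (PiM ?I (\<lambda>_. D))"
          by (rule minor_measurable) (rule ent)
        have "(\<lambda>y. (\<kappa> * cmod (y i))\<^sup>2) \<in> borel_measurable (PiM ?I (\<lambda>_. D))" if "i \<in> ?I" for i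
        proof -
          have [measurable]: "(\<lambda>y. y i) \<in> borel_measurable (PiM ?I (\<lambda>_. D))"
            using L.entry_measurable[OF that, of 0 1] by simp
          show ?thesis by measurable
        qed
        then have [measurable]: "(\<lambda>y. \<Sum>i\<in>?I. (\<kappa> * cmod (y i))\<^sup>2) \<in> borel_measurable (PiM ?I (\<lambda>_. D))"
          by (intro borel_measurable_sum)
        show ?thesis by measurable
      qed
      let ?F = "{\<omega> \<in> space (M n). hs_norm (\<delta> n \<cdot>\<^sub>m \<Phi> n \<omega>) \<le> h \<and>
         cmod (det (block_shift_mat (b n) n + \<delta> n \<cdot>\<^sub>m \<Phi> n \<omega>)) < exp (- \<epsilon> * n)}"
      have "?F \<subseteq> Y -` ?E \<inter> space (M n)"
      proof
        fix \<omega> assume "\<omega> \<in> ?F"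
        then have \<omega>: "\<omega> \<in> space (M n)" "hs_norm (\<delta> n \<cdot>\<^sub>m \<Phi> n \<omega>) \<le> h"
          "cmod (det (block_shift_mat (b n) n + \<delta> n \<cdot>\<^sub>m \<Phi> n \<omega>)) < exp (- \<epsilon> * n)" by auto
        have \<Phi>: "\<Phi> n \<omega> \<in> carrier_mat n n" using iid[of n] \<omega>(1) by (auto simp: iid_matrix_def)
        have B: "block_shift_mat (b n) n \<in> carrier_mat n n" using block_shift_index by blast
        have scale: "complex_of_real \<kappa> * Y \<omega> i = \<delta> n * \<Phi> n \<omega> $$ \<pi> i" if "i \<in> ?I" for i
        proof -
          have "complex_of_real \<kappa> * complex_of_real (sqrt n) = \<delta> n"
            using n unfolding \<kappa>_def \<delta>_def of_real_mult[symmetric] by simp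
          then show ?thesis using that by (simp add: Y_def mult.assoc[symmetric])
        qed
        have "(\<Sum>i\<in>?I. (\<kappa> * cmod (Y \<omega> i))\<^sup>2) = (\<Sum>i\<in>?I. (cmod (\<delta> n * \<Phi> n \<omega> $$ \<pi> i))\<^sup>2)"
        proof (intro sum.cong refl arg_cong[where f = "\<lambda>z. z\<^sup>2"])
          fix i assume "i \<in> ?I"
          from scale[OF this] show "\<kappa> * cmod (Y \<omega> i) = cmod (\<delta> n * \<Phi> n \<omega> $$ \<pi> i)"
            using \<kappa> by (metis norm_mult norm_of_real abs_of_pos)
        qed
        also have "\<dots> = (\<Sum>i\<in>?I. (cmod (\<delta> n * \<Phi> n \<omega> $$ i))\<^sup>2)"
          by (rule sum.reindex_bij_betw[OF \<pi>])
        also have "\<dots> = (hs_norm (\<delta> n \<cdot>\<^sub>m \<Phi> n \<omega>))\<^sup>2"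
          unfolding hs_norm_sq sum.cartesian_product' using \<Phi> by (auto intro!: sum.cong)
        also have "\<dots> \<le> h\<^sup>2" using \<omega>(2) by (intro power_mono) auto
        finally have 1: "(\<Sum>i\<in>?I. (\<kappa> * cmod (Y \<omega> i))\<^sup>2) \<le> h\<^sup>2" .
        let ?G = "\<lambda>i j. (block_shift_mat (b n) n + \<delta> n \<cdot>\<^sub>m \<Phi> n \<omega>) $$ (i, j)"
        have "minor n (H (Y \<omega>)) = minor n (\<lambda>a j. ?G (r a) (cc j))"
        proof (rule minor_cong)
          fix a j assume aj: "a < n" "j < n"
          then show "H (Y \<omega>) a j = ?G (r a) (cc j)"
            using rn(1)[OF aj(1)] rn(2)[OF aj(2)] B \<Phi> scale[of "(a, j)"] by (simp add: H_def T_def \<pi>_def)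
        qed
        then have "cmod (minor n (H (Y \<omega>))) = cmod (det (block_shift_mat (b n) n + \<delta> n \<cdot>\<^sub>m \<Phi> n \<omega>))"
          using norm_minor_bij[OF rc(1,2), of ?G] det_eq_minor[OF add_carrier_mat[OF smult_carrier_mat[OF \<Phi>]]]
          by (simp only:)
        also have "\<dots> < exp (- \<epsilon> * n)" by (rule \<omega>(3))
        also have "\<dots> \<le> (1 - h) ^ n * (\<tau> * \<kappa>) ^ m * s ^ d"
          unfolding s_def \<kappa>_def by (rule elim(2)[rule_format, OF rc(4)])
        finally have 2: "cmod (minor n (H (Y \<omega>))) < (1 - h) ^ n * (\<tau> * \<kappa>) ^ m * s ^ d" .
        show "\<omega> \<in> Y -` ?E \<inter> space (M n)"
          using 1 2 \<omega>(1) measurable_space[OF Y(1) \<omega>(1)] by simp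
      qed
      then have "Mn.prob ?F \<le> Mn.prob (Y -` ?E \<inter> space (M n))"
        using measurable_sets[OF Y(1) E] by (rule Mn.finite_measure_mono)
      also have "\<dots> = measure (distr (M n) (PiM ?I (\<lambda>_. D)) Y) ?E"
        by (rule measure_distr[OF Y(1) E, symmetric])
      also have "\<dots> \<le> ?q ^ d / c + real n ^ K * (real K * ?q ^ (n - d - K)) + real d * \<epsilon>'"
        unfolding Y(2) by (rule bound)
      also have "real n ^ K * (real K * ?q ^ (n - d - K)) = real n ^ K * ?q ^ n * (real K / ?q ^ (d + K))"
      proof -
        have "?q ^ (n - d - K) = ?q ^ n / ?q ^ (d + K)"
          using q n power_diff[of ?q "d + K" n] by simp
        then show ?thesis by simp
      qed
      also have "?q ^ d / c + real n ^ K * ?q ^ n * (real K / ?q ^ (d + K)) + real d * \<epsilon>' < \<eta>"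
      proof -
        have "?q ^ d / c < \<eta> / 3" using d c by (simp add: divide_less_eq)
        then show ?thesis using elim(1) \<epsilon>'(2) by linarith
      qed
      finally show ?case by simp
    qed
  qed
qed

section \<open>Convergence of the empirical spectral distribution\<close>

text \<open>For \<open>\<gamma> > 1/2\<close> the expected squared Hilbert-Schmidt norm of the perturbation, \<open>n powr (1 - 2 * \<gamma>)\<close>, tends
to \<open>0\<close>. Off the events that this norm exceeds a small \<open>h\<close>, or that the determinant is below
\<open>exp (- \<epsilon> * n)\<close>, the criterion for equidistribution applies to the eigenvalues.\<close>
lemma esd_converges_block_shift:
  fixes N :: "'b measure" and x :: "'b \<Rightarrow> complex"
    and M :: "nat \<Rightarrow> 'a measure" and \<Phi> :: "nat \<Rightarrow> 'a \<Rightarrow> complex mat"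
    and \<gamma> :: real and b :: "nat \<Rightarrow> nat"
  assumes \<gamma>: "\<gamma> > 1/2" and N: "prob_space N" and x: "x \<in> borel_measurable N"
    and mean: "(\<integral>\<omega>. x \<omega> \<partial>N) = 0"
    and int2: "integrable N (\<lambda>\<omega>. (cmod (x \<omega>))\<^sup>2)" and var: "(\<integral>\<omega>. (cmod (x \<omega>))\<^sup>2 \<partial>N) = 1"
    and M: "\<And>n. prob_space (M n)"
    and iid: "\<And>n. iid_matrix (M n) n (\<Phi> n) (distr N borel (\<lambda>\<omega>. x \<omega> / complex_of_real (sqrt (real n))))"
    and b: "\<forall>n\<ge>2. b n > 0" "filterlim (\<lambda>n. real (b n) / ln (real n)) at_top sequentially"
  shows "esd_converges_in_prob M
      (\<lambda>n \<omega>. block_shift_mat (b n) n + complex_of_real (real n powr (- \<gamma>)) \<cdot>\<^sub>m \<Phi> n \<omega>) uniform_circle"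
  unfolding esd_converges_in_prob_def converges_in_prob_def
proof (intro allI impI conjI)
  fix g :: "complex \<Rightarrow> complex" assume "test_function g"
  then have "Ck_plane 0 g" unfolding test_function_def by blast
  then have g: "continuous_on UNIV g" by simp
  define \<delta> where "\<delta> = (\<lambda>n. complex_of_real (real n powr (- \<gamma>)))"
  define A where "A = (\<lambda>n \<omega>. block_shift_mat (b n) n + \<delta> n \<cdot>\<^sub>m \<Phi> n \<omega>)"
  have \<Phi>c: "\<Phi> n \<omega> \<in> carrier_mat n n" if "\<omega> \<in> space (M n)" for n \<omega>
    using iid[of n] that by (auto simp: iid_matrix_def)
  have Bc: "block_shift_mat (b n) n \<in> carrier_mat n n" for n using block_shift_index by blast
  have Ac: "A n \<omega> \<in> carrier_mat n n" if "\<omega> \<in> space (M n)" for n \<omega>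
    unfolding A_def using \<Phi>c[OF that] Bc by simp
  have Am: "(\<lambda>\<omega>. A n \<omega> $$ (i, j)) \<in> borel_measurable (M n)" if ij: "i < n" "j < n" for n i j
  proof -
    have [measurable]: "(\<lambda>\<omega>. \<Phi> n \<omega> $$ (i, j)) \<in> borel_measurable (M n)"
      by (rule iid_matrix_entry_measurable[OF M iid ij])
    have "(\<lambda>\<omega>. A n \<omega> $$ (i, j)) \<in> borel_measurable (M n) \<longleftrightarrow>
      (\<lambda>\<omega>. block_shift_mat (b n) n $$ (i, j) + \<delta> n * \<Phi> n \<omega> $$ (i, j)) \<in> borel_measurable (M n)"
    proof (rule measurable_cong)
      fix \<omega> assume "\<omega> \<in> space (M n)"
      then show "A n \<omega> $$ (i, j) = block_shift_mat (b n) n $$ (i, j) + \<delta> n * \<Phi> n \<omega> $$ (i, j)"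
        unfolding A_def using ij Bc[of n] \<Phi>c[of \<omega> n] by simp
    qed
    then show ?thesis by simp
  qed
  show "(\<lambda>\<omega>. \<integral>z. g z \<partial>esd (block_shift_mat (b n) n + complex_of_real (real n powr (- \<gamma>)) \<cdot>\<^sub>m \<Phi> n \<omega>))
      \<in> borel_measurable (M n)" for n
    using measurable_integral_esd[OF g Ac Am, of n] by (simp add: A_def \<delta>_def)
  fix \<epsilon>0 :: real assume \<epsilon>0: "0 < \<epsilon>0"
  obtain L \<epsilon> where \<epsilon>: "0 < \<epsilon>"
    and crit: "\<And>es. \<lbrakk>es \<noteq> []; \<forall>e\<in>set es. cmod e \<le> 1 + \<epsilon>; exp (- \<epsilon> * length es) \<le> cmod (prod_list es);
        \<forall>k\<in>{1..L}. cmod (\<Sum>e\<leftarrow>es. e ^ k) \<le> \<epsilon> * length es\<rbrakk> \<Longrightarrow>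
        dist ((\<Sum>e\<leftarrow>es. g e) /\<^sub>R length es) (\<integral>z. g z \<partial>uniform_circle) \<le> \<epsilon>0"
    using equidistribution_criterion[OF g \<epsilon>0] by metis
  \<comment> \<open>The bounds serve the power sums up to \<open>L\<close>, the requirement \<open>h < 1\<close>, and \<open>- ln (1 - h) < \<epsilon>\<close>.\<close>
  define h where "h = min (\<epsilon> / 2 ^ L) (min (1/2) ((1 - exp (- \<epsilon>)) / 2))"
  have e1: "exp (- \<epsilon>) < 1" using \<epsilon> by simp
  have h: "0 < h" "h \<le> 1/2" "2 ^ L * h \<le> \<epsilon>" "h < 1 - exp (- \<epsilon>)"
  proof -
    show "0 < h" using \<epsilon> e1 by (simp add: h_def)
    show "h \<le> 1/2" unfolding h_def by (intro min.coboundedI2 min.cobounded1)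
    have "h \<le> \<epsilon> / 2 ^ L" by (simp add: h_def)
    then show "2 ^ L * h \<le> \<epsilon>" by (simp add: field_simps)
    have "h \<le> (1 - exp (- \<epsilon>)) / 2" unfolding h_def by (intro min.coboundedI2 min.cobounded2)
    moreover have "u < 1 - v" if "u \<le> (1 - v) / 2" "v < 1" for u v :: real using that by simp
    ultimately show "h < 1 - exp (- \<epsilon>)" using e1 by blast
  qed
  have hl: "0 < \<epsilon> + ln (1 - h)"
  proof -
    have "ln (exp (- \<epsilon>)) < ln (1 - h)" using h by (subst ln_less_cancel_iff) auto
    then show ?thesis by simp
  qed
  have h\<epsilon>: "h \<le> \<epsilon>"
  proof -
    have "1 * h \<le> 2 ^ L * h" using h by (intro mult_right_mono) auto
    then show ?thesis using h(3) by simp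
  qed
  let ?bad1 = "\<lambda>n. {\<omega> \<in> space (M n). h < hs_norm (\<delta> n \<cdot>\<^sub>m \<Phi> n \<omega>)}"
  let ?bad2 = "\<lambda>n. {\<omega> \<in> space (M n). hs_norm (\<delta> n \<cdot>\<^sub>m \<Phi> n \<omega>) \<le> h \<and> cmod (det (A n \<omega>)) < exp (- \<epsilon> * n)}"
  let ?dev = "\<lambda>n. {\<omega> \<in> space (M n). dist (\<integral>z. g z \<partial>esd (A n \<omega>)) (\<integral>z. g z \<partial>uniform_circle) > \<epsilon>0}"
  have good: "dist (\<integral>z. g z \<partial>esd (A n \<omega>)) (\<integral>z. g z \<partial>uniform_circle) \<le> \<epsilon>0"
    if n: "0 < n" and \<omega>: "\<omega> \<in> space (M n)" "hs_norm (\<delta> n \<cdot>\<^sub>m \<Phi> n \<omega>) \<le> h"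
      "exp (- \<epsilon> * n) \<le> cmod (det (A n \<omega>))" for n \<omega>
  proof -
    have Ec: "\<delta> n \<cdot>\<^sub>m \<Phi> n \<omega> \<in> carrier_mat n n" using \<Phi>c[OF \<omega>(1)] by simp
    obtain es where es: "length es = n" "proots (char_poly (A n \<omega>)) = mset es" "det (A n \<omega>) = prod_list es"
      "\<forall>k. mat_trace (A n \<omega> ^\<^sub>m k) = (\<Sum>e\<leftarrow>es. e ^ k)"
      by (rule spectrum_list[OF Ac[OF \<omega>(1)]])
    have ne: "es \<noteq> []" using es n by auto
    have c1: "cmod e \<le> 1 + \<epsilon>" if "e \<in> set es" for e
    proof -
      have "cmod e \<le> 1 + hs_norm (\<delta> n \<cdot>\<^sub>m \<Phi> n \<omega>)"
        using that es(2) unfolding A_def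
        by (intro spectral_bound_perturbed_subshift[OF subshift_block_shift[of n "b n"] Ec]) simp
      then show ?thesis using \<omega>(2) h\<epsilon> by linarith
    qed
    have c2: "cmod (\<Sum>e\<leftarrow>es. e ^ k) \<le> \<epsilon> * n" if k: "k \<in> {1..L}" for k
    proof -
      have "cmod (mat_trace (A n \<omega> ^\<^sub>m k)) \<le> sqrt n * (2 ^ k * hs_norm (\<delta> n \<cdot>\<^sub>m \<Phi> n \<omega>))"
        unfolding A_def using \<omega>(2) h k
        by (intro trace_perturbed_subshift_pow[OF subshift_block_shift[of n "b n"] Ec]) auto
      also have "\<dots> \<le> real n * (2 ^ L * h)"
      proof (intro mult_mono)
        show "sqrt n \<le> real n" using n by (simp add: real_le_lsqrt power2_eq_square)
      qed (use \<omega>(2) k h in \<open>auto intro: power_increasing\<close>)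
      also have "\<dots> \<le> real n * \<epsilon>" using h by (intro mult_left_mono) auto
      finally show ?thesis using es(4) by (simp add: mult.commute)
    qed
    have "(\<integral>z. g z \<partial>esd (A n \<omega>)) = (\<Sum>e\<leftarrow>es. g e) /\<^sub>R length es"
      by (rule integral_esd[OF g es(2) ne])
    moreover have "exp (- \<epsilon> * length es) \<le> cmod (prod_list es)"
      using \<omega>(3) unfolding es(1,3) .
    ultimately show ?thesis using crit[OF ne] c1 c2 es(1) by simp
  qed
  have small1: "?bad1 n \<in> sets (M n) \<and> measure (M n) (?bad1 n) \<le> real n powr (1 - 2 * \<gamma>) / h\<^sup>2" if n: "0 < n" for n
  proof -
    have "(real n powr (- \<gamma>))\<^sup>2 * n = real n powr (1 - 2 * \<gamma>)"
    proof -
      have "real n powr (1 - 2 * \<gamma>) = real n powr (1 + (- \<gamma> + - \<gamma>))" by simp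
      also have "\<dots> = real n powr 1 * (real n powr (- \<gamma>) * real n powr (- \<gamma>))"
        by (simp only: powr_add)
      finally show ?thesis using n by (simp add: power2_eq_square)
    qed
    then show ?thesis
      using perturbation_hs_small[OF M x int2 var n iid h(1), of "real n powr (- \<gamma>)"]
      unfolding \<delta>_def by (simp only: powr_ge_zero simp_thms)
  qed
  have bad2m: "?bad2 n \<in> sets (M n)" if n: "0 < n" for n
  proof -
    have "(\<lambda>\<omega>. minor n (\<lambda>i j. A n \<omega> $$ (i, j))) \<in> borel_measurable (M n)"
      by (rule minor_measurable) (rule Am)
    then have [measurable]: "(\<lambda>\<omega>. det (A n \<omega>)) \<in> borel_measurable (M n)"
      using measurable_cong[of "M n" "\<lambda>\<omega>. det (A n \<omega>)" "\<lambda>\<omega>. minor n (\<lambda>i j. A n \<omega> $$ (i, j))"] det_eq_minor[OF Ac]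
      by simp
    have "{\<omega> \<in> space (M n). cmod (det (A n \<omega>)) < exp (- \<epsilon> * n)} \<in> sets (M n)" by measurable
    then have "{\<omega> \<in> space (M n). cmod (det (A n \<omega>)) < exp (- \<epsilon> * n)} - ?bad1 n \<in> sets (M n)"
      using small1[OF n, THEN conjunct1] by (rule sets.Diff)
    moreover have "{\<omega> \<in> space (M n). cmod (det (A n \<omega>)) < exp (- \<epsilon> * n)} - ?bad1 n = ?bad2 n"
      by (auto simp only: mem_Collect_eq Diff_iff not_less)
    ultimately show ?thesis by simp
  qed
  have "(\<lambda>n. measure (M n) (?bad2 n)) \<longlonglongrightarrow> 0"
    unfolding A_def \<delta>_def
    by (rule determinant_not_small[OF _ N x mean var M iid b _ _ hl]) (use \<gamma> h in auto)
  moreover have "(\<lambda>n. real n powr (1 - 2 * \<gamma>) / h\<^sup>2) \<longlonglongrightarrow> 0 / h\<^sup>2"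
    using \<gamma> h by (intro tendsto_divide tendsto_const tendsto_neg_powr filterlim_real_sequentially) auto
  ultimately have lim: "(\<lambda>n. real n powr (1 - 2 * \<gamma>) / h\<^sup>2 + measure (M n) (?bad2 n)) \<longlonglongrightarrow> 0"
    using tendsto_add by fastforce
  have "(\<lambda>n. measure (M n) (?dev n)) \<longlonglongrightarrow> 0"
  proof (rule tendsto_sandwich[OF _ _ tendsto_const lim])
    show "eventually (\<lambda>n. measure (M n) (?dev n) \<le> real n powr (1 - 2 * \<gamma>) / h\<^sup>2 + measure (M n) (?bad2 n)) sequentially"
      using eventually_gt_at_top[of 0]
    proof eventually_elim
      case (elim n)
      interpret Mn: prob_space "M n" by (rule M)
      have "?dev n \<subseteq> ?bad1 n \<union> ?bad2 n"
      proof
        fix \<omega> assume \<omega>: "\<omega> \<in> ?dev n"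
        consider "h < hs_norm (\<delta> n \<cdot>\<^sub>m \<Phi> n \<omega>)"
          | "hs_norm (\<delta> n \<cdot>\<^sub>m \<Phi> n \<omega>) \<le> h" "cmod (det (A n \<omega>)) < exp (- \<epsilon> * n)"
          | "hs_norm (\<delta> n \<cdot>\<^sub>m \<Phi> n \<omega>) \<le> h" "exp (- \<epsilon> * n) \<le> cmod (det (A n \<omega>))"
          by (meson not_less)
        then show "\<omega> \<in> ?bad1 n \<union> ?bad2 n"
        proof cases
          case 3
          from good[OF elim _ 3] \<omega> show ?thesis by force
        qed (use \<omega> in auto)
      qed
      then have "Mn.prob (?dev n) \<le> Mn.prob (?bad1 n \<union> ?bad2 n)"
        using small1[OF elim] bad2m[OF elim] by (intro Mn.finite_measure_mono) auto
      also have "\<dots> \<le> Mn.prob (?bad1 n) + Mn.prob (?bad2 n)"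
        using small1[OF elim] bad2m[OF elim] by (intro measure_Un_le) auto
      finally show ?case using small1[OF elim] by linarith
    qed
  qed simp
  then show "(\<lambda>n. measure (M n) {\<omega> \<in> space (M n).
      dist (\<integral>z. g z \<partial>esd (block_shift_mat (b n) n + complex_of_real (real n powr (- \<gamma>)) \<cdot>\<^sub>m \<Phi> n \<omega>))
        (\<integral>z. g z \<partial>uniform_circle) > \<epsilon>0}) \<longlonglongrightarrow> 0"
    by (simp add: A_def \<delta>_def)
qed

lemma full_block_dominates_log:
  "filterlim (\<lambda>n. real (n - 1) / ln (real n)) at_top sequentially"
proof (rule filterlim_at_top_mono)
  have "(\<lambda>n. 2 * (ln (real n) / real n)) \<longlonglongrightarrow> 2 * 0" by (intro tendsto_intros lim_ln_over_n)
  moreover have "eventually (\<lambda>n. 0 < 2 * (ln (real n) / real n)) sequentially"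
    using eventually_ge_at_top[of 2] by eventually_elim simp
  ultimately show "filterlim (\<lambda>n. inverse (2 * (ln (real n) / real n))) at_top sequentially"
    by (intro filterlim_inverse_at_top) simp_all
  show "eventually (\<lambda>n. inverse (2 * (ln (real n) / real n)) \<le> real (n - 1) / ln (real n)) sequentially"
    using eventually_ge_at_top[of 2]
  proof eventually_elim
    case (elim n)
    have "(real n / 2) / ln (real n) \<le> real (n - 1) / ln (real n)"
      using elim by (intro divide_right_mono) auto
    then show ?case using elim by (simp add: field_simps)
  qed
qed

theorem theorem5:
  fixes N :: "'b measure" and x :: "'b \<Rightarrow> complex"
    and M :: "nat \<Rightarrow> 'a measure" and \<Phi> :: "nat \<Rightarrow> 'a \<Rightarrow> complex mat"
    and \<gamma> :: real
  assumes "\<gamma> > 1.5"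
    and "prob_space N"
    and "x \<in> borel_measurable N"
    and "integrable N x" and "(\<integral>\<omega>. x \<omega> \<partial>N) = 0"
    and "integrable N (\<lambda>\<omega>. (cmod (x \<omega>))\<^sup>2)" and "(\<integral>\<omega>. (cmod (x \<omega>))\<^sup>2 \<partial>N) = 1"
    and "\<And>n. prob_space (M n)"
    and "\<And>n. iid_matrix (M n) n (\<Phi> n)
           (distr N borel (\<lambda>\<omega>. x \<omega> / complex_of_real (sqrt (real n))))"
  shows "(\<forall>b :: nat \<Rightarrow> nat.
            (\<forall>n\<ge>2. b n > 0) \<and>
            filterlim (\<lambda>n. real (b n) / ln (real n)) at_top sequentially \<longrightarrow>
            esd_converges_in_prob M
              (\<lambda>n \<omega>. block_shift_mat (b n) n
                 + complex_of_real (real n powr (- \<gamma>)) \<cdot>\<^sub>m \<Phi> n \<omega>)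
              uniform_circle) \<and>
         esd_converges_in_prob M
           (\<lambda>n \<omega>. shift_mat n + complex_of_real (real n powr (- \<gamma>)) \<cdot>\<^sub>m \<Phi> n \<omega>)
           uniform_circle"
proof -
  have "1 / 2 < \<gamma>" using assms(1) by simp
  note block = esd_converges_block_shift[OF this assms(2,3,5-9)]
  show ?thesis
  proof (intro conjI allI impI)
    fix b :: "nat \<Rightarrow> nat"
    assume "(\<forall>n\<ge>2. b n > 0) \<and> filterlim (\<lambda>n. real (b n) / ln (real n)) at_top sequentially"
    then show "esd_converges_in_prob M (\<lambda>n \<omega>. block_shift_mat (b n) n
        + complex_of_real (real n powr (- \<gamma>)) \<cdot>\<^sub>m \<Phi> n \<omega>) uniform_circle"
      using block by blast
  next
    show "esd_converges_in_prob M (\<lambda>n \<omega>. shift_mat n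
        + complex_of_real (real n powr (- \<gamma>)) \<cdot>\<^sub>m \<Phi> n \<omega>) uniform_circle"
      unfolding shift_mat_eq_block_shift
      by (rule block[of "\<lambda>n. n - 1", OF _ full_block_dominates_log]) simp
  qed
qed

end
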